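(* Let $F\in X_\lambda$ be a closed point, and let $\mu=(\mu_1,\dots,\mu_c)$ be the unique coarsening of $\lambda$ with $F\in X_\mu^\circ$. Then: (i) $F$ is nonsingular in $X_\lambda$ if and only if there is only one splitting $\delta^1,\dots,\delta^c$ of $\mu$ into $\lambda$, and $\delta^k$ is even for all $k\in\{1,\dots,c\}$; (ii) the number of closed points in $f_\lambda^{-1}(F)$ equals the number of splittings of $\mu$ into $\lambda$; (iii) there is a closed point $G\in f_\lambda^{-1}(F)$ such that the induced map on tangent spaces $df_\lambda: T_{Y_\lambda,G}\to T_{\mathbb{P}(\mathrm{Sym}^dV),F}$ is not an isomorphism if and only if there is a splitting $\delta^1,\dots,\delta^c$ of $\mu$ into $\lambda$ such that $\delta^k$ is not even for some $k\in\{1,\dots,c\}$.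
   Context: Let $K$ be an algebraically closed field of characteristic zero, $d\ge 1$ an integer, $V=K[x,y]_1$ the space of linear forms in $x,y$. A closed point $(a_0:\cdots:a_k)$ of $\mathbb{P}(\mathrm{Sym}^kV)\cong\mathbb{P}^k_K$ is identified with the binary form $\sum_{j=0}^k a_jx^{k-j}y^j$ up to scalars in $K^*$. Let $\lambda=(\lambda_1,\dots,\lambda_e)$ be a partition of $d$, also written $\lambda=(1^{e_1}2^{e_2}\cdots d^{e_d})$, where $e_r\ge0$ is the number of $\lambda_i$ equal to $r$. Put $Y_\lambda=\prod_{r=1}^d\mathbb{P}(\mathrm{Sym}^{e_r}V)$, let $f_\lambda:Y_\lambda\to\mathbb{P}(\mathrm{Sym}^dV)$ be the morphism $(G_1,\dots,G_d)\mapsto\prod_{r=1}^dG_r^r$, and let the coincident root locus $X_\lambda=\mathrm{im}(f_\lambda)$ be its image, an integral closed subscheme of $\mathbb{P}(\mathrm{Sym}^dV)$; its closed points are the forms $\prod_{i=1}^eL_i^{\lambda_i}$ with $L_1,\dots,L_e$ nonzero linear forms. A partition $\mu$ of $d$ is a coarsening of $\lambda$ if $\lambda$ is a refinement of $\mu$ (i.e. $\mu$ arises from $\lambda$ by grouping the parts of $\lambda$ and summing within each group; $\mu=\lambda$ is allowed); then $X_\mu\subseteq X_\lambda$. Define $X_\mu^\circ=X_\mu\setminus\bigcup_\omega X_\omega$, where $\omega$ runs over all coarsenings $\omega\ne\mu$ of $\mu$. For every closed point $F\in X_\lambda$ there is exactly one coarsening $\mu$ of $\lambda$ with $F\in X_\mu^\circ$.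 Let $\mu=(\mu_1,\dots,\mu_c)$ be a coarsening of $\lambda$, with a fixed order of its entries. A splitting of $\mu$ into $\lambda$ is a tuple $\delta^1,\dots,\delta^c$, where $\delta^k$ is a partition of $\mu_k$ for each $k$ and the parts of $\delta^1,\dots,\delta^c$ taken together (as a multiset) are exactly the parts of $\lambda$. Two splittings are equal if and only if their $k$-th partitions are equal for each $k$ (e.g. for $\mu=(2,2)$, $\lambda=(1,1,2)$ there are two splittings: $(1,1),(2)$ and $(2),(1,1)$). A partition is even if all its entries are equal.
   Formalization: In (iii), "not an isomorphism" is replaced by "not injective" (not an isomorphism onto its image): literally (iii) fails, e.g. for d=2, λ=(2), F=x², where the only splitting is even but the tangent map goes from dimension 1 to dimension 2. *)

theory Defs
  imports
    "HOL-Algebra.Ideal"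
    "HOL-Computational_Algebra.Polynomial"
    "HOL-Library.Poly_Mapping"
    "HOL-Library.Multiset"
    "HOL-Library.FuncSet"
    "HOL-Library.Extended_Nat"
begin

section \<open>Partitions, coarsenings and splittings\<close>

definition partition_of :: "nat \<Rightarrow> nat multiset \<Rightarrow> bool" where
  "partition_of d lam \<longleftrightarrow> 0 \<notin># lam \<and> sum_mset lam = d"

text \<open>\<open>coarsening mu lam\<close>: \<open>mu\<close> arises from \<open>lam\<close> by distributing the parts of \<open>lam\<close> over
  a multiset \<open>D\<close> of nonempty groups and summing within each group.\<close>

definition coarsening :: "nat multiset \<Rightarrow> nat multiset \<Rightarrow> bool" where
  "coarsening mu lam \<longleftrightarrow>
     (\<exists>D. (\<forall>B\<in>#D. B \<noteq> {#}) \<and> sum_mset D = lam \<and> image_mset sum_mset D = mu)"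

definition splittings :: "nat list \<Rightarrow> nat multiset \<Rightarrow> nat multiset list set" where
  "splittings mu lam =
     {\<delta>. length \<delta> = length mu \<and> (\<forall>k<length mu. partition_of (mu ! k) (\<delta> ! k)) \<and> sum_list \<delta> = lam}"

definition even_partition :: "nat multiset \<Rightarrow> bool" where
  "even_partition lam \<longleftrightarrow> (\<forall>a\<in>#lam. \<forall>b\<in>#lam. a = b)"


section \<open>Binary forms and projective spaces of binary forms\<close>

text \<open>The ring $K[x,y]$ is \<open>'a poly poly\<close>; the outer variable is $x$ and the inner one is $y$, so that
  \<open>coeff (coeff G i) j\<close> is the coefficient of $x^i y^j$ in \<open>G\<close>, and multiplication by a scalar
  \<open>c\<close> is \<open>smult [:c:]\<close>.\<close>

definition forms :: "nat \<Rightarrow> 'a::field poly poly set" where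
  "forms k = {G. \<forall>i j. coeff (coeff G i) j \<noteq> 0 \<longrightarrow> i + j = k}"

definition coords :: "nat \<Rightarrow> 'a::field poly poly \<Rightarrow> nat \<Rightarrow> 'a" where
  "coords k G j = coeff (coeff G (k - j)) j"

definition prop_rel :: "('a::field poly poly \<times> 'a poly poly) set" where
  "prop_rel = {(G, H). \<exists>c. c \<noteq> 0 \<and> H = smult [:c:] G}"

text \<open>Closed points of $\mathbb{P}(\mathrm{Sym}^k V)$; a point is the set of all forms representing it.
  For \<open>k = 0\<close> this is a single point.\<close>

definition proj_forms :: "nat \<Rightarrow> 'a::field poly poly set set" where
  "proj_forms k = (forms k - {0}) // prop_rel"


section \<open>The morphism \<open>f_lam\<close> and coincident root loci\<close>

text \<open>Here $e_r$ is \<open>count lam r\<close>. The union in \<open>f_map\<close> ranges over all choices of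
  representatives \<open>g r\<close> of the points \<open>GG r\<close>; all of them give the same class.\<close>

definition Y_locus :: "nat \<Rightarrow> nat multiset \<Rightarrow> (nat \<Rightarrow> 'a::field poly poly set) set" where
  "Y_locus d lam = PiE {1..d} (\<lambda>r. proj_forms (count lam r))"

definition f_map :: "nat \<Rightarrow> (nat \<Rightarrow> 'a::field poly poly set) \<Rightarrow> 'a poly poly set" where
  "f_map d GG = (\<Union>g\<in>PiE {1..d} GG. prop_rel `` {\<Prod>r\<in>{1..d}. g r ^ r})"

definition X_locus :: "nat \<Rightarrow> nat multiset \<Rightarrow> 'a::field poly poly set set" where
  "X_locus d lam = f_map d ` Y_locus d lam"

definition X_open :: "nat \<Rightarrow> nat multiset \<Rightarrow> 'a::field poly poly set set" where
  "X_open d mu = X_locus d mu - (\<Union>\<omega>\<in>{\<omega>. coarsening \<omega> mu \<and> \<omega> \<noteq> mu}. X_locus d \<omega>)"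

definition fibre :: "nat \<Rightarrow> nat multiset \<Rightarrow> 'a::field poly poly set
    \<Rightarrow> (nat \<Rightarrow> 'a poly poly set) set" where
  "fibre d lam F = {GG \<in> Y_locus d lam. f_map d GG = F}"


section \<open>Tangent spaces\<close>

text \<open>A tangent vector at a closed point is a point with values in the dual numbers
  $K[\epsilon]/(\epsilon^2)$ lying over it. For a point \<open>P\<close> of
  $\mathbb{P}(W)$ these are the elements $w + \epsilon v$ with \<open>w \<in> P\<close> and $v \<in> W$, up to
  multiplication by the units $a + b\epsilon$ with \<open>a \<noteq> 0\<close>; after fixing \<open>w\<close> this is the
  usual $W / K w$. The element $w + \epsilon v$ is the pair \<open>(w, v)\<close>.\<close>

definition unit_rel ::
    "(('a::field poly poly \<times> 'a poly poly) \<times> ('a poly poly \<times> 'a poly poly)) set" where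
  "unit_rel = {((w, v), (w', v')). \<exists>a b. a \<noteq> 0 \<and> w' = smult [:a:] w
                                       \<and> v' = smult [:a:] v + smult [:b:] w}"

definition tangent_space ::
    "nat \<Rightarrow> 'a::field poly poly set \<Rightarrow> ('a poly poly \<times> 'a poly poly) set set" where
  "tangent_space k P = (P \<times> forms k) // unit_rel"

definition tangent_Y :: "nat \<Rightarrow> nat multiset \<Rightarrow> (nat \<Rightarrow> 'a::field poly poly set)
    \<Rightarrow> (nat \<Rightarrow> ('a poly poly \<times> 'a poly poly) set) set" where
  "tangent_Y d lam GG = PiE {1..d} (\<lambda>r. tangent_space (count lam r) (GG r))"

text \<open>The differential is $(w_r + \epsilon v_r)_r \mapsto \prod_r (w_r + \epsilon v_r)^r$,
  computed in polynomials in $\epsilon$ over $K[x,y]$ and truncated modulo $\epsilon^2$. Since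
  $\dim Y_\lambda$ is the number of parts of \<open>lam\<close>, which is smaller than \<open>d\<close> unless all parts are
  \<open>1\<close>, the differential can only be an isomorphism onto its image; failure of this means that it is
  not injective, and for this the underlying map of sets suffices.\<close>

definition df_map :: "nat \<Rightarrow> (nat \<Rightarrow> ('a::field poly poly \<times> 'a poly poly) set)
    \<Rightarrow> ('a poly poly \<times> 'a poly poly) set" where
  "df_map d \<xi> = (\<Union>u\<in>PiE {1..d} \<xi>. unit_rel ``
     {let p = (\<Prod>r\<in>{1..d}. [: fst (u r), snd (u r) :] ^ r) in (coeff p 0, coeff p 1)})"


section \<open>Local rings and nonsingular points\<close>

type_synonym 'a mpoly = "(nat \<Rightarrow>\<^sub>0 nat) \<Rightarrow>\<^sub>0 'a"

definition mpoly_eval :: "(nat \<Rightarrow> 'a::field) \<Rightarrow> 'a mpoly \<Rightarrow> 'a" where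
  "mpoly_eval a p = (\<Sum>m\<in>Poly_Mapping.keys p. Poly_Mapping.lookup p m *
      (\<Prod>i\<in>Poly_Mapping.keys m. a i ^ Poly_Mapping.lookup m i))"

text \<open>Homogeneous polynomials of degree \<open>n\<close> in the coordinates $a_0, \dots, a_d$
  of $\mathbb{P}(\mathrm{Sym}^d V)$, and their vanishing at a closed point.\<close>

definition hom_polys :: "nat \<Rightarrow> nat \<Rightarrow> 'a::field mpoly set" where
  "hom_polys d n = {p. \<forall>m\<in>Poly_Mapping.keys p. Poly_Mapping.keys m \<subseteq> {0..d} \<and>
      (\<Sum>i\<in>Poly_Mapping.keys m. Poly_Mapping.lookup m i) = n}"

definition zero_at :: "nat \<Rightarrow> 'a::field mpoly \<Rightarrow> 'a poly poly set \<Rightarrow> bool" where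
  "zero_at d p P \<longleftrightarrow> (\<forall>G\<in>P. mpoly_eval (coords d G) p = 0)"

text \<open>The local ring of a closed subvariety \<open>X\<close> (with its reduced structure) at \<open>F\<close> consists of
  the germs of fractions $p/q$ of homogeneous polynomials of equal degree with
  $q(F) \<noteq> 0$. Two fractions have the same germ if they agree at the points of \<open>X\<close> in some
  principal open neighbourhood \<open>s \<noteq> 0\<close> of \<open>F\<close>.\<close>

definition fracs_at :: "nat \<Rightarrow> 'a::field poly poly set \<Rightarrow> ('a mpoly \<times> 'a mpoly) set" where
  "fracs_at d F = {(p, q). (\<exists>n. p \<in> hom_polys d n \<and> q \<in> hom_polys d n) \<and> \<not> zero_at d q F}"

definition germ_rel :: "nat \<Rightarrow> 'a::field poly poly set set \<Rightarrow> 'a poly poly set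
    \<Rightarrow> (('a mpoly \<times> 'a mpoly) \<times> ('a mpoly \<times> 'a mpoly)) set" where
  "germ_rel d X F = {((p, q), (p', q')). (p, q) \<in> fracs_at d F \<and> (p', q') \<in> fracs_at d F \<and>
      (\<exists>n s. s \<in> hom_polys d n \<and> \<not> zero_at d s F \<and>
         (\<forall>P\<in>X. zero_at d (s * (p * q' - p' * q)) P))}"

definition local_ring :: "nat \<Rightarrow> 'a::field poly poly set set \<Rightarrow> 'a poly poly set
    \<Rightarrow> ('a mpoly \<times> 'a mpoly) set ring" where
  "local_ring d X F =
    \<lparr> carrier = fracs_at d F // germ_rel d X F,
      monoid.mult = (\<lambda>A B. \<Union>(p, q)\<in>A. \<Union>(p', q')\<in>B. germ_rel d X F `` {(p * p', q * q')}),
      one = germ_rel d X F `` {(1, 1)},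
      zero = germ_rel d X F `` {(0, 1)},
      add = (\<lambda>A B. \<Union>(p, q)\<in>A. \<Union>(p', q')\<in>B. germ_rel d X F `` {(p * q' + p' * q, q * q')}) \<rparr>"

text \<open>Krull dimension: the supremum of the lengths \<open>n\<close> of chains $P_0 \subset \dots \subset P_n$
  of prime ideals.\<close>

definition krull_dim :: "('b, 'm) ring_scheme \<Rightarrow> enat" where
  "krull_dim R = (SUP n\<in>{n. \<exists>P :: nat \<Rightarrow> 'b set.
      (\<forall>i\<le>n. primeideal (P i) R) \<and> (\<forall>i<n. P i \<subset> P (Suc i))}. enat n)"

text \<open>\<open>F\<close> is nonsingular in \<open>X\<close> if its local ring is a regular local ring, i.e. if the maximal
  ideal of this (automatically Noetherian) local ring \<open>R\<close> is generated by \<open>krull_dim R\<close>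
  elements.\<close>

definition nonsingular_at :: "nat \<Rightarrow> 'a::field poly poly set set \<Rightarrow> 'a poly poly set \<Rightarrow> bool" where
  "nonsingular_at d X F \<longleftrightarrow> (let R = local_ring d X F in
     \<exists>S \<subseteq> carrier R. finite S \<and> maximalideal (genideal R S) R \<and> enat (card S) = krull_dim R)"

end

theory Submission
  imports Defs "HOL-Library.Function_Algebras" "HOL-Combinatorics.Permutations"
    "HOL-Computational_Algebra.Polynomial_FPS"
begin

text \<open>Over a chart everything becomes a statement about monic polynomials in one variable. Choose \<open>c\<close> such
  that \<open>F\<close> does not vanish at $(1 : c)$ and restrict forms to the affine line $x = X$, $y = 1 + c X$. The points of the
  chart are the monic polynomials of degree \<open>d\<close>, the locus $X_\lambda$ consists of the products
  $\prod_{i=1}^e (X - t_i)^{\lambda_i}$, and $F$ is $f = \prod_k (X - a_k)^{\mu_k}$ with distinct $a_k$ because it lies in $X_\mu^\circ$.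

  A point of the fibre is a factorization $f = \prod_r g_r^r$. By unique factorization it amounts to a distribution of the
  parts of $\lambda$ over the roots $a_k$, which is a splitting (\<open>split_factors_bij\<close>). A tangent vector
  $(y_r)$ is killed by the differential if $\sum_r r\,y_r/g_r$ is constant. If no root occurs in two
  of the factors, the poles must cancel one by one and the vector is zero; if a root occurs in two of them, opposite motions
  of it compensate each other (\<open>tangent_map_injective_iff\<close>). A root occurs in several factors exactly if its
  partition is not even.

  For nonsingularity, the local ring is described as the ring of fractions of the algebra $C$ of those functions of
  $t = (t_1, \dots, t_e)$ which are polynomials in the coefficients of $\prod_i (X - t_i)^{\lambda_i}$. Its dimension is $e$: fixing
  one root after the other gives a chain of primes of length $e$, and a longer chain would yield more than $e$
  algebraically independent polynomial functions of $e$ variables, which a count of monomials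
  excludes (\<open>krull_dim_eq\<close>).

  If $F$ is nonsingular, the derivations of $C$ at the point form a space of dimension at most $e$. Moving distinct
  roots $t_i$ near the point gives all variations $Q X^h$ with $h < e$ and $Q = \prod_i (X - t_i)^{\lambda_i - 1}$, by Lagrange
  interpolation, and these stay tangent in the limit where roots collide. So for each assignment of the parts to the roots,
  the limit of $Q$ accounts for all tangent vectors, and there is none of smaller degree. But the
  difference of two limits would be such a vector; and if a root carried different parts, the first-order change of $Q$
  along a suitable curve would be one as well. Hence each root carries equal parts, and their number is determined by the multiplicity
  of the root in $Q$: the splitting is unique and even (\<open>unique_even_splitting\<close>).

  Conversely, let the splitting be unique and even. On the fibre of $t \mapsto \prod_i (X - t_i)^{\lambda_i}$ over $f$, taken as a
  scheme, the Chinese remainder theorem gives idempotents that tell which $t_i$ specializes to which $a_k$. They show that the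
  power sums of each block $\{t_i : \lambda_i = r\}$ are constant there (\<open>block_sum_fibre_const\<close>), and therefore
  so are all functions symmetric in the blocks. The fibre algebra being finite, Nakayama's lemma turns this into the statement that such
  functions lie in the local ring (\<open>common_denominator\<close>). In particular it contains the coefficients
  of $\prod_{\lambda_i = r} (X - t_i)$ for all $r$; these are $e$ elements, and every element of $C$ is a polynomial in them, so their
  differences from their values at the point generate the maximal ideal (\<open>nonsingular\<close>).\<close>

section \<open>Binary forms as polynomials in one variable\<close>

definition bieval :: "'a::comm_ring_1 poly poly \<Rightarrow> 'a \<Rightarrow> 'a \<Rightarrow> 'a" where
  "bieval G x y = poly (poly G [:x:]) y"

lemma bieval_simps [simp]:
  "bieval (G + H) x y = bieval G x y + bieval H x y"
  "bieval (G * H) x y = bieval G x y * bieval H x y"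
  "bieval (smult [:a:] G) x y = a * bieval G x y"
  "bieval (G ^ n) x y = bieval G x y ^ n"
  "bieval 0 x y = 0" "bieval 1 x y = 1"
  by (simp_all add: bieval_def)

lemma bieval_sum: "bieval (sum F I) x y = (\<Sum>i\<in>I. bieval (F i) x y)"
  by (simp add: bieval_def poly_sum)

lemma coords_add: "coords k (G + H) j = coords k G j + coords k H j"
  and coords_smult: "coords k (smult [:a:] G) j = a * coords k G j"
  by (simp_all add: coords_def)

lemma coords_sum: "coords k (sum F I) j = (\<Sum>i\<in>I. coords k (F i) j)"
  by (simp add: coords_def coeff_sum)

lemma form_expansion:
  assumes "G \<in> forms k"
  shows "G = (\<Sum>j\<le>k. monom (monom (coords k G j) j) (k - j))"
proof (intro poly_eqI)
  fix i j
  have "coeff (coeff (\<Sum>j\<le>k. monom (monom (coords k G j) j) (k - j)) i) j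
      = (\<Sum>j'\<le>k. if k - j' = i \<and> j' = j then coords k G j' else 0)"
    by (simp add: coeff_sum coeff_monom if_distrib[of "\<lambda>p. coeff p j"] if_distribR)
       (auto intro!: sum.cong)
  also have "\<dots> = (if i + j = k then coords k G j else 0)"
  proof (cases "i + j = k")
    case True
    then have "(\<Sum>j'\<le>k. if k - j' = i \<and> j' = j then coords k G j' else 0)
        = (\<Sum>j'\<le>k. if j' = j then coords k G j' else 0)" by (intro sum.cong) auto
    then show ?thesis using True by simp
  next
    case False
    then show ?thesis by (auto intro!: sum.neutral)
  qed
  also have "\<dots> = coeff (coeff G i) j"
    using assms by (auto simp: forms_def coords_def)
  finally show "coeff (coeff G i) j
      = coeff (coeff (\<Sum>j\<le>k. monom (monom (coords k G j) j) (k - j)) i) j" by simp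
qed

lemma bieval_form:
  assumes "G \<in> forms k"
  shows "bieval G x y = (\<Sum>j\<le>k. coords k G j * (x ^ (k - j) * y ^ j))"
proof -
  have "bieval (monom (monom a j) i) x y = a * (x ^ i * y ^ j)" for a i j
    by (simp add: bieval_def poly_monom)
  then have "bieval (\<Sum>j\<le>k. monom (monom (coords k G j) j) (k - j)) x y
      = (\<Sum>j\<le>k. coords k G j * (x ^ (k - j) * y ^ j))" by (simp add: bieval_sum)
  then show ?thesis by (simp flip: form_expansion[OF assms])
qed

lemma forms_add: "G \<in> forms k \<Longrightarrow> H \<in> forms k \<Longrightarrow> G + H \<in> forms k"
  unfolding forms_def
proof (clarsimp)
  fix i j
  assume *: "\<forall>i j. coeff (coeff G i) j \<noteq> 0 \<longrightarrow> i + j = k" "\<forall>i j. coeff (coeff H i) j \<noteq> 0 \<longrightarrow> i + j = k"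
    and nz: "coeff (coeff G i) j + coeff (coeff H i) j \<noteq> 0"
  from nz have "coeff (coeff G i) j \<noteq> 0 \<or> coeff (coeff H i) j \<noteq> 0" by auto
  with * show "i + j = k" by blast
qed

lemma forms_smult: "G \<in> forms k \<Longrightarrow> smult [:a:] G \<in> forms k"
  by (auto simp: forms_def)

lemma forms_0 [simp]: "0 \<in> forms k"
  by (simp add: forms_def)

lemma forms_sum: "(\<And>i. i \<in> I \<Longrightarrow> F i \<in> forms k) \<Longrightarrow> sum F I \<in> forms k"
  by (induction I rule: infinite_finite_induct) (auto intro: forms_add)

lemma forms_mult: assumes "G \<in> forms j" "H \<in> forms k" shows "G * H \<in> forms (j + k)"
  unfolding forms_def
proof (clarify, rule ccontr)
  fix n m assume nz: "coeff (coeff (G * H) n) m \<noteq> 0" and ne: "n + m \<noteq> j + k"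
  have "coeff (coeff G i) i' * coeff (coeff H (n - i)) (m - i') = 0" if "i \<le> n" "i' \<le> m" for i i'
  proof (rule ccontr)
    assume "\<not> ?thesis"
    then have "i + i' = j" "(n - i) + (m - i') = k" using assms by (auto simp: forms_def)
    then show False using that ne by linarith
  qed
  then have "coeff (coeff (G * H) n) m = 0"
    unfolding coeff_mult coeff_sum by (intro sum.neutral ballI) auto
  with nz show False by simp
qed

lemma forms_1: "1 \<in> forms 0"
  by (auto simp: forms_def split: if_splits)

lemma forms_power: "G \<in> forms k \<Longrightarrow> G ^ n \<in> forms (n * k)"
  by (induction n) (auto simp: forms_1 intro: forms_mult)

lemma forms_prod: "(\<And>i. i \<in> I \<Longrightarrow> F i \<in> forms (k i)) \<Longrightarrow> prod F I \<in> forms (sum k I)"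
  by (induction I rule: infinite_finite_induct) (auto simp: forms_1 intro: forms_mult)

text \<open>Restriction of a form to the line through $(0, 1)$ with direction $(1, c)$. The
  coefficient of $X^k$ is the value of the form at the point $(1 : c)$ at infinity.\<close>
definition dehom :: "'a::comm_ring_1 \<Rightarrow> 'a poly poly \<Rightarrow> 'a poly" where
  "dehom c G = (\<Sum>i\<le>degree G. pcompose (coeff G i) [:1, c:] * [:0, 1:] ^ i)"

lemma poly_dehom: "poly (dehom c G) z = bieval G z (1 + c * z)"
  unfolding dehom_def bieval_def poly_altdef[of G]
  by (simp add: poly_sum poly_pcompose algebra_simps)

lemma poly_ext: "(\<And>z. poly p z = poly q z) \<Longrightarrow> p = q" for p q :: "'a::field_char_0 poly"
  using poly_eq_poly_eq_iff[of p q] by (simp add: fun_eq_iff)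

context
  fixes c :: "'a::field_char_0"
begin

lemma dehom_simps [simp]:
  "dehom c (G + H) = dehom c G + dehom c H" "dehom c (G * H) = dehom c G * dehom c H"
  "dehom c (smult [:a:] G) = smult a (dehom c G)" "dehom c (G ^ n) = dehom c G ^ n"
  "dehom c 0 = 0" "dehom c 1 = 1"
  by (rule poly_ext; simp add: poly_dehom)+

lemma dehom_sum: "dehom c (sum F I) = (\<Sum>i\<in>I. dehom c (F i))"
  by (induction I rule: infinite_finite_induct) auto

lemma dehom_prod: "dehom c (prod F I) = (\<Prod>i\<in>I. dehom c (F i))"
  by (induction I rule: infinite_finite_induct) auto

lemma dehom_form:
  assumes "G \<in> forms k"
  shows "dehom c G = (\<Sum>j\<le>k. smult (coords k G j) ([:0, 1:] ^ (k - j) * [:1, c:] ^ j))"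
  by (rule poly_ext) (simp add: poly_dehom bieval_form[OF assms] poly_sum algebra_simps)

lemma degree_dehom: assumes "G \<in> forms k" shows "degree (dehom c G) \<le> k"
  unfolding dehom_form[OF assms]
proof (rule degree_sum_le)
  fix j assume "j \<in> {..k}"
  have "degree ([:0, 1::'a:] ^ (k - j) * [:1, c:] ^ j) \<le> degree ([:0, 1::'a:] ^ (k - j)) + degree ([:1, c:] ^ j)"
    by (rule degree_mult_le)
  also have "\<dots> \<le> (k - j) + j"
    by (intro add_mono order.trans[OF degree_power_le]) auto
  finally have "degree ([:0, 1::'a:] ^ (k - j) * [:1, c:] ^ j) \<le> k" using \<open>j \<in> {..k}\<close> by simp
  then show "degree (smult (coords k G j) ([:0, 1:] ^ (k - j) * [:1, c:] ^ j)) \<le> k"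
    by (rule order.trans[OF degree_smult_le])
qed simp

lemma coeff_dehom_top:
  assumes "G \<in> forms k"
  shows "coeff (dehom c G) k = poly (\<Sum>j\<le>k. monom (coords k G j) j) c"
proof -
  have top: "coeff ([:1, c:] ^ j) j = c ^ j" for j
  proof (induction j)
    case (Suc j)
    have "degree ([:1, c:] ^ j) \<le> j" by (rule order.trans[OF degree_power_le]) simp
    then have "coeff ([:1, c:] ^ j) (Suc j) = 0" by (intro coeff_eq_0) simp
    with Suc show ?case by (simp add: coeff_pCons)
  qed simp
  have "coeff ([:0, 1:] ^ (k - j) * [:1, c:] ^ j) k = c ^ j" if "j \<le> k" for j
  proof -
    have "[:0, 1:] ^ (k - j) = monom (1::'a) (k - j)" by (simp add: monom_altdef)
    then show ?thesis using that top[of j] by (simp add: coeff_monom_mult)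
  qed
  then show ?thesis by (simp add: dehom_form[OF assms] coeff_sum poly_sum poly_monom)
qed

text \<open>On the line, $y/x$ takes every value except \<open>c\<close>; the factor $X - c$ in the proof takes
  care of this value.\<close>
lemma dehom_eq_0: assumes "G \<in> forms k" "dehom c G = 0" shows "G = 0"
proof -
  define p where "p = (\<Sum>j\<le>k. monom (coords k G j) j)"
  have "poly (p * [:- c, 1:]) y = poly 0 y" for y
  proof (cases "y = c")
    case False
    define z where "z = 1 / (y - c)"
    have "1 + c * z = y * z" using False by (simp add: z_def field_simps)
    then have "bieval G z (y * z) = 0" using poly_dehom[of c G z] assms(2) by simp
    then have "(\<Sum>j\<le>k. coords k G j * (z ^ (k - j) * (y * z) ^ j)) = 0"
      by (simp add: bieval_form[OF assms(1)])
    moreover have "coords k G j * (z ^ (k - j) * (y * z) ^ j) = z ^ k * (coords k G j * y ^ j)"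
      if "j \<le> k" for j
      using power_add[of z "k - j" j] that by (simp add: power_mult_distrib)
    ultimately have "z ^ k * poly p y = 0"
      by (simp add: p_def poly_sum poly_monom sum_distrib_left)
    then show ?thesis using False by (simp add: z_def)
  qed simp
  then have "p * [:- c, 1:] = 0" by (rule poly_ext)
  then have "p = 0" by (simp only: mult_eq_0_iff) simp
  have "coords k G j = 0" if "j \<le> k" for j
  proof -
    have "coeff p j = coords k G j" using that by (simp add: p_def coeff_sum coeff_monom)
    with \<open>p = 0\<close> show ?thesis by simp
  qed
  then show "G = 0" by (subst form_expansion[OF assms(1)]) simp
qed

lemma dehom_inj: assumes "G \<in> forms k" "H \<in> forms k" "dehom c G = dehom c H" shows "G = H"
proof -
  have "G + smult [:- 1:] H \<in> forms k" using assms by (intro forms_add forms_smult)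
  moreover have "dehom c (G + smult [:- 1:] H) = 0" using assms by simp
  ultimately have "G + smult [:- 1:] H = 0" by (rule dehom_eq_0)
  moreover have "smult [:- 1:] H = - H" by (simp add: poly_eq_iff)
  ultimately show ?thesis by simp
qed

text \<open>The form $x^i (y - c x)^{k-i}$, which restricts to $X^i$ since $y - c x$ is $1$ on the line.\<close>
definition homog_basis :: "nat \<Rightarrow> nat \<Rightarrow> 'a poly poly" where
  "homog_basis k i = [:0, 1:] ^ i * [:[:0, 1:], [:- c:]:] ^ (k - i)"

definition homog :: "nat \<Rightarrow> 'a poly \<Rightarrow> 'a poly poly" where
  "homog k g = (\<Sum>i\<le>k. smult [:coeff g i:] (homog_basis k i))"

lemma hom_basis_forms: assumes "i \<le> k" shows "homog_basis k i \<in> forms k"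
proof -
  have "[:0, 1:] \<in> forms 1" "[:[:0, 1:], [:- c:]:] \<in> forms 1"
    by (auto simp: forms_def coeff_pCons split: nat.splits)
  then have "homog_basis k i \<in> forms (i * 1 + (k - i) * 1)"
    unfolding homog_basis_def by (intro forms_mult forms_power)
  with assms show ?thesis by simp
qed

lemma homog_forms [simp]: "homog k g \<in> forms k"
  unfolding homog_def by (intro forms_sum forms_smult hom_basis_forms) auto

lemma coords_homog: "coords k (homog k g) j = (\<Sum>i\<le>k. coeff g i * coords k (homog_basis k i) j)"
  by (simp add: homog_def coords_sum coords_smult)

lemma dehom_homog: assumes "degree g \<le> k" shows "dehom c (homog k g) = g"
proof (rule poly_ext)
  fix z
  have "bieval (homog_basis k i) z (1 + c * z) = z ^ i" for i
    by (simp add: homog_basis_def) (simp add: bieval_def)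
  then have "poly (dehom c (homog k g)) z = (\<Sum>i\<le>k. coeff g i * z ^ i)"
    by (simp add: poly_dehom homog_def bieval_sum)
  also have "\<dots> = poly g z"
    unfolding poly_altdef using assms by (intro sum.mono_neutral_right) (auto simp: coeff_eq_0)
  finally show "poly (dehom c (homog k g)) z = poly g z" .
qed

end

text \<open>The field is infinite, so a nonzero form does not vanish at all points $(1 : c)$. This is what allows
  all arguments to take place in one chart, with monic polynomials in place of forms.\<close>
lemma exists_chart:
  fixes G :: "'a::field_char_0 poly poly"
  assumes "G \<in> forms k" "G \<noteq> 0"
  obtains c where "coeff (dehom c G) k \<noteq> 0"
proof -
  define p where "p = (\<Sum>j\<le>k. monom (coords k G j) j)"
  have "p \<noteq> 0"
  proof
    assume "p = 0"
    have "coords k G j = 0" if "j \<le> k" for j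
    proof -
      have "coeff p j = coords k G j" using that by (simp add: p_def coeff_sum coeff_monom)
      with \<open>p = 0\<close> show ?thesis by simp
    qed
    then have "G = 0" by (subst form_expansion[OF assms(1)]) simp
    with assms show False by simp
  qed
  then obtain c where "poly p c \<noteq> 0" using poly_all_0_iff_0 by blast
  then show ?thesis using that[of c] coeff_dehom_top[OF assms(1), of c] by (simp add: p_def)
qed

section \<open>Points of projective space\<close>

lemma prop_class: "prop_rel `` {G} = {smult [:a:] G | a. a \<noteq> 0}"
  by (auto simp: prop_rel_def)

lemma prop_rel_refl [simp]: "(G, G) \<in> prop_rel"
  unfolding prop_rel_def by (auto intro!: exI[of _ 1] simp flip: one_pCons)

lemma prop_class_eqI: assumes "H \<in> prop_rel `` {G}" shows "prop_rel `` {H} = prop_rel `` {G}"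
proof -
  obtain a where a: "a \<noteq> 0" "H = smult [:a:] G" using assms by (auto simp: prop_class)
  have "smult [:b:] H = smult [:b * a:] G" for b using a by (simp add: mult.commute)
  moreover have "smult [:b:] G = smult [:b / a:] H" for b using a by simp
  moreover have "b \<noteq> 0 \<Longrightarrow> b * a \<noteq> 0" "b \<noteq> 0 \<Longrightarrow> b / a \<noteq> 0" for b using a by auto
  ultimately show ?thesis unfolding prop_class by blast
qed

lemma proj_forms_iff: "P \<in> proj_forms k \<longleftrightarrow> (\<exists>G\<in>forms k. G \<noteq> 0 \<and> P = prop_rel `` {G})"
  by (auto simp: proj_forms_def quotient_def)

lemma prod_smult_const:
  "(\<Prod>i\<in>I. smult [:a i:] (G i)) = smult [:\<Prod>i\<in>I. a i:] (\<Prod>i\<in>I. G i :: 'a::field poly poly)"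
  by (induction I rule: infinite_finite_induct) (auto simp: mult.commute simp flip: one_pCons)

lemma f_map_class:
  assumes "\<And>r. r \<in> {1..d} \<Longrightarrow> GG r = prop_rel `` {G r}"
  shows "f_map d GG = prop_rel `` {\<Prod>r\<in>{1..d}. G r ^ r}"
proof -
  define G' where "G' = restrict G {1..d}"
  have G': "G' \<in> PiE {1..d} GG" using assms by (auto simp: G'_def)
  have "prop_rel `` {\<Prod>r\<in>{1..d}. g r ^ r} = prop_rel `` {\<Prod>r\<in>{1..d}. G r ^ r}"
    if "g \<in> PiE {1..d} GG" for g
  proof (rule prop_class_eqI)
    have "\<exists>a. a \<noteq> 0 \<and> g r = smult [:a:] (G r)" if "r \<in> {1..d}" for r
      using PiE_mem[OF \<open>g \<in> _\<close> that] assms[OF that] by (auto simp: prop_class)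
    then obtain a where a: "\<And>r. r \<in> {1..d} \<Longrightarrow> a r \<noteq> 0 \<and> g r = smult [:a r:] (G r)" by metis
    have "(\<Prod>r\<in>{1..d}. g r ^ r) = (\<Prod>r\<in>{1..d}. smult [:a r ^ r:] (G r ^ r))"
      using a by (intro prod.cong) (auto simp: smult_power poly_const_pow)
    also have "\<dots> = smult [:\<Prod>r\<in>{1..d}. a r ^ r:] (\<Prod>r\<in>{1..d}. G r ^ r)"
      by (rule prod_smult_const)
    finally show "(\<Prod>r\<in>{1..d}. g r ^ r) \<in> prop_rel `` {\<Prod>r\<in>{1..d}. G r ^ r}"
      using a by (auto simp: prop_class intro!: exI[of _ "\<Prod>r\<in>{1..d}. a r ^ r"])
  qed
  then show ?thesis unfolding f_map_def using G' by blast
qed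

text \<open>For monic \<open>f\<close> of degree \<open>k\<close> these are the points of the chart of forms that do not vanish
  at $(1 : c)$.\<close>
definition pt :: "nat \<Rightarrow> 'a::field_char_0 \<Rightarrow> 'a poly \<Rightarrow> 'a poly poly set" where
  "pt k c f = prop_rel `` {homog c k f}"

definition monics :: "nat \<Rightarrow> 'a::field poly set" where
  "monics k = {f. degree f = k \<and> lead_coeff f = 1}"

lemma monics_nonzero: "f \<in> monics k \<Longrightarrow> f \<noteq> 0"
  by (auto simp: monics_def)

lemma homog_nonzero: "degree f \<le> k \<Longrightarrow> f \<noteq> 0 \<Longrightarrow> homog c k f \<noteq> 0"
  using dehom_homog[of f k c] by auto

lemma pt_proj: "f \<in> monics k \<Longrightarrow> pt k c f \<in> proj_forms k"
  unfolding proj_forms_iff pt_def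
  by (intro bexI[of _ "homog c k f"]) (auto simp: homog_nonzero monics_def monics_nonzero)

lemma pt_eqI:
  assumes "G \<in> forms k" "dehom c G = smult a f" "a \<noteq> 0"
  shows "prop_rel `` {G} = pt k c f"
  unfolding pt_def
proof (rule prop_class_eqI)
  have "degree f \<le> k" using degree_dehom[OF assms(1), of c] assms by simp
  then have "G = smult [:a:] (homog c k f)"
    by (intro dehom_inj[of _ k _ c, OF assms(1) forms_smult]) (simp_all add: assms dehom_homog)
  then show "G \<in> prop_rel `` {homog c k f}" using assms(3) by (auto simp: prop_class)
qed

lemma pt_inj: assumes "f \<in> monics k" "g \<in> monics k" "pt k c f = pt k c g" shows "f = g"
proof -
  have "homog c k f \<in> pt k c g" unfolding assms(3)[symmetric] by (simp add: pt_def)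
  then obtain a where a: "homog c k f = smult [:a:] (homog c k g)" by (auto simp: pt_def prop_class)
  then have "dehom c (homog c k f) = dehom c (smult [:a:] (homog c k g))" by simp
  then have "f = smult a g" using assms by (simp add: dehom_homog monics_def)
  moreover from this have "a = 1" using assms by (auto simp: monics_def)
  ultimately show ?thesis by simp
qed

lemma chart_point:
  assumes "G \<in> forms k" "coeff (dehom c G) k \<noteq> 0"
  obtains f where "f \<in> monics k" "prop_rel `` {G} = pt k c f"
proof -
  define a where "a = coeff (dehom c G) k"
  define f where "f = smult (1 / a) (dehom c G)"
  have deg: "degree (dehom c G) = k" using degree_dehom[OF assms(1), of c] assms(2) by (simp add: le_antisym le_degree)
  have "f \<in> monics k" using assms(2) deg by (simp add: monics_def f_def a_def)
  moreover have "dehom c G = smult a f" using assms(2) by (simp add: f_def a_def)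
  ultimately show ?thesis using that pt_eqI[OF assms(1), of c a f] assms(2) by (auto simp: a_def)
qed

lemma exists_chart_point:
  fixes P :: "'a::field_char_0 poly poly set"
  assumes "P \<in> proj_forms k"
  obtains c f where "f \<in> monics k" "P = pt k c f"
proof -
  obtain G where G: "G \<in> forms k" "G \<noteq> 0" "P = prop_rel `` {G}" using assms by (auto simp: proj_forms_iff)
  obtain c where "coeff (dehom c G) k \<noteq> 0" using exists_chart[OF G(1,2)] .
  then show ?thesis using chart_point[OF G(1)] that G(3) by blast
qed

section \<open>Partitions, coarsenings and splittings\<close>

lemma image_mset_as_sum: "finite I \<Longrightarrow> image_mset f (mset_set I) = (\<Sum>i\<in>I. {#f i#})"
  by (induction I rule: finite_induct) auto

lemma image_mset_fibres:
  assumes "finite I" "finite K" "\<kappa> ` I \<subseteq> K"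
  shows "(\<Sum>k\<in>K. image_mset f (mset_set {i \<in> I. \<kappa> i = k})) = image_mset f (mset_set I)"
  using sum.group[of I K \<kappa> "\<lambda>i. {#f i#}"] assms by (simp add: image_mset_as_sum)

lemma sum_mset_by_count:
  "set_mset lam \<subseteq> {1..d} \<Longrightarrow> sum_mset lam = (\<Sum>r\<in>{1..d}. r * count lam r)"
proof (induction lam)
  case (add x lam)
  have "(\<Sum>r\<in>{1..d}. r * count (add_mset x lam) r) = (\<Sum>r\<in>{1..d}. (if r = x then x else 0) + r * count lam r)"
    by (intro sum.cong) auto
  also have "\<dots> = x + (\<Sum>r\<in>{1..d}. r * count lam r)"
    using add.prems by (simp add: sum.distrib)
  finally show ?case using add by simp
qed simp

lemma partition_ofD:
  assumes "partition_of d lam"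
  shows "set_mset lam \<subseteq> {1..d}" "(\<Sum>r\<in>{1..d}. r * count lam r) = d" "0 \<notin># lam" "sum_mset lam = d"
proof -
  have "x \<le> sum_mset lam" if "x \<in># lam" for x
    using that by (metis insert_DiffM le_add1 sum_mset.add_mset)
  moreover have "x \<noteq> 0" if "x \<in># lam" for x using assms that unfolding partition_of_def by metis
  ultimately show *: "set_mset lam \<subseteq> {1..d}" using assms by (fastforce simp: partition_of_def Suc_le_eq)
  show "(\<Sum>r\<in>{1..d}. r * count lam r) = d"
    using assms sum_mset_by_count[OF *] by (simp add: partition_of_def)
  show "0 \<notin># lam" "sum_mset lam = d" using assms by (auto simp: partition_of_def)
qed

lemma partition_of_coarsening:
  assumes "partition_of d lam" "coarsening mu lam" shows "partition_of d mu"
proof -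
  obtain D where D: "\<forall>B\<in>#D. B \<noteq> {#}" "sum_mset D = lam" "image_mset sum_mset D = mu"
    using assms(2) by (auto simp: coarsening_def)
  have "sum_mset (image_mset sum_mset D) = sum_mset (sum_mset D)" by (induction D) auto
  moreover have "sum_mset B \<noteq> 0" if "B \<in># D" for B
  proof -
    have "B \<noteq> {#}" using D(1) that by blast
    then obtain x where "x \<in># B" by (rule multiset_nonemptyE)
    then have "x \<in># lam" using D(2) that by (metis insert_DiffM mset_subset_eq_add_left mset_subset_eqD sum_mset.add_mset)
    then have "x \<noteq> 0" using assms(1) unfolding partition_of_def by metis
    then show ?thesis using \<open>x \<in># B\<close> by (metis add_is_0 insert_DiffM sum_mset.add_mset)
  qed
  then have "0 \<notin># mu" unfolding D(3)[symmetric] by fastforce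
  ultimately show ?thesis using assms(1) D(2,3) by (simp add: partition_of_def)
qed

lemma labelled_mset:
  assumes "image_mset fst M = mset l"
  obtains t where "M = image_mset (\<lambda>i. (l ! i, t i)) (mset_set {..<length l})"
proof -
  obtain xs where xs: "mset xs = M" using ex_mset by blast
  then have "mset l = mset (map fst xs)" using assms by simp
  then obtain ys where ys: "length ys = length l" "mset (zip l ys) = mset (zip (map fst xs) (map snd xs))"
    using ex_mset_zip_left[of "map fst xs" "map snd xs" l] by auto
  have "zip l ys = map (\<lambda>i. (l ! i, ys ! i)) [0..<length l]"
    using ys(1) by (intro nth_equalityI) auto
  then have "mset (zip l ys) = image_mset (\<lambda>i. (l ! i, ys ! i)) (mset_set {..<length l})"
    by (simp add: atLeast0LessThan)
  then show ?thesis using that ys(2) xs by (simp add: zip_map_fst_snd)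
qed

lemma mset_list_image: "mset l = image_mset ((!) l) (mset_set {..<length l})"
  by (metis map_nth mset_map mset_upt atLeast0LessThan)

lemma sum_list_map_upt: "sum_list (map f [0..<n]) = (\<Sum>k<n. f k :: 'b::comm_monoid_add)"
  by (simp add: atLeast0LessThan interv_sum_list_conv_sum_set_nat)

text \<open>A splitting is described by sending each part of \<open>lam\<close> to the part of \<open>mu\<close> which it belongs to.\<close>
definition assignments :: "nat list \<Rightarrow> nat list \<Rightarrow> (nat \<Rightarrow> nat) set" where
  "assignments l mu = {\<kappa> \<in> PiE {..<length l} (\<lambda>_. {..<length mu}).
      \<forall>k<length mu. (\<Sum>i | i < length l \<and> \<kappa> i = k. l ! i) = mu ! k}"

definition split_of :: "nat list \<Rightarrow> nat \<Rightarrow> (nat \<Rightarrow> nat) \<Rightarrow> nat multiset list" where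
  "split_of l m \<kappa> = map (\<lambda>k. image_mset ((!) l) (mset_set {i. i < length l \<and> \<kappa> i = k})) [0..<m]"

lemma finite_assignments: "finite (assignments l mu)"
  by (rule finite_subset[of _ "{..<length l} \<rightarrow>\<^sub>E {..<length mu}"])
     (auto simp: assignments_def intro!: finite_PiE)

text \<open>Different assignments may give the same splitting, by permuting equal parts. Labelling each part of
  $\delta^k$ with \<open>k\<close> and writing the labelled parts along \<open>l\<close> recovers an assignment.\<close>
lemma splittings_eq:
  assumes "0 \<notin> set l"
  shows "splittings mu (mset l) = split_of l (length mu) ` assignments l mu"
proof (intro subset_antisym subsetI)
  fix \<delta> assume \<delta>: "\<delta> \<in> splittings mu (mset l)"
  define M where "M = (\<Sum>k<length mu. image_mset (\<lambda>r. (r, k)) (\<delta> ! k))"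
  have fsts: "image_mset fst (\<Sum>k\<in>K. image_mset (\<lambda>r. (r, k)) (\<delta> ! k)) = (\<Sum>k\<in>K. \<delta> ! k)" for K
    by (induction K rule: infinite_finite_induct) (auto simp: multiset.map_comp comp_def)
  have "sum_list \<delta> = (\<Sum>k<length mu. \<delta> ! k)"
    using \<delta> by (simp add: splittings_def sum_list_sum_nth atLeast0LessThan)
  then have "image_mset fst M = mset l" using fsts \<delta> by (simp add: M_def splittings_def)
  then obtain t where t: "M = image_mset (\<lambda>i. (l ! i, t i)) (mset_set {..<length l})"
    by (rule labelled_mset)
  have fil: "image_mset fst (filter_mset (\<lambda>p. snd p = k) M) = \<delta> ! k" if "k < length mu" for k
  proof -
    have "image_mset fst (filter_mset (\<lambda>p. snd p = k) (\<Sum>k\<in>K. image_mset (\<lambda>r. (r, k)) (\<delta> ! k)))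
        = (if k \<in> K then \<delta> ! k else {#})" if "finite K" for K
      using that
      by (induction K rule: finite_induct)
         (auto simp: filter_mset_image_mset multiset.map_comp comp_def)
    then show ?thesis using that by (simp add: M_def)
  qed
  have t_less: "t i < length mu" if "i < length l" for i
  proof -
    have "(l ! i, t i) \<in># M" using that by (auto simp: t)
    moreover have "snd p \<in> K" if "p \<in># (\<Sum>k\<in>K. image_mset (\<lambda>r. (r, k)) (\<delta> ! k))" for p K
      using that by (induction K rule: infinite_finite_induct) auto
    ultimately show ?thesis unfolding M_def by fastforce
  qed
  define \<kappa> where "\<kappa> = restrict t {..<length l}"
  have \<delta>k: "\<delta> ! k = image_mset ((!) l) (mset_set {i. i < length l \<and> \<kappa> i = k})" if "k < length mu" for k
  proof -
    have "\<delta> ! k = image_mset ((!) l) (filter_mset (\<lambda>i. t i = k) (mset_set {..<length l}))"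
      unfolding fil[OF that, symmetric] t
      by (simp add: filter_mset_image_mset multiset.map_comp comp_def)
    also have "filter_mset (\<lambda>i. t i = k) (mset_set {..<length l}) = mset_set {i. i < length l \<and> \<kappa> i = k}"
      by (auto simp: filter_mset_mset_set \<kappa>_def intro!: arg_cong[of _ _ mset_set])
    finally show ?thesis .
  qed
  have "\<kappa> \<in> assignments l mu"
    unfolding assignments_def
  proof (intro CollectI conjI allI impI)
    show "\<kappa> \<in> {..<length l} \<rightarrow>\<^sub>E {..<length mu}" using t_less by (auto simp: \<kappa>_def)
    fix k assume k: "k < length mu"
    then have "sum_mset (\<delta> ! k) = mu ! k" using \<delta> by (auto simp: splittings_def partition_of_def)
    then show "(\<Sum>i | i < length l \<and> \<kappa> i = k. l ! i) = mu ! k"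
      by (simp add: \<delta>k[OF k] sum_unfold_sum_mset)
  qed
  moreover have "\<delta> = split_of l (length mu) \<kappa>"
    using \<delta> \<delta>k by (intro nth_equalityI) (auto simp: split_of_def splittings_def)
  ultimately show "\<delta> \<in> split_of l (length mu) ` assignments l mu" by blast
next
  fix \<delta> assume "\<delta> \<in> split_of l (length mu) ` assignments l mu"
  then obtain \<kappa> where \<kappa>: "\<kappa> \<in> assignments l mu" "\<delta> = split_of l (length mu) \<kappa>" by blast
  have "sum_list \<delta> = (\<Sum>k<length mu. image_mset ((!) l) (mset_set {i \<in> {..<length l}. \<kappa> i = k}))"
    by (simp add: \<kappa>(2) split_of_def sum_list_map_upt)
  also have "\<dots> = mset l"
    using \<kappa>(1) by (subst image_mset_fibres) (auto simp: assignments_def mset_list_image[symmetric])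
  finally have "sum_list \<delta> = mset l" .
  moreover have "partition_of (mu ! k) (\<delta> ! k)" if "k < length mu" for k
    using \<kappa> that assms
    by (auto simp: partition_of_def split_of_def assignments_def sum_unfold_sum_mset in_set_conv_nth)
  ultimately show "\<delta> \<in> splittings mu (mset l)"
    by (simp add: splittings_def \<kappa>(2) split_of_def)
qed

section \<open>Products of linear factors\<close>

definition root_prod :: "nat list \<Rightarrow> (nat \<Rightarrow> 'a::comm_ring_1) \<Rightarrow> 'a poly" where
  "root_prod l t = (\<Prod>i<length l. [:- t i, 1:] ^ (l ! i))"

lemma monics_iff: "f \<in> monics k \<longleftrightarrow> f \<noteq> 0 \<and> degree f = k \<and> lead_coeff f = 1"
  by (auto simp: monics_def)

lemma monics_mult: "f \<in> monics j \<Longrightarrow> g \<in> monics k \<Longrightarrow> f * g \<in> monics (j + k)"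
proof -
  assume *: "f \<in> monics j" "g \<in> monics k"
  then have "degree (f * g) = j + k" by (simp add: monics_iff degree_mult_eq)
  moreover have "lead_coeff (f * g) = 1" using * by (subst lead_coeff_mult) (auto simp: monics_iff)
  ultimately show ?thesis by (simp add: monics_def)
qed

lemma monics_power: "f \<in> monics j \<Longrightarrow> f ^ n \<in> monics (n * j)"
  by (induction n) (auto intro: monics_mult simp: monics_def[of 0])

lemma monics_prod: "(\<And>i. i \<in> I \<Longrightarrow> f i \<in> monics (k i)) \<Longrightarrow> prod f I \<in> monics (sum k I)"
  by (induction I rule: infinite_finite_induct) (auto intro: monics_mult simp: monics_def[of 0])

lemma monics_linear: "[:- x, 1:] \<in> monics 1"
  by (simp add: monics_def)

lemma monics_linear_power: "[:- x, 1:] ^ n \<in> monics n"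
  using monics_power[OF monics_linear, of x n] by simp

lemma root_prod_monic: "root_prod l t \<in> monics (sum_list l)"
  unfolding root_prod_def sum_list_sum_nth atLeast0LessThan
  by (intro monics_prod monics_linear_power)

lemma order_prod_linear:
  fixes a :: "nat \<Rightarrow> 'a::field"
  assumes "inj_on a K" "k \<in> K" "finite K"
  shows "order (a k) (\<Prod>j\<in>K. [:- a j, 1:] ^ n j) = n k"
proof -
  define q where "q = (\<Prod>j\<in>K - {k}. [:- a j, 1:] ^ n j)"
  have eq: "(\<Prod>j\<in>K. [:- a j, 1:] ^ n j) = [:- a k, 1:] ^ n k * q"
    unfolding q_def using assms by (intro prod.remove) auto
  have "poly q (a k) \<noteq> 0"
    using assms by (auto simp: q_def poly_prod inj_on_def)
  then have "order (a k) q = 0" "q \<noteq> 0" by (auto intro: order_0I)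
  then show ?thesis unfolding eq by (subst order_mult) (auto simp: order_power_n_n)
qed

lemma exists_linear_factors:
  fixes f :: "'a::alg_closed_field poly"
  assumes "f \<in> monics k"
  obtains A where "size A = k" "f = (\<Prod>x\<in>#A. [:- x, 1:])"
proof -
  obtain A where "size A = degree f" "f = smult (lead_coeff f) (\<Prod>x\<in>#A. [:-x, 1:])"
    using alg_closed_imp_factorization[of f] monics_nonzero[OF assms] by blast
  moreover have "degree f = k" "lead_coeff f = 1" using assms by (auto simp: monics_def)
  ultimately show ?thesis using that[of A] by simp
qed

lemma linear_factors_on:
  fixes f :: "'a::alg_closed_field poly"
  assumes "f \<in> monics m" "inj_on a K" "finite K" "\<And>x. poly f x = 0 \<Longrightarrow> x \<in> a ` K"
  obtains n where "f = (\<Prod>k\<in>K. [:- a k, 1:] ^ n k)"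
proof -
  obtain A where A: "f = (\<Prod>x\<in>#A. [:- x, 1:])" using exists_linear_factors[OF assms(1)] .
  have "set_mset A \<subseteq> a ` K"
  proof
    fix x assume "x \<in># A"
    then have "poly f x = 0" unfolding A by (induction A) auto
    then show "x \<in> a ` K" by (rule assms(4))
  qed
  have "f = (\<Prod>x\<in>set_mset A. [:- x, 1:] ^ count A x)"
    unfolding A by (simp add: image_prod_mset_multiplicity)
  also have "\<dots> = (\<Prod>x\<in>a ` K. [:- x, 1:] ^ count A x)"
    using \<open>set_mset A \<subseteq> a ` K\<close> assms(3) by (intro prod.mono_neutral_left) (auto simp: not_in_iff)
  also have "\<dots> = (\<Prod>k\<in>K. [:- a k, 1:] ^ count A (a k))"
    using assms(2) by (simp add: prod.reindex)
  finally show ?thesis by (rule that)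
qed

lemma root_prod_assignment:
  fixes \<kappa> :: "nat \<Rightarrow> nat"
  assumes "\<kappa> ` {..<length l} \<subseteq> {..<m}"
  shows "root_prod l (\<lambda>i. a (\<kappa> i)) = (\<Prod>k<m. [:- a k, 1:] ^ (\<Sum>i | i < length l \<and> \<kappa> i = k. l ! i))"
proof -
  have "root_prod l (\<lambda>i. a (\<kappa> i)) = (\<Prod>k<m. \<Prod>i\<in>{i \<in> {..<length l}. \<kappa> i = k}. [:- a (\<kappa> i), 1:] ^ (l ! i))"
    unfolding root_prod_def using assms by (subst prod.group) auto
  also have "\<dots> = (\<Prod>k<m. [:- a k, 1:] ^ (\<Sum>i | i < length l \<and> \<kappa> i = k. l ! i))"
    by (intro prod.cong refl) (simp add: power_sum)
  finally show ?thesis .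
qed

lemma root_prod_of_assignment:
  assumes "\<kappa> \<in> assignments l mu" shows "root_prod l (\<lambda>i. a (\<kappa> i)) = root_prod mu a"
proof -
  have "\<kappa> ` {..<length l} \<subseteq> {..<length mu}" using assms by (auto simp: assignments_def)
  from root_prod_assignment[OF this, of a] show ?thesis
    using assms unfolding root_prod_def[of mu] assignments_def by simp
qed

lemma root_prod_cong: "(\<And>i. i < length l \<Longrightarrow> t i = u i) \<Longrightarrow> root_prod l t = root_prod l u"
  by (simp add: root_prod_def)

text \<open>Every root of the left-hand side is a root of the right-hand side, and the distinctness of the roots
  \<open>a\<close> allows to compare multiplicities.\<close>
lemma assignment_of_root_prod:
  fixes a t :: "nat \<Rightarrow> 'a::field"
  assumes "root_prod l t = root_prod mu a" "0 \<notin> set l" "inj_on a {..<length mu}"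
  obtains \<kappa> where "\<kappa> \<in> assignments l mu" "\<And>i. i < length l \<Longrightarrow> t i = a (\<kappa> i)"
proof -
  have "\<exists>k<length mu. t i = a k" if "i < length l" for i
  proof -
    have "l ! i \<noteq> 0" using assms(2) that by (metis nth_mem)
    then have "poly (root_prod l t) (t i) = 0" using that by (auto simp: root_prod_def poly_prod)
    then have "poly (root_prod mu a) (t i) = 0" by (simp add: assms(1))
    then obtain k where "k < length mu" "poly ([:- a k, 1:] ^ (mu ! k)) (t i) = 0"
      by (auto simp: root_prod_def poly_prod)
    then show ?thesis by auto
  qed
  then obtain \<kappa>0 where \<kappa>0: "\<And>i. i < length l \<Longrightarrow> \<kappa>0 i < length mu \<and> t i = a (\<kappa>0 i)" by metis
  define \<kappa> where "\<kappa> = restrict \<kappa>0 {..<length l}"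
  have img: "\<kappa> ` {..<length l} \<subseteq> {..<length mu}" using \<kappa>0 by (auto simp: \<kappa>_def)
  have t: "t i = a (\<kappa> i)" if "i < length l" for i using \<kappa>0 that by (simp add: \<kappa>_def)
  have "root_prod l t = root_prod l (\<lambda>i. a (\<kappa> i))" by (intro root_prod_cong t)
  then have eq: "(\<Prod>k<length mu. [:- a k, 1:] ^ (\<Sum>i | i < length l \<and> \<kappa> i = k. l ! i))
      = (\<Prod>k<length mu. [:- a k, 1:] ^ (mu ! k))"
    using assms(1) root_prod_assignment[OF img, of a] by (simp add: root_prod_def[of mu])
  have "(\<Sum>i | i < length l \<and> \<kappa> i = k. l ! i) = mu ! k" if "k < length mu" for k
    using arg_cong[OF eq, of "order (a k)"] order_prod_linear[OF assms(3), of k] that by simp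
  then have "\<kappa> \<in> assignments l mu" using img by (auto simp: assignments_def \<kappa>_def)
  then show ?thesis using that t by blast
qed

section \<open>The morphism in a chart\<close>

definition Y_chart :: "nat \<Rightarrow> nat multiset \<Rightarrow> (nat \<Rightarrow> 'a::field poly) set" where
  "Y_chart d lam = PiE {1..d} (\<lambda>r. monics (count lam r))"

lemma Y_chartD: "g \<in> Y_chart d lam \<Longrightarrow> r \<in> {1..d} \<Longrightarrow> g r \<in> monics (count lam r)"
  unfolding Y_chart_def by (rule PiE_mem)

definition Y_pt :: "nat \<Rightarrow> nat multiset \<Rightarrow> 'a::field_char_0 \<Rightarrow> (nat \<Rightarrow> 'a poly) \<Rightarrow> nat \<Rightarrow> 'a poly poly set" where
  "Y_pt d lam c g = restrict (\<lambda>r. pt (count lam r) c (g r)) {1..d}"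

definition power_prod :: "nat \<Rightarrow> (nat \<Rightarrow> 'a::comm_ring_1) \<Rightarrow> 'a" where
  "power_prod d g = (\<Prod>r\<in>{1..d}. g r ^ r)"

lemma power_prod_monic:
  assumes "partition_of d lam" "g \<in> Y_chart d lam" shows "power_prod d g \<in> monics d"
proof -
  have "power_prod d g \<in> monics (\<Sum>r\<in>{1..d}. r * count lam r)"
    unfolding power_prod_def using assms(2) by (intro monics_prod monics_power) (auto simp: Y_chart_def)
  then show ?thesis by (simp only: partition_ofD(2)[OF assms(1)])
qed

lemma power_prod_forms:
  assumes "partition_of d lam" "\<And>r. r \<in> {1..d} \<Longrightarrow> G r \<in> forms (count lam r)"
  shows "power_prod d G \<in> forms d"
proof -
  have "power_prod d G \<in> forms (\<Sum>r\<in>{1..d}. r * count lam r)"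
    unfolding power_prod_def using assms(2) by (intro forms_prod forms_power)
  then show ?thesis by (simp only: partition_ofD(2)[OF assms(1)])
qed

lemma Y_pt_in_Y: "g \<in> Y_chart d lam \<Longrightarrow> Y_pt d lam c g \<in> Y_locus d lam"
  by (auto simp: Y_pt_def Y_locus_def Y_chart_def intro!: pt_proj)

lemma f_map_Y_pt:
  assumes "partition_of d lam" "g \<in> Y_chart d lam"
  shows "f_map d (Y_pt d lam c g) = pt d c (power_prod d g)"
proof -
  define G where "G = (\<lambda>r. homog c (count lam r) (g r))"
  have "f_map d (Y_pt d lam c g) = prop_rel `` {power_prod d G}"
    unfolding power_prod_def by (rule f_map_class) (simp add: Y_pt_def pt_def G_def)
  also have "\<dots> = pt d c (power_prod d g)"
  proof (rule pt_eqI)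
    show "power_prod d G \<in> forms d" by (rule power_prod_forms[OF assms(1)]) (simp add: G_def)
    have "dehom c (G r) = g r" if "r \<in> {1..d}" for r
      using PiE_mem[OF assms(2)[unfolded Y_chart_def] that] by (simp add: G_def dehom_homog monics_def)
    then show "dehom c (power_prod d G) = smult 1 (power_prod d g)"
      by (simp add: power_prod_def dehom_prod)
  qed simp
  finally show ?thesis .
qed

lemma Y_pt_inj: "inj_on (Y_pt d lam c) (Y_chart d lam)"
proof (rule inj_onI)
  fix g h :: "nat \<Rightarrow> 'a poly"
  assume *: "g \<in> Y_chart d lam" "h \<in> Y_chart d lam" "Y_pt d lam c g = Y_pt d lam c h"
  show "g = h"
  proof (rule PiE_ext[OF *(1,2)[unfolded Y_chart_def]])
    fix r assume r: "r \<in> {1..d}"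
    have "pt (count lam r) c (g r) = pt (count lam r) c (h r)"
      using fun_cong[OF *(3), of r] r by (simp add: Y_pt_def)
    then show "g r = h r"
      using *(1,2) r unfolding Y_chart_def by (intro pt_inj) (auto dest: PiE_mem)
  qed
qed

text \<open>All points of the fibre over a point of the chart lie in the corresponding chart of the
  source: degrees can only drop under restriction to the line, and the weighted degrees add up to $d$.\<close>
lemma fibre_chart:
  fixes f :: "'a::field_char_0 poly"
  assumes "partition_of d lam" "f \<in> monics d"
  shows "fibre d lam (pt d c f) = Y_pt d lam c ` {g \<in> Y_chart d lam. power_prod d g = f}"
proof (intro subset_antisym subsetI)
  fix GG assume "GG \<in> fibre d lam (pt d c f)"
  then have GG: "GG \<in> Y_locus d lam" "f_map d GG = pt d c f" by (auto simp: fibre_def)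
  then have "\<exists>G\<in>forms (count lam r). G \<noteq> 0 \<and> GG r = prop_rel `` {G}" if "r \<in> {1..d}" for r
    using that by (auto simp: Y_locus_def proj_forms_iff dest: PiE_mem)
  then obtain G where G: "\<And>r. r \<in> {1..d} \<Longrightarrow> G r \<in> forms (count lam r) \<and> G r \<noteq> 0 \<and> GG r = prop_rel `` {G r}"
    by metis
  have "f_map d GG = prop_rel `` {power_prod d G}"
    unfolding power_prod_def using G by (intro f_map_class) auto
  then have "power_prod d G \<in> pt d c f" using GG(2) by auto
  then obtain a where a: "a \<noteq> 0" "power_prod d G = smult [:a:] (homog c d f)"
    by (auto simp: pt_def prop_class)
  have eq: "(\<Prod>r\<in>{1..d}. dehom c (G r) ^ r) = smult a f"
    using arg_cong[OF a(2), of "dehom c"] assms(2) by (simp add: power_prod_def dehom_prod dehom_homog monics_def)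
  have nz: "dehom c (G r) \<noteq> 0" if "r \<in> {1..d}" for r using G[OF that] dehom_eq_0 by blast
  have "d = degree (\<Prod>r\<in>{1..d}. dehom c (G r) ^ r)" using a(1) assms(2) unfolding eq by (simp add: monics_def)
  also have "\<dots> = (\<Sum>r\<in>{1..d}. r * degree (dehom c (G r)))"
    using nz by (subst degree_prod_eq_sum_degree) (auto simp: degree_power_eq)
  finally have sum_eq: "(\<Sum>r\<in>{1..d}. r * degree (dehom c (G r))) = (\<Sum>r\<in>{1..d}. r * count lam r)"
    using partition_ofD(2)[OF assms(1)] by simp
  have le: "r * degree (dehom c (G r)) \<le> r * count lam r" if "r \<in> {1..d}" for r
    using degree_dehom[of "G r" "count lam r" c] G[OF that] by simp
  have "degree (dehom c (G r)) = count lam r" if "r \<in> {1..d}" for r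
  proof (rule ccontr)
    assume "degree (dehom c (G r)) \<noteq> count lam r"
    then have "r * degree (dehom c (G r)) < r * count lam r"
      using that degree_dehom[of "G r" "count lam r" c] G[OF that] by simp
    then have "(\<Sum>r\<in>{1..d}. r * degree (dehom c (G r))) < (\<Sum>r\<in>{1..d}. r * count lam r)"
      using that le by (intro sum_strict_mono_ex1) auto
    with sum_eq show False by simp
  qed
  then have "coeff (dehom c (G r)) (count lam r) \<noteq> 0" if "r \<in> {1..d}" for r
    using nz[OF that] that by (metis leading_coeff_0_iff)
  then have "\<exists>g\<in>monics (count lam r). GG r = pt (count lam r) c g" if "r \<in> {1..d}" for r
    using chart_point[of "G r" "count lam r" c] G[OF that] that by metis
  then obtain g0 where g0: "\<And>r. r \<in> {1..d} \<Longrightarrow> g0 r \<in> monics (count lam r) \<and> GG r = pt (count lam r) c (g0 r)"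
    by metis
  define g where "g = restrict g0 {1..d}"
  have g: "g \<in> Y_chart d lam" using g0 by (auto simp: g_def Y_chart_def)
  have "GG = Y_pt d lam c g"
  proof (rule PiE_ext[OF GG(1)[unfolded Y_locus_def] Y_pt_in_Y[OF g, unfolded Y_locus_def]])
    show "GG r = Y_pt d lam c g r" if "r \<in> {1..d}" for r using g0[OF that] that by (simp add: g_def Y_pt_def)
  qed
  moreover from this have "pt d c (power_prod d g) = pt d c f"
    using f_map_Y_pt[OF assms(1) g] GG(2) by simp
  then have "power_prod d g = f" using pt_inj[OF power_prod_monic[OF assms(1) g] assms(2)] by blast
  ultimately show "GG \<in> Y_pt d lam c ` {g \<in> Y_chart d lam. power_prod d g = f}" using g by blast
next
  fix GG assume "GG \<in> Y_pt d lam c ` {g \<in> Y_chart d lam. power_prod d g = f}"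
  then show "GG \<in> fibre d lam (pt d c f)"
    using f_map_Y_pt[OF assms(1)] Y_pt_in_Y by (auto simp: fibre_def)
qed

lemma X_locus_fibre: "P \<in> X_locus d lam \<longleftrightarrow> fibre d lam P \<noteq> {}"
  by (auto simp: X_locus_def fibre_def)

lemma X_locus_proj:
  assumes "partition_of d lam" "P \<in> X_locus d lam"
  shows "P \<in> proj_forms d"
proof -
  obtain GG where GG: "GG \<in> Y_locus d lam" "P = f_map d GG" using assms(2) by (auto simp: X_locus_def)
  then have "\<exists>G\<in>forms (count lam r). G \<noteq> 0 \<and> GG r = prop_rel `` {G}" if "r \<in> {1..d}" for r
    using that by (auto simp: Y_locus_def proj_forms_iff dest: PiE_mem)
  then obtain G where G: "\<And>r. r \<in> {1..d} \<Longrightarrow> G r \<in> forms (count lam r) \<and> G r \<noteq> 0 \<and> GG r = prop_rel `` {G r}"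
    by metis
  have "P = prop_rel `` {power_prod d G}"
    unfolding power_prod_def GG(2) using G by (intro f_map_class) auto
  moreover have "power_prod d G \<in> forms d" using G by (intro power_prod_forms[OF assms(1)]) auto
  moreover have "power_prod d G \<noteq> 0" using G by (auto simp: power_prod_def)
  ultimately show ?thesis by (auto simp: proj_forms_iff)
qed

text \<open>The pair $(n, x)$ is a part $n$ whose factor has the root $x$. With multisets of such pairs,
  merging two factors with the same root is visibly a coarsening of the partition.\<close>
definition labelled_prod :: "(nat \<times> 'a::comm_ring_1) multiset \<Rightarrow> 'a poly" where
  "labelled_prod M = (\<Prod>(n, x)\<in>#M. [:- x, 1:] ^ n)"

lemma labelled_prod_simps [simp]:
  "labelled_prod {#} = 1" "labelled_prod (add_mset (n, x) M) = [:- x, 1:] ^ n * labelled_prod M"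
  "labelled_prod (M + N) = labelled_prod M * labelled_prod N"
  by (simp_all add: labelled_prod_def)

lemma labelled_prod_list:
  "labelled_prod (image_mset (\<lambda>i. (l ! i, t i)) (mset_set {..<length l})) = root_prod l t"
  by (simp add: labelled_prod_def root_prod_def multiset.map_comp comp_def prod_unfold_prod_mset)

text \<open>The factor with exponent $r$ splits into linear factors, and its roots are labelled by $r$.\<close>
lemma X_locus_chart_labelled:
  fixes f :: "'a::{alg_closed_field, field_char_0} poly"
  assumes "partition_of d lam" "f \<in> monics d"
  shows "pt d c f \<in> X_locus d lam \<longleftrightarrow> (\<exists>M. image_mset fst M = lam \<and> f = labelled_prod M)"
proof
  assume "pt d c f \<in> X_locus d lam"
  then obtain g where g: "g \<in> Y_chart d lam" "power_prod d g = f"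
    unfolding X_locus_fibre fibre_chart[OF assms] by blast
  have "\<exists>A. size A = count lam r \<and> g r = (\<Prod>x\<in>#A. [:- x, 1:])" if "r \<in> {1..d}" for r
  proof -
    have "g r \<in> monics (count lam r)" using g(1) that by (rule Y_chartD)
    from exists_linear_factors[OF this] show ?thesis by metis
  qed
  then obtain A where A: "\<And>r. r \<in> {1..d} \<Longrightarrow> size (A r) = count lam r \<and> g r = (\<Prod>x\<in>#A r. [:- x, 1:])" by metis
  define M where "M = (\<Sum>r\<in>{1..d}. image_mset (Pair r) (A r))"
  have "image_mset fst (\<Sum>r\<in>K. image_mset (Pair r) (A r)) = (\<Sum>r\<in>K. replicate_mset (size (A r)) r)" for K
    by (induction K rule: infinite_finite_induct) (auto simp: multiset.map_comp comp_def image_mset_const_eq)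
  then have "image_mset fst M = (\<Sum>r\<in>{1..d}. replicate_mset (count lam r) r)"
    using A by (simp add: M_def)
  also have "\<dots> = lam"
  proof (rule multiset_eqI)
    fix r
    show "count (\<Sum>r\<in>{1..d}. replicate_mset (count lam r) r) r = count lam r"
      using partition_ofD(1)[OF assms(1)]
      by (cases "r \<in> {1..d}") (auto simp: count_sum count_replicate_mset not_in_iff[symmetric] dest!: subsetD)
  qed
  finally have "image_mset fst M = lam" .
  moreover have "labelled_prod (\<Sum>r\<in>K. image_mset (Pair r) (A r)) = (\<Prod>r\<in>K. (\<Prod>x\<in>#A r. [:- x, 1:]) ^ r)" for K
  proof (induction K rule: infinite_finite_induct)
    case (insert r K)
    have "labelled_prod (image_mset (Pair r) B) = (\<Prod>x\<in>#B. [:- x, 1:]) ^ r" for B :: "'a multiset"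
      by (induction B) (auto simp: power_mult_distrib simp del: mult_pCons_left)
    with insert show ?case by simp
  qed auto
  then have "labelled_prod M = f" using A g(2) by (simp add: M_def power_prod_def)
  ultimately show "\<exists>M. image_mset fst M = lam \<and> f = labelled_prod M" by blast
next
  assume "\<exists>M. image_mset fst M = lam \<and> f = labelled_prod M"
  then obtain M where M: "image_mset fst M = lam" "f = labelled_prod M" by blast
  define g0 where "g0 = (\<lambda>(M :: (nat \<times> 'a) multiset) r. \<Prod>x\<in>#image_mset snd (filter_mset (\<lambda>p. fst p = r) M). [:- x :: 'a, 1:])"
  have g0: "power_prod d (g0 N) = labelled_prod N" if "set_mset (image_mset fst N) \<subseteq> {1..d}" for N
    using that
  proof (induction N)
    case (add p N)
    obtain n x where p: "p = (n, x)" by force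
    have "g0 (add_mset p N) r = (if r = n then [:- x, 1:] else 1) * g0 N r" for r
      by (simp add: g0_def p)
    then have "power_prod d (g0 (add_mset p N)) = (\<Prod>r\<in>{1..d}. (if r = n then [:- x, 1:] ^ n else 1) * g0 N r ^ r)"
      unfolding power_prod_def by (intro prod.cong) (auto simp: power_mult_distrib)
    also have "\<dots> = [:- x, 1:] ^ n * power_prod d (g0 N)"
      using add.prems by (simp add: prod.distrib power_prod_def p)
    finally show ?case using add by (simp add: p)
  qed (simp add: power_prod_def g0_def)
  have "power_prod d (g0 M) = f" unfolding M(2) by (rule g0) (simp only: M(1) partition_ofD(1)[OF assms(1)])
  moreover define g where "g = restrict (g0 M) {1..d}"
  have "g0 N r \<in> monics (count (image_mset fst N) r)" for N r
  proof (induction N)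
    case (add p N)
    then have "[:- snd p, 1:] * g0 N r \<in> monics (1 + count (image_mset fst N) r)"
      by (intro monics_mult monics_linear)
    with add show ?case by (simp add: g0_def)
  qed (simp add: g0_def monics_def)
  then have "g \<in> Y_chart d lam" using M(1) by (auto simp: g_def Y_chart_def)
  moreover have "power_prod d g = power_prod d (g0 M)" by (simp add: power_prod_def g_def)
  ultimately show "pt d c f \<in> X_locus d lam" unfolding X_locus_fibre fibre_chart[OF assms] by auto
qed

lemma X_locus_chart:
  fixes f :: "'a::{alg_closed_field, field_char_0} poly"
  assumes "partition_of d (mset l)" "f \<in> monics d"
  shows "pt d c f \<in> X_locus d (mset l) \<longleftrightarrow> (\<exists>t. f = root_prod l t)"
proof
  assume "pt d c f \<in> X_locus d (mset l)"
  then obtain M where M: "image_mset fst M = mset l" "f = labelled_prod M"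
    using X_locus_chart_labelled[OF assms] by blast
  then show "\<exists>t. f = root_prod l t" using labelled_prod_list by (metis labelled_mset)
next
  assume "\<exists>t. f = root_prod l t"
  then obtain t where "f = root_prod l t" by blast
  then have "f = labelled_prod (image_mset (\<lambda>i. (l ! i, t i)) (mset_set {..<length l}))"
    by (simp add: labelled_prod_list)
  moreover have "image_mset fst (image_mset (\<lambda>i. (l ! i, t i)) (mset_set {..<length l})) = mset l"
    by (simp add: multiset.map_comp comp_def mset_list_image[symmetric])
  ultimately show "pt d c f \<in> X_locus d (mset l)" using X_locus_chart_labelled[OF assms] by blast
qed

text \<open>Two equal roots could be merged, which puts the form into a smaller locus.\<close>
lemma X_open_distinct_roots:
  fixes f :: "'a::{alg_closed_field, field_char_0} poly"
  assumes "partition_of d (mset mu)" "f \<in> monics d" "pt d c f \<in> X_open d (mset mu)"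
  obtains a where "f = root_prod mu a" "inj_on a {..<length mu}"
proof -
  have "pt d c f \<in> X_locus d (mset mu)" using assms(3) by (simp add: X_open_def)
  then obtain a where a: "f = root_prod mu a" using X_locus_chart[OF assms(1,2)] by blast
  have "inj_on a {..<length mu}"
  proof (rule inj_onI, rule ccontr)
    fix i j assume ij: "i \<in> {..<length mu}" "j \<in> {..<length mu}" "a i = a j" "i \<noteq> j"
    define M' where "M' = image_mset (\<lambda>k. (mu ! k, a k)) (mset_set ({..<length mu} - {i, j}))"
    have "mset_set {..<length mu} = add_mset i (add_mset j (mset_set ({..<length mu} - {i, j})))"
      using ij by (metis (no_types, lifting) Diff_insert2 DiffI finite_Diff finite_lessThan mset_set.remove singletonD)
    then have M: "image_mset (\<lambda>k. (mu ! k, a k)) (mset_set {..<length mu})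
        = add_mset (mu ! i, a i) (add_mset (mu ! j, a i) M')" using ij by (simp add: M'_def)
    define \<omega> where "\<omega> = add_mset (mu ! i + mu ! j) (image_mset fst M')"
    have mu: "mset mu = add_mset (mu ! i) (add_mset (mu ! j) (image_mset fst M'))"
      using arg_cong[OF M, of "image_mset fst"]
      by (simp add: multiset.map_comp comp_def mset_list_image[symmetric])
    define D where "D = add_mset {#mu ! i, mu ! j#} (image_mset (\<lambda>p. {#fst p#}) M')"
    have "sum_mset (image_mset (\<lambda>p. {#fst p#}) N) = image_mset fst N" for N :: "(nat \<times> 'a) multiset"
      by (induction N) auto
    then have "coarsening \<omega> (mset mu)"
      unfolding coarsening_def mu
      by (intro exI[of _ D]) (auto simp: D_def \<omega>_def multiset.map_comp comp_def)
    moreover have "\<omega> \<noteq> mset mu"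
    proof
      assume "\<omega> = mset mu"
      then have "size \<omega> = size (mset mu)" by simp
      then show False unfolding mu \<omega>_def by simp
    qed
    moreover have "partition_of d \<omega>" by (rule partition_of_coarsening[OF assms(1) \<open>coarsening \<omega> (mset mu)\<close>])
    have "f = labelled_prod (add_mset (mu ! i + mu ! j, a i) M')"
      using arg_cong[OF M, of labelled_prod] a by (simp add: labelled_prod_list power_add mult_ac)
    moreover have "image_mset fst (add_mset (mu ! i + mu ! j, a i) M') = \<omega>" by (simp add: \<omega>_def)
    ultimately have "pt d c f \<in> X_locus d \<omega>"
      using X_locus_chart_labelled[OF \<open>partition_of d \<omega>\<close> assms(2)] by blast
    with \<open>coarsening \<omega> (mset mu)\<close> \<open>\<omega> \<noteq> mset mu\<close> assms(3) show False by (auto simp: X_open_def)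
  qed
  with a that show ?thesis by blast
qed

section \<open>Fibres and splittings\<close>

text \<open>The point of the fibre belonging to a splitting: the root $a_k$ occurs in the factor with exponent $r$
  as often as the part $r$ occurs in $\delta^k$.\<close>
definition split_factors :: "nat \<Rightarrow> nat \<Rightarrow> (nat \<Rightarrow> 'a::comm_ring_1) \<Rightarrow> nat multiset list \<Rightarrow> nat \<Rightarrow> 'a poly" where
  "split_factors d m a \<delta> = restrict (\<lambda>r. \<Prod>k<m. [:- a k, 1:] ^ count (\<delta> ! k) r) {1..d}"

text \<open>By unique factorization, each factor is a product of powers of the $X - a_k$, and the exponents of
  $X - a_k$ in the factors are the multiplicities of the parts of a partition of $\mu_k$.\<close>
lemma split_factors_bij:
  fixes a :: "nat \<Rightarrow> 'a::{alg_closed_field, field_char_0}"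
  assumes lam: "partition_of d lam" and mu: "partition_of d (mset mu)" and inj: "inj_on a {..<length mu}"
  shows "bij_betw (split_factors d (length mu) a) (splittings mu lam)
           {g \<in> Y_chart d lam. power_prod d g = root_prod mu a}"
proof -
  have le: "mu ! k \<le> d" if "k < length mu" for k
    using partition_ofD(1)[OF mu] that by (auto dest!: nth_mem)
  have sub: "set_mset (\<delta> ! k) \<subseteq> {1..d}" if "\<delta> \<in> splittings mu lam" "k < length mu" for \<delta> k
  proof -
    have "set_mset (\<delta> ! k) \<subseteq> {1..mu ! k}" using that by (intro partition_ofD(1)) (auto simp: splittings_def)
    with le[OF that(2)] show ?thesis by auto
  qed
  have csum: "count (sum_list \<delta>) r = (\<Sum>k<length \<delta>. count (\<delta> ! k) r)" for \<delta> :: "nat multiset list" and r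
    by (simp add: sum_list_sum_nth atLeast0LessThan count_sum)
  show ?thesis
  proof (rule bij_betwI')
    fix \<delta> \<delta>' assume \<delta>: "\<delta> \<in> splittings mu lam" "\<delta>' \<in> splittings mu lam"
    show "split_factors d (length mu) a \<delta> = split_factors d (length mu) a \<delta>' \<longleftrightarrow> \<delta> = \<delta>'"
    proof
      assume eq: "split_factors d (length mu) a \<delta> = split_factors d (length mu) a \<delta>'"
      show "\<delta> = \<delta>'"
      proof (rule nth_equalityI)
        fix k assume "k < length \<delta>"
        then have k: "k < length mu" using \<delta> by (simp add: splittings_def)
        show "\<delta> ! k = \<delta>' ! k"
        proof (rule multiset_eqI)
          fix r
          show "count (\<delta> ! k) r = count (\<delta>' ! k) r"
          proof (cases "r \<in> {1..d}")
            case True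
            then have "(\<Prod>k<length mu. [:- a k, 1:] ^ count (\<delta> ! k) r) = (\<Prod>k<length mu. [:- a k, 1:] ^ count (\<delta>' ! k) r)"
              using fun_cong[OF eq, of r] by (simp add: split_factors_def)
            from arg_cong[OF this, of "order (a k)"] show ?thesis
              using k by (simp add: order_prod_linear[OF inj, of k])
          next
            case False
            then have "r \<notin># \<delta> ! k" "r \<notin># \<delta>' ! k" using sub[OF \<delta>(1) k] sub[OF \<delta>(2) k] by blast+
            then show ?thesis by (simp add: not_in_iff)
          qed
        qed
      qed (use \<delta> in \<open>simp add: splittings_def\<close>)
    qed simp
  next
    fix \<delta> assume \<delta>: "\<delta> \<in> splittings mu lam"
    then have len: "length \<delta> = length mu" and sl: "sum_list \<delta> = lam" by (auto simp: splittings_def)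
    have "(\<Prod>k<length mu. [:- a k, 1:] ^ count (\<delta> ! k) r) \<in> monics (count lam r)" for r
    proof -
      have "(\<Prod>k<length mu. [:- a k, 1:] ^ count (\<delta> ! k) r) \<in> monics (\<Sum>k<length mu. count (\<delta> ! k) r)"
        by (intro monics_prod monics_linear_power)
      then show ?thesis using csum[of \<delta> r] by (simp add: len sl)
    qed
    then have "split_factors d (length mu) a \<delta> \<in> Y_chart d lam"
      by (auto simp: Y_chart_def split_factors_def)
    moreover have "power_prod d (split_factors d (length mu) a \<delta>)
        = (\<Prod>k<length mu. [:- a k, 1:] ^ (\<Sum>r\<in>{1..d}. r * count (\<delta> ! k) r))"
      by (simp add: power_prod_def split_factors_def power_sum prod_power_distrib prod.swap[of _ "{..<length mu}"]
          flip: power_mult) (simp add: mult.commute)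
    moreover have "(\<Sum>r\<in>{1..d}. r * count (\<delta> ! k) r) = mu ! k" if "k < length mu" for k
      using sum_mset_by_count[OF sub[OF \<delta> that]] \<delta> that by (auto simp: splittings_def partition_of_def)
    ultimately show "split_factors d (length mu) a \<delta> \<in> {g \<in> Y_chart d lam. power_prod d g = root_prod mu a}"
      by (simp add: root_prod_def)
  next
    fix g assume "g \<in> {g \<in> Y_chart d lam. power_prod d g = root_prod mu a}"
    then have g: "g \<in> Y_chart d lam" "power_prod d g = root_prod mu a" by auto
    have "\<exists>n. g r = (\<Prod>k<length mu. [:- a k, 1:] ^ n k)" if r: "r \<in> {1..d}" for r
    proof -
      have gr: "g r \<in> monics (count lam r)" using g(1) r by (rule Y_chartD)
      have "x \<in> a ` {..<length mu}" if "poly (g r) x = 0" for x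
      proof -
        have "poly (power_prod d g) x = 0" unfolding power_prod_def poly_prod
          using r that by (intro prod_zero) (auto intro!: bexI[of _ r])
        then show ?thesis unfolding g(2) by (auto simp: root_prod_def poly_prod)
      qed
      then obtain n where "g r = (\<Prod>k<length mu. [:- a k, 1:] ^ n k)"
        by (rule linear_factors_on[OF gr inj finite_lessThan])
      then show ?thesis by (intro exI[of _ n]) simp
    qed
    then obtain n where n: "\<And>r. r \<in> {1..d} \<Longrightarrow> g r = (\<Prod>k<length mu. [:- a k, 1:] ^ n r k)" by metis
    define \<delta> where "\<delta> = map (\<lambda>k. \<Sum>r\<in>{1..d}. replicate_mset (n r k) r) [0..<length mu]"
    have cnt: "count (\<delta> ! k) r = (if r \<in> {1..d} then n r k else 0)" if "k < length mu" for k r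
      using that by (auto simp: \<delta>_def count_sum)
    have "(\<Prod>k<length mu. [:- a k, 1:] ^ (\<Sum>r\<in>{1..d}. r * n r k)) = power_prod d g"
      using n by (simp add: power_prod_def power_sum prod_power_distrib prod.swap[of _ "{..<length mu}"]
          flip: power_mult) (simp add: mult.commute)
    then have eq: "(\<Prod>k<length mu. [:- a k, 1:] ^ (\<Sum>r\<in>{1..d}. r * n r k)) = (\<Prod>k<length mu. [:- a k, 1:] ^ (mu ! k))"
      by (simp add: g(2) root_prod_def)
    have muk: "(\<Sum>r\<in>{1..d}. r * n r k) = mu ! k" if "k < length mu" for k
      using arg_cong[OF eq, of "order (a k)"] that by (simp add: order_prod_linear[OF inj, of k])
    have part: "partition_of (mu ! k) (\<delta> ! k)" if "k < length mu" for k
    proof -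
      have sub: "set_mset (\<delta> ! k) \<subseteq> {1..d}" using cnt[OF that] by (auto simp flip: count_greater_zero_iff split: if_splits)
      then have "0 \<notin># \<delta> ! k" by force
      with cnt[OF that] muk[OF that] sum_mset_by_count[OF sub] show ?thesis by (simp add: partition_of_def)
    qed
    have "sum_list \<delta> = lam"
    proof (rule multiset_eqI)
      fix r
      show "count (sum_list \<delta>) r = count lam r"
      proof (cases "r \<in> {1..d}")
        case True
        then have "degree (g r) = count lam r" using Y_chartD[OF g(1) True] by (simp add: monics_def)
        moreover have "(\<Prod>k<length mu. [:- a k, 1:] ^ n r k) \<in> monics (\<Sum>k<length mu. n r k)"
          by (intro monics_prod monics_linear_power)
        then have "degree (g r) = (\<Sum>k<length mu. n r k)" using n[OF True] by (simp add: monics_def)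
        ultimately show ?thesis using True cnt by (simp add: csum \<delta>_def[THEN arg_cong, of length])
      next
        case False
        then have "r \<notin># lam" using partition_ofD(1)[OF lam] by blast
        then show ?thesis using False cnt by (auto simp: csum \<delta>_def[THEN arg_cong, of length] not_in_iff)
      qed
    qed
    then have "\<delta> \<in> splittings mu lam" using part by (simp add: splittings_def \<delta>_def)
    moreover have "g = split_factors d (length mu) a \<delta>"
    proof
      fix r show "g r = split_factors d (length mu) a \<delta> r"
        using n[of r] cnt g(1) by (cases "r \<in> {1..d}") (auto simp: split_factors_def Y_chart_def)
    qed
    ultimately show "\<exists>\<delta>\<in>splittings mu lam. g = split_factors d (length mu) a \<delta>" by blast
  qed
qed

lemma finite_splittings:
  assumes "partition_of d lam" shows "finite (splittings mu lam)"
proof -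
  obtain l where "mset l = lam" using ex_mset by blast
  then show ?thesis
    using splittings_eq[of l mu] assms finite_assignments by (auto simp: partition_of_def)
qed

lemma card_fibre:
  fixes a :: "nat \<Rightarrow> 'a::{alg_closed_field, field_char_0}"
  assumes "partition_of d lam" "partition_of d (mset mu)" "inj_on a {..<length mu}"
  shows "finite (fibre d lam (pt d c (root_prod mu a)))"
    "card (fibre d lam (pt d c (root_prod mu a))) = card (splittings mu lam)"
proof -
  have mon: "root_prod mu a \<in> monics d"
    using root_prod_monic[of mu a] partition_ofD(4)[OF assms(2)] by (simp add: sum_mset_sum_list)
  note bij = split_factors_bij[OF assms]
  have "finite {g \<in> Y_chart d lam. power_prod d g = root_prod mu a}"
    using bij_betw_finite[OF bij] finite_splittings[OF assms(1)] by blast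
  then show "finite (fibre d lam (pt d c (root_prod mu a)))"
    by (simp add: fibre_chart[OF assms(1) mon])
  have "inj_on (Y_pt d lam c) {g \<in> Y_chart d lam. power_prod d g = root_prod mu a}"
    by (rule inj_on_subset[OF Y_pt_inj]) auto
  then show "card (fibre d lam (pt d c (root_prod mu a))) = card (splittings mu lam)"
    using bij_betw_same_card[OF bij] by (simp add: fibre_chart[OF assms(1) mon] card_image)
qed

section \<open>Tangent maps\<close>

lemma unit_class: "unit_rel `` {(w, v)} = {(smult [:a:] w, smult [:a:] v + smult [:b:] w) | a b. a \<noteq> 0}"
  by (auto simp: unit_rel_def)

lemma unit_relI: "a \<noteq> 0 \<Longrightarrow> ((w, v), (smult [:a:] w, smult [:a:] v + smult [:b:] w)) \<in> unit_rel"
  by (auto simp: unit_rel_def)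

lemma smult_const_one [simp]: "smult [:1:] (p :: 'a::comm_ring_1 poly poly) = p"
  by (simp flip: one_pCons)

lemma smult_const_mult: "smult [:a:] (smult [:b:] p) = smult [:a * b:] p"
  for p :: "'a::comm_ring_1 poly poly"
  by (simp add: mult.commute)

lemma smult_const_add: "smult [:a:] p + smult [:b:] p = smult [:a + b:] p"
  for p :: "'a::comm_ring_1 poly poly"
  by (simp flip: smult_add_left)

lemma unit_rel_refl [simp]: "(p, p) \<in> unit_rel"
proof -
  have "((fst p, snd p), (smult [:1:] (fst p), smult [:1:] (snd p) + smult [:0:] (fst p))) \<in> unit_rel"
    by (rule unit_relI) simp
  then show ?thesis by (simp only: smult_const_one prod.collapse pCons_0_0 smult_0_left add_0_right)
qed

lemma unit_rel_sym: assumes "(p, q) \<in> unit_rel" shows "(q, p) \<in> unit_rel"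
proof -
  obtain w v where p: "p = (w, v)" by force
  then obtain a b where ab: "a \<noteq> 0" "q = (smult [:a:] w, smult [:a:] v + smult [:b:] w)"
    using assms by (auto simp: unit_rel_def)
  define e where "e = - b / a ^ 2"
  have "1 / a * a = 1" "1 / a * b + e * a = 0" using ab(1) by (simp_all add: e_def power2_eq_square)
  moreover have "(q, (smult [:1 / a:] (smult [:a:] w),
      smult [:1 / a:] (smult [:a:] v + smult [:b:] w) + smult [:e:] (smult [:a:] w))) \<in> unit_rel"
    unfolding ab(2) by (rule unit_relI) (use ab(1) in simp)
  ultimately show ?thesis
    by (simp only: p smult_add_right smult_const_mult add.assoc smult_const_add smult_const_one pCons_0_0
        smult_0_left add_0_right)
qed

lemma unit_rel_trans: assumes "(p, q) \<in> unit_rel" "(q, r) \<in> unit_rel" shows "(p, r) \<in> unit_rel"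
proof -
  obtain w v where p: "p = (w, v)" by force
  then obtain a b where ab: "a \<noteq> 0" "q = (smult [:a:] w, smult [:a:] v + smult [:b:] w)"
    using assms by (auto simp: unit_rel_def)
  then obtain c e where ce: "c \<noteq> 0" "r = (smult [:c:] (fst q), smult [:c:] (snd q) + smult [:e:] (fst q))"
    using assms(2) by (auto simp: unit_rel_def)
  have "r = (smult [:c * a:] w, smult [:c * a:] v + smult [:c * b + e * a:] w)"
    unfolding ce(2) ab(2) by (simp only: fst_conv snd_conv smult_add_right smult_const_mult add.assoc smult_const_add)
  then show ?thesis using unit_relI[of "c * a" w v "c * b + e * a"] ab(1) ce(1) by (simp only: p) simp
qed

lemma unit_class_eqI: assumes "p \<in> unit_rel `` {q}" shows "unit_rel `` {p} = unit_rel `` {q}"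
  using assms by (auto intro: unit_rel_sym unit_rel_trans)

text \<open>This identifies the tangent space at the point of \<open>w\<close> with the quotient by the multiples
  of \<open>w\<close>.\<close>
lemma unit_class_same_point:
  assumes "w \<noteq> 0"
  shows "unit_rel `` {(w, v)} = unit_rel `` {(w, v')} \<longleftrightarrow> (\<exists>b. v' = v + smult [:b:] w)"
proof
  assume "unit_rel `` {(w, v)} = unit_rel `` {(w, v')}"
  then have "(w, v') \<in> unit_rel `` {(w, v)}" by simp
  then obtain a b where *: "w = smult [:a:] w" "v' = smult [:a:] v + smult [:b:] w"
    unfolding unit_class by blast
  have "smult [:1 - a:] w + smult [:a:] w = w" by (simp only: smult_const_add) simp
  then have "smult [:1 - a:] w = 0" using *(1) by (metis add_cancel_left_left)
  then have "a = 1" using assms by simp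
  with *(2) show "\<exists>b. v' = v + smult [:b:] w" by (auto simp flip: one_pCons)
next
  assume "\<exists>b. v' = v + smult [:b:] w"
  then obtain b where "v' = smult [:1:] v + smult [:b:] w" by (auto simp flip: one_pCons)
  moreover have "w = smult [:1:] w" by (simp flip: one_pCons)
  ultimately have "(w, v') \<in> unit_rel `` {(w, v)}" using unit_relI[of 1 w v b] by simp
  then show "unit_rel `` {(w, v)} = unit_rel `` {(w, v')}" by (rule unit_class_eqI[symmetric])
qed

lemma tangent_space_class:
  assumes "P = prop_rel `` {w}"
  shows "tangent_space k P = {unit_rel `` {(w, v)} | v. v \<in> forms k}"
proof (intro subset_antisym subsetI)
  fix \<tau> assume "\<tau> \<in> tangent_space k P"
  then obtain w' v' where \<tau>: "w' \<in> P" "v' \<in> forms k" "\<tau> = unit_rel `` {(w', v')}"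
    by (auto simp: tangent_space_def quotient_def)
  then obtain a where a: "a \<noteq> 0" "w' = smult [:a:] w" using assms by (auto simp: prop_class)
  have "v' = smult [:a:] (smult [:1 / a:] v') + smult [:0:] w" using a(1) by (simp flip: one_pCons)
  then have "(w', v') \<in> unit_rel `` {(w, smult [:1 / a:] v')}" using a unfolding unit_class by blast
  then have "\<tau> = unit_rel `` {(w, smult [:1 / a:] v')}" unfolding \<tau>(3) by (rule unit_class_eqI)
  then show "\<tau> \<in> {unit_rel `` {(w, v)} | v. v \<in> forms k}" using \<tau>(2) forms_smult by blast
next
  fix \<tau> assume "\<tau> \<in> {unit_rel `` {(w, v)} | v. v \<in> forms k}"
  then show "\<tau> \<in> tangent_space k P" unfolding tangent_space_def quotient_def assms by auto
qed

lemma coeff_mult_01: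
  "coeff (p * q) 0 = coeff p 0 * coeff q 0"
  "coeff (p * q) (Suc 0) = coeff p 0 * coeff q (Suc 0) + coeff p (Suc 0) * coeff q 0"
  by (simp_all add: coeff_mult)

text \<open>The first two coefficients of a product of polynomials in $\epsilon$ change by a unit of the
  dual numbers if those of its factors do.\<close>
lemma unit_rel_mult:
  assumes "((coeff p 0, coeff p 1), (coeff p' 0, coeff p' 1)) \<in> unit_rel"
    and "((coeff q 0, coeff q 1), (coeff q' 0, coeff q' 1)) \<in> unit_rel"
  shows "((coeff (p * q) 0, coeff (p * q) 1), (coeff (p' * q') 0, coeff (p' * q') 1)) \<in> unit_rel"
proof -
  obtain a b where 1: "a \<noteq> 0" "coeff p' 0 = smult [:a:] (coeff p 0)"
      "coeff p' 1 = smult [:a:] (coeff p 1) + smult [:b:] (coeff p 0)"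
    using assms(1) by (auto simp: unit_rel_def)
  obtain a' b' where 2: "a' \<noteq> 0" "coeff q' 0 = smult [:a':] (coeff q 0)"
      "coeff q' 1 = smult [:a':] (coeff q 1) + smult [:b':] (coeff q 0)"
    using assms(2) by (auto simp: unit_rel_def)
  show ?thesis unfolding unit_rel_def
  proof (clarify, intro exI conjI)
    show "a * a' \<noteq> 0" using 1 2 by simp
    show "coeff (p' * q') 0 = smult [:a * a':] (coeff (p * q) 0)"
      using 1 2 by (simp add: coeff_mult_01 mult.commute)
    show "coeff (p' * q') 1 = smult [:a * a':] (coeff (p * q) 1) + smult [:a * b' + b * a':] (coeff (p * q) 0)"
    proof -
      define P0 P1 Q0 Q1 where "P0 = coeff p 0" "P1 = coeff p 1" "Q0 = coeff q 0" "Q1 = coeff q 1"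
      have sm: "smult c x = [:c:] * x" for c :: "'a poly" and x by simp
      have cc: "[:[:x * y:]:] = [:[:x:]:] * [:[:y:]:]" "[:[:x + y:]:] = [:[:x:]:] + [:[:y:]:]" for x y :: 'a
        by simp_all
      show ?thesis using 1 2 unfolding One_nat_def coeff_mult_01
        by (simp only: sm cc) (simp only: algebra_simps)
    qed
  qed
qed

lemma unit_rel_prod:
  assumes "\<And>r. r \<in> I \<Longrightarrow> ((coeff (p r) 0, coeff (p r) 1), (coeff (q r) 0, coeff (q r) 1)) \<in> unit_rel"
  shows "((coeff (\<Prod>r\<in>I. p r ^ n r) 0, coeff (\<Prod>r\<in>I. p r ^ n r) 1),
          (coeff (\<Prod>r\<in>I. q r ^ n r) 0, coeff (\<Prod>r\<in>I. q r ^ n r) 1)) \<in> unit_rel"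
  using assms
proof (induction I rule: infinite_finite_induct)
  case (insert r I)
  have "((coeff (p r ^ m) 0, coeff (p r ^ m) 1), (coeff (q r ^ m) 0, coeff (q r ^ m) 1)) \<in> unit_rel" for m
    by (induction m) (use insert.prems[of r] unit_rel_mult in auto)
  moreover have "((coeff (\<Prod>r\<in>I. p r ^ n r) 0, coeff (\<Prod>r\<in>I. p r ^ n r) 1),
      (coeff (\<Prod>r\<in>I. q r ^ n r) 0, coeff (\<Prod>r\<in>I. q r ^ n r) 1)) \<in> unit_rel"
    using insert by blast
  ultimately show ?case unfolding prod.insert[OF insert.hyps] by (rule unit_rel_mult)
qed auto

text \<open>The differential of \<open>power_prod d\<close> at \<open>w\<close> in the direction \<open>v\<close>.\<close>
definition lin_part :: "nat \<Rightarrow> (nat \<Rightarrow> 'a::comm_ring_1) \<Rightarrow> (nat \<Rightarrow> 'a) \<Rightarrow> 'a" where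
  "lin_part d w v = (\<Sum>r\<in>{1..d}. of_nat r * v r * w r ^ (r - 1) * (\<Prod>s\<in>{1..d} - {r}. w s ^ s))"

lemma coeff_prod_01:
  assumes "finite I"
  shows "coeff (\<Prod>r\<in>I. p r) 0 = (\<Prod>r\<in>I. coeff (p r) 0)"
    "coeff (\<Prod>r\<in>I. p r) (Suc 0) = (\<Sum>r\<in>I. coeff (p r) (Suc 0) * (\<Prod>s\<in>I - {r}. coeff (p s) 0))"
proof -
  show 0: "coeff (\<Prod>r\<in>I. p r) 0 = (\<Prod>r\<in>I. coeff (p r) 0)" for I
    by (induction I rule: infinite_finite_induct) (auto simp: coeff_mult_01)
  show "coeff (\<Prod>r\<in>I. p r) (Suc 0) = (\<Sum>r\<in>I. coeff (p r) (Suc 0) * (\<Prod>s\<in>I - {r}. coeff (p s) 0))"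
    using assms
  proof (induction I rule: finite_induct)
    case (insert r I)
    have "(\<Prod>s\<in>insert r I - {u}. coeff (p s) 0) = coeff (p r) 0 * (\<Prod>s\<in>I - {u}. coeff (p s) 0)" if "u \<in> I" for u
    proof -
      have "insert r I - {u} = insert r (I - {u})" using that insert by auto
      then show ?thesis using insert by simp
    qed
    then show ?case using insert by (simp add: coeff_mult_01 0 sum_distrib_left mult_ac add.commute cong: sum.cong_simp)
  qed simp
qed

lemma coeff_linear_power_01:
  "coeff ([:w, v:] ^ r) 0 = w ^ r" "coeff ([:w, v:] ^ r) (Suc 0) = of_nat r * v * w ^ (r - 1)"
proof -
  show 0: "coeff ([:w, v:] ^ r) 0 = w ^ r" for r
    by (induction r) (auto simp: coeff_mult_01)
  show "coeff ([:w, v:] ^ r) (Suc 0) = of_nat r * v * w ^ (r - 1)"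
  proof (induction r)
    case (Suc r)
    have "of_nat r * v * w ^ (r - 1) * w = of_nat r * v * w ^ r" by (cases r) (auto simp: mult_ac)
    then show ?case unfolding power_Suc coeff_mult_01 0 Suc by (simp add: algebra_simps)
  qed simp
qed

lemma df_map_class:
  assumes "\<And>r. r \<in> {1..d} \<Longrightarrow> \<xi> r = unit_rel `` {(w r, v r)}"
  shows "df_map d \<xi> = unit_rel `` {(power_prod d w, lin_part d w v)}"
proof -
  define p where "p = (\<lambda>u :: nat \<Rightarrow> 'a poly poly \<times> 'a poly poly. \<Prod>r\<in>{1..d}. [:fst (u r), snd (u r):] ^ r)"
  define u0 where "u0 = restrict (\<lambda>r. (w r, v r)) {1..d}"
  have u0: "u0 \<in> PiE {1..d} \<xi>" using assms by (auto simp: u0_def)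
  have cl: "unit_rel `` {(coeff (p u) 0, coeff (p u) 1)} = unit_rel `` {(coeff (p u0) 0, coeff (p u0) 1)}"
    if "u \<in> PiE {1..d} \<xi>" for u
  proof (rule unit_class_eqI)
    have "((coeff [:fst (u0 r), snd (u0 r):] 0, coeff [:fst (u0 r), snd (u0 r):] 1),
         (coeff [:fst (u r), snd (u r):] 0, coeff [:fst (u r), snd (u r):] 1)) \<in> unit_rel" if "r \<in> {1..d}" for r
      using PiE_mem[OF \<open>u \<in> _\<close> that] assms[OF that] that by (simp add: u0_def)
    then have "((coeff (p u0) 0, coeff (p u0) 1), (coeff (p u) 0, coeff (p u) 1)) \<in> unit_rel"
      unfolding p_def by (rule unit_rel_prod)
    then show "(coeff (p u) 0, coeff (p u) 1) \<in> unit_rel `` {(coeff (p u0) 0, coeff (p u0) 1)}" by simp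
  qed
  have "df_map d \<xi> = (\<Union>u\<in>PiE {1..d} \<xi>. unit_rel `` {(coeff (p u) 0, coeff (p u) 1)})"
    by (simp add: df_map_def p_def Let_def)
  also have "\<dots> = unit_rel `` {(coeff (p u0) 0, coeff (p u0) 1)}"
    using cl u0 by blast
  also have "coeff (p u0) 0 = power_prod d w"
    by (simp add: p_def u0_def coeff_prod_01 coeff_linear_power_01 power_prod_def)
  also have "coeff (p u0) 1 = lin_part d w v"
    by (simp add: p_def u0_def coeff_prod_01 coeff_linear_power_01 lin_part_def)
  finally show ?thesis .
qed

lemma dehom_lin_part:
  fixes c :: "'a::field_char_0"
  shows "dehom c (lin_part d w v) = lin_part d (\<lambda>r. dehom c (w r)) (\<lambda>r. dehom c (v r))"
proof -
  have "dehom c (of_nat n :: 'a poly poly) = of_nat n" for n by (induction n) auto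
  then show ?thesis by (simp add: lin_part_def dehom_sum dehom_prod)
qed

lemma lin_part_diff: "lin_part d w (\<lambda>r. v r - v' r) = lin_part d w v - lin_part d w v'"
  by (simp add: lin_part_def algebra_simps sum_subtractf)

lemma linear_prod_dvd:
  fixes a :: "nat \<Rightarrow> 'a::field"
  assumes "finite K" "inj_on a K" "y \<noteq> 0" "\<And>k. k \<in> K \<Longrightarrow> n k \<le> order (a k) y"
  shows "(\<Prod>k\<in>K. [:- a k, 1:] ^ n k) dvd y"
  using assms
proof (induction K rule: finite_induct)
  case (insert k K)
  define q where "q = (\<Prod>k\<in>K. [:- a k, 1:] ^ n k)"
  have "q dvd y" using insert by (auto simp: q_def)
  then obtain z where z: "y = q * z" by (rule dvdE)
  have "poly q (a k) \<noteq> 0" using insert by (auto simp: q_def poly_prod inj_on_def)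
  then have "order (a k) q = 0" by (rule order_0I)
  then have "n k \<le> order (a k) z" using insert.prems(3)[of k] insert.prems(2) z by (simp add: order_mult)
  then have "[:- a k, 1:] ^ n k dvd z" by (simp add: order_divides)
  then show ?case using insert.hyps by (simp add: z q_def[symmetric] mult_dvd_mono mult.commute)
qed simp

text \<open>Dividing by $\prod_s g_s^s$, the equation says $\sum_s s\,y_s/g_s = b$. If no two factors share a root, the
  poles of the summands are disjoint and have to cancel separately, so that $g_r$ divides $y_r$.\<close>
lemma lin_part_multiple:
  fixes a :: "nat \<Rightarrow> 'a::field_char_0"
  assumes inj: "inj_on a {..<m}"
    and g: "\<And>r. r \<in> {1..d} \<Longrightarrow> g r = (\<Prod>k<m. [:- a k, 1:] ^ n r k)"
    and one: "\<And>r s k. r \<in> {1..d} \<Longrightarrow> s \<in> {1..d} \<Longrightarrow> k < m \<Longrightarrow> n r k > 0 \<Longrightarrow> n s k > 0 \<Longrightarrow> r = s"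
    and eq: "lin_part d g y = smult b (power_prod d g)"
    and r: "r \<in> {1..d}" and deg: "degree (y r) \<le> degree (g r)"
  shows "\<exists>c. y r = smult c (g r)"
proof (cases "y r = 0")
  case False
  have g0: "g s \<noteq> 0" if "s \<in> {1..d}" for s using g[OF that] by simp
  define q where "q = (\<Prod>s\<in>{1..d} - {r}. g s ^ s)"
  have rest: "g r ^ r dvd (\<Sum>s\<in>{1..d} - {r}. of_nat s * y s * g s ^ (s - 1) * (\<Prod>u\<in>{1..d} - {s}. g u ^ u))"
  proof (rule dvd_sum)
    fix s assume "s \<in> {1..d} - {r}"
    then have "g r ^ r dvd (\<Prod>u\<in>{1..d} - {s}. g u ^ u)" using r by (intro dvd_prodI) auto
    then show "g r ^ r dvd of_nat s * y s * g s ^ (s - 1) * (\<Prod>u\<in>{1..d} - {s}. g u ^ u)" by (rule dvd_mult)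
  qed
  have "g r ^ r dvd smult b (power_prod d g)"
    unfolding power_prod_def using r by (intro dvd_smult dvd_prodI) auto
  then have "g r ^ r dvd lin_part d g y" by (simp only: eq)
  moreover have "lin_part d g y = of_nat r * y r * g r ^ (r - 1) * q
      + (\<Sum>s\<in>{1..d} - {r}. of_nat s * y s * g s ^ (s - 1) * (\<Prod>u\<in>{1..d} - {s}. g u ^ u))"
    unfolding lin_part_def q_def using r by (subst sum.remove[of _ r]) auto
  ultimately have "g r ^ r dvd of_nat r * y r * g r ^ (r - 1) * q"
    by (simp only: dvd_add_left_iff[OF rest])
  moreover have "g r ^ r = g r ^ (r - 1) * g r" using r by (cases r) (auto simp: mult.commute)
  ultimately have "g r ^ (r - 1) * g r dvd g r ^ (r - 1) * (of_nat r * (y r * q))" by (simp add: mult_ac)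
  then have "g r dvd of_nat r * (y r * q)" using g0[OF r] by (simp only: dvd_mult_cancel_left) simp
  then have dvd: "g r dvd y r * q" using r by (simp add: of_nat_poly dvd_smult_iff)
  have q0: "q \<noteq> 0" using g0 by (auto simp: q_def)
  have "(\<Prod>k<m. [:- a k, 1:] ^ n r k) dvd y r"
  proof (rule linear_prod_dvd[OF _ inj False])
    fix k assume k: "k \<in> {..<m}"
    show "n r k \<le> order (a k) (y r)"
    proof (cases "n r k = 0")
      case nz: False
      have "poly (g s) (a k) \<noteq> 0" if "s \<in> {1..d} - {r}" for s
      proof
        assume "poly (g s) (a k) = 0"
        moreover have "g s = (\<Prod>k<m. [:- a k, 1:] ^ n s k)" using that g by blast
        ultimately obtain j where "j < m" "a k = a j" "n s j > 0" by (auto simp: poly_prod)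
        then have "n s k > 0" using inj k by (auto simp: inj_on_def)
        then show False using one[of r s k] that nz k r by auto
      qed
      then have "poly q (a k) \<noteq> 0" by (auto simp: q_def poly_prod)
      then have "order (a k) q = 0" by (rule order_0I)
      then have "order (a k) (y r * q) = order (a k) (y r)" using False q0 by (simp add: order_mult)
      moreover have "order (a k) (g r) \<le> order (a k) (y r * q)" using dvd False q0 by (intro dvd_imp_order_le) auto
      moreover have "order (a k) (g r) = n r k" unfolding g[OF r] using order_prod_linear[OF inj k] by simp
      ultimately show ?thesis by simp
    qed simp
  qed simp
  then obtain z where z: "y r = g r * z" unfolding g[OF r, symmetric] by (rule dvdE)
  then have "degree z = 0" using deg False by (auto simp: degree_mult_eq)
  then obtain e where "z = [:e:]" by (rule degree_eq_zeroE)
  then show ?thesis using z by auto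
qed (auto intro: exI[of _ 0])

text \<open>The partition $\delta^k$ is even if and only if the root $a_k$ occurs in one factor only. If it
  occurs in $w_r$ and in $w_s$, moving it in $w_r$ with velocity proportional to $s$ and in $w_s$ with
  velocity proportional to $- r$ leaves the product unchanged to first order.\<close>
lemma tangent_map_injective_iff:
  fixes a :: "nat \<Rightarrow> 'a::{alg_closed_field, field_char_0}"
  assumes lam: "partition_of d lam" and mu: "partition_of d (mset mu)" and inj: "inj_on a {..<length mu}"
    and \<delta>: "\<delta> \<in> splittings mu lam"
  defines "g \<equiv> split_factors d (length mu) a \<delta>"
  shows "inj_on (df_map d) (tangent_Y d lam (Y_pt d lam c g)) \<longleftrightarrow> (\<forall>k<length mu. even_partition (\<delta> ! k))"
proof -
  have "g \<in> Y_chart d lam" using bij_betwE[OF split_factors_bij[OF lam mu inj]] \<delta> by (auto simp: g_def)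
  then have gm: "g r \<in> monics (count lam r)" if "r \<in> {1..d}" for r using that by (rule Y_chartD)
  define w where "w = (\<lambda>r. homog c (count lam r) (g r))"
  have w: "w r \<in> forms (count lam r)" "w r \<noteq> 0" "dehom c (w r) = g r" if "r \<in> {1..d}" for r
    using gm[OF that] by (auto simp: w_def homog_nonzero dehom_homog monics_iff)
  have W0: "power_prod d w \<noteq> 0" using w(2) by (auto simp: power_prod_def)
  have pts: "Y_pt d lam c g r = prop_rel `` {w r}" if "r \<in> {1..d}" for r
    using that by (simp add: Y_pt_def pt_def w_def)
  have gr: "g r = (\<Prod>k<length mu. [:- a k, 1:] ^ count (\<delta> ! k) r)" if "r \<in> {1..d}" for r
    using that by (simp add: g_def split_factors_def)
  have parts: "r \<in> {1..d}" if "k < length mu" "r \<in># \<delta> ! k" for k r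
  proof -
    have "r \<in> {1..mu ! k}" using \<delta> that partition_ofD(1)[of "mu ! k" "\<delta> ! k"] by (auto simp: splittings_def)
    moreover have "mu ! k \<le> d" using partition_ofD(1)[OF mu] that by (auto dest!: nth_mem)
    ultimately show ?thesis by auto
  qed
  show ?thesis
  proof
    assume even: "\<forall>k<length mu. even_partition (\<delta> ! k)"
    show "inj_on (df_map d) (tangent_Y d lam (Y_pt d lam c g))"
    proof (rule inj_onI)
      fix \<xi> \<xi>' assume \<xi>: "\<xi> \<in> tangent_Y d lam (Y_pt d lam c g)" "\<xi>' \<in> tangent_Y d lam (Y_pt d lam c g)"
        and eq: "df_map d \<xi> = df_map d \<xi>'"
      have rep: "\<exists>v\<in>forms (count lam r). \<zeta> r = unit_rel `` {(w r, v)}"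
        if "r \<in> {1..d}" "\<zeta> \<in> tangent_Y d lam (Y_pt d lam c g)" for r \<zeta>
        using PiE_mem[OF that(2)[unfolded tangent_Y_def] that(1)] tangent_space_class[OF pts[OF that(1)]] by auto
      obtain v where v: "\<And>r. r \<in> {1..d} \<Longrightarrow> v r \<in> forms (count lam r) \<and> \<xi> r = unit_rel `` {(w r, v r)}"
        using rep[OF _ \<xi>(1)] by metis
      obtain v' where v': "\<And>r. r \<in> {1..d} \<Longrightarrow> v' r \<in> forms (count lam r) \<and> \<xi>' r = unit_rel `` {(w r, v' r)}"
        using rep[OF _ \<xi>(2)] by metis
      have "df_map d \<xi> = unit_rel `` {(power_prod d w, lin_part d w v)}" using v by (intro df_map_class) auto
      moreover have "df_map d \<xi>' = unit_rel `` {(power_prod d w, lin_part d w v')}" using v' by (intro df_map_class) auto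
      ultimately obtain b where "lin_part d w v' = lin_part d w v + smult [:b:] (power_prod d w)"
        using eq unit_class_same_point[OF W0] by metis
      then have lp: "lin_part d w (\<lambda>r. v' r - v r) = smult [:b:] (power_prod d w)"
        by (simp add: lin_part_diff)
      define y where "y = (\<lambda>r. dehom c (v' r) - dehom c (v r))"
      have dd: "dehom c (G - H) = dehom c G - dehom c H" for G H :: "'a poly poly"
        using dehom_simps(1)[of c "G - H" H] by simp
      have "lin_part d (\<lambda>r. dehom c (w r)) y = smult b (power_prod d (\<lambda>r. dehom c (w r)))"
        using arg_cong[OF lp, of "dehom c"]
        by (simp add: dehom_lin_part y_def dd) (simp add: power_prod_def dehom_prod)
      moreover have "lin_part d (\<lambda>r. dehom c (w r)) y = lin_part d g y"
          "power_prod d (\<lambda>r. dehom c (w r)) = power_prod d g"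
        using w(3) by (auto simp: lin_part_def power_prod_def intro!: sum.cong prod.cong)
      ultimately have lg: "lin_part d g y = smult b (power_prod d g)" by simp
      have "\<xi> r = \<xi>' r" if r: "r \<in> {1..d}" for r
      proof -
        have "\<exists>e. y r = smult e (g r)"
        proof (rule lin_part_multiple[OF inj gr _ lg r])
          show "s = t" if "k < length mu" "0 < count (\<delta> ! k) s" "0 < count (\<delta> ! k) t" for s t k
            using even that by (auto simp: even_partition_def)
          have "degree (y r) \<le> count lam r"
            unfolding y_def using v[OF r] v'[OF r] by (intro degree_diff_le degree_dehom) auto
          then show "degree (y r) \<le> degree (g r)" using gm[OF r] by (simp add: monics_def)
        qed
        then obtain e where e: "dehom c (v' r) = dehom c (v r + smult [:e:] (w r))"
          using w(3)[OF r] by (auto simp: y_def algebra_simps)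
        have "v' r = v r + smult [:e:] (w r)"
          using v[OF r] v'[OF r] w(1)[OF r] by (intro dehom_inj[OF _ _ e]) (auto intro: forms_add forms_smult)
        then show ?thesis using v[OF r] v'[OF r] unit_class_same_point[OF w(2)[OF r]] by metis
      qed
      then show "\<xi> = \<xi>'" using \<xi> unfolding tangent_Y_def by (intro PiE_ext)
    qed
  next
    assume injd: "inj_on (df_map d) (tangent_Y d lam (Y_pt d lam c g))"
    show "\<forall>k<length mu. even_partition (\<delta> ! k)"
    proof (rule ccontr)
      assume "\<not> (\<forall>k<length mu. even_partition (\<delta> ! k))"
      then obtain k r s where k: "k < length mu" and rs: "r \<in># \<delta> ! k" "s \<in># \<delta> ! k" "r \<noteq> s"
        by (auto simp: even_partition_def)
      then have r: "r \<in> {1..d}" and s: "s \<in> {1..d}" using parts by auto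
      define \<Lambda> where "\<Lambda> = homog c 1 [:- a k, 1:]"
      have \<Lambda>: "\<Lambda> \<in> forms 1" "\<Lambda> \<noteq> 0" "dehom c \<Lambda> = [:- a k, 1:]"
        by (auto simp: \<Lambda>_def homog_nonzero dehom_homog)
      define N where "N = homog c 1 1"
      have N: "N \<in> forms 1" "dehom c N = 1" by (auto simp: N_def dehom_homog)
      have "\<exists>h. h \<in> forms (count lam u - 1) \<and> count lam u \<ge> 1 \<and> w u = \<Lambda> * h"
        if u: "u \<in> {1..d}" "u \<in># \<delta> ! k" for u
      proof -
        have "poly (g u) (a k) = 0" using gr[OF u(1)] k u(2) by (auto simp: poly_prod)
        then obtain q where q: "g u = [:- a k, 1:] * q" unfolding poly_eq_0_iff_dvd by (rule dvdE)
        have "q \<noteq> 0" "g u \<noteq> 0" using gm[OF u(1)] q by (auto simp: monics_iff)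
        then have deg: "count lam u = Suc (degree q)"
          using gm[OF u(1)] arg_cong[OF q, of degree] by (subst (asm) degree_mult_eq) (auto simp: monics_def)
        define h where "h = homog c (count lam u - 1) q"
        have "\<Lambda> * h \<in> forms (1 + (count lam u - 1))" unfolding h_def by (intro forms_mult \<Lambda> homog_forms)
        then have "w u = \<Lambda> * h"
          using w(1,3)[OF u(1)] deg by (intro dehom_inj[of _ "count lam u" _ c]) (auto simp: h_def \<Lambda> q dehom_homog)
        with deg show ?thesis by (intro exI[of _ h]) (simp add: h_def)
      qed
      from this[OF r rs(1)] this[OF s rs(2)] obtain h h' where
        h: "h \<in> forms (count lam r - 1)" "count lam r \<ge> 1" "w r = \<Lambda> * h" and
        h': "h' \<in> forms (count lam s - 1)" "count lam s \<ge> 1" "w s = \<Lambda> * h'" by blast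
      define v where "v = (\<lambda>u. if u = r then smult [:of_nat s:] (N * h)
        else if u = s then smult [:- of_nat r:] (N * h') else 0)"
      have "N * h \<in> forms (1 + (count lam r - 1))" "N * h' \<in> forms (1 + (count lam s - 1))"
        by (intro forms_mult N h h')+
      then have vf: "v u \<in> forms (count lam u)" for u
        using h(2) h'(2) by (auto simp: v_def intro: forms_smult)
      have nat_smult: "smult [:of_nat n:] x = of_nat n * x" for n and x :: "'a poly poly"
        by (simp add: of_nat_poly)
      have summand: "\<Lambda> * (of_nat u * v u * w u ^ (u - 1) * (\<Prod>t\<in>{1..d} - {u}. w t ^ t))
          = of_nat u * x * N * power_prod d w" if "u \<in> {1..d}" "\<Lambda> * v u = x * N * w u" for u x
      proof -
        have "power_prod d w = w u * w u ^ (u - 1) * (\<Prod>t\<in>{1..d} - {u}. w t ^ t)"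
          unfolding power_prod_def using that(1) by (subst prod.remove[of _ u]) (auto simp flip: power_Suc)
        then have "of_nat u * x * N * power_prod d w
          = of_nat u * (x * N * w u) * w u ^ (u - 1) * (\<Prod>t\<in>{1..d} - {u}. w t ^ t)" by (simp only: mult_ac)
        then show ?thesis unfolding that(2)[symmetric] by (simp only: mult_ac)
      qed
      have vr: "\<Lambda> * v r = of_nat s * N * w r" using h(3) by (simp add: v_def nat_smult mult_ac)
      have vs: "\<Lambda> * v s = (- of_nat r) * N * w s"
      proof -
        have "[:- of_nat r :: 'a:] = - [:of_nat r:]" by simp
        then have "smult [:- of_nat r:] (N * h') = - (of_nat r * (N * h'))"
          by (simp only: smult_minus_left nat_smult)
        then show ?thesis using h'(3) rs(3) by (simp add: v_def mult_ac)
      qed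
      have "\<Lambda> * lin_part d w v = (\<Sum>u\<in>{r, s}. \<Lambda> * (of_nat u * v u * w u ^ (u - 1) * (\<Prod>t\<in>{1..d} - {u}. w t ^ t)))"
        unfolding lin_part_def sum_distrib_left
        using r s by (intro sum.mono_neutral_right) (auto simp: v_def)
      also have "\<dots> = 0" using summand[OF r vr] summand[OF s vs] rs(3) by (simp add: mult_ac)
      finally have lp0: "lin_part d w v = 0" using \<Lambda>(2) by simp
      define \<xi> where "\<xi> = (\<lambda>v. restrict (\<lambda>u. unit_rel `` {(w u, v u)}) {1..d})"
      have tan: "\<xi> v \<in> tangent_Y d lam (Y_pt d lam c g)" if "\<And>u. v u \<in> forms (count lam u)" for v
        unfolding tangent_Y_def \<xi>_def
      proof (rule restrict_PiE_iff[THEN iffD2], rule ballI)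
        fix u assume "u \<in> {1..d}"
        show "unit_rel `` {(w u, v u)} \<in> tangent_space (count lam u) (Y_pt d lam c g u)"
          unfolding tangent_space_class[OF pts[OF \<open>u \<in> {1..d}\<close>]] using that by blast
      qed
      have df: "df_map d (\<xi> v) = unit_rel `` {(power_prod d w, lin_part d w v)}" for v
        by (rule df_map_class) (simp add: \<xi>_def)
      have "lin_part d w (\<lambda>_. 0) = 0" by (simp add: lin_part_def)
      then have "df_map d (\<xi> v) = df_map d (\<xi> (\<lambda>_. 0))" by (simp add: df lp0)
      then have \<xi>eq: "\<xi> v = \<xi> (\<lambda>_. 0)" by (rule inj_onD[OF injd]) (auto intro!: tan vf)
      have "unit_rel `` {(w r, 0)} = unit_rel `` {(w r, v r)}"
        using fun_cong[OF \<xi>eq, of r] r by (simp add: \<xi>_def)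
      then obtain b where "v r = smult [:b:] (w r)"
        unfolding unit_class_same_point[OF w(2)[OF r]] by auto
      then have "\<Lambda> * v r = (smult [:b:] \<Lambda>) * w r" by simp
      then have "(of_nat s * N) * w r = (smult [:b:] \<Lambda>) * w r" unfolding vr .
      then have "of_nat s * N = smult [:b:] \<Lambda>" using w(2)[OF r] by (simp only: mult_cancel_right) simp
      then have "dehom c (smult [:of_nat s:] N) = dehom c (smult [:b:] \<Lambda>)" by (simp only: nat_smult)
      then have "[:of_nat s:] = smult b [:- a k, 1:]" by (simp add: N \<Lambda>)
      then have "of_nat s = (0 :: 'a)" by auto
      then show False using s by simp
    qed
  qed
qed

section \<open>Local rings of fractions\<close>

text \<open>A domain $C$ with a $K$-valued point \<open>ev\<close>, and its local ring at this point. The elements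
  \<open>frac x q\<close> of the ring stay abstract, because the local rings of varieties are given by classes of
  pairs of homogeneous polynomials, which are not themselves elements of $C$.\<close>
locale fraction_ring =
  fixes A :: "'r ring" (structure) and C :: "'t::comm_ring_1 set"
    and ev :: "'t \<Rightarrow> 'k::field" and cst :: "'k \<Rightarrow> 't" and frac :: "'t \<Rightarrow> 't \<Rightarrow> 'r"
  assumes C_cst [intro, simp]: "cst a \<in> C"
    and C_add [intro, simp]: "x \<in> C \<Longrightarrow> y \<in> C \<Longrightarrow> x + y \<in> C"
    and C_mult [intro, simp]: "x \<in> C \<Longrightarrow> y \<in> C \<Longrightarrow> x * y \<in> C"
    and cst_0 [simp]: "cst 0 = 0" and cst_1 [simp]: "cst 1 = 1"
    and cst_add: "cst (a + b) = cst a + cst b" and cst_mult: "cst (a * b) = cst a * cst b"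
    and ev_cst [simp]: "ev (cst a) = a"
    and ev_add [simp]: "x \<in> C \<Longrightarrow> y \<in> C \<Longrightarrow> ev (x + y) = ev x + ev y"
    and ev_mult [simp]: "x \<in> C \<Longrightarrow> y \<in> C \<Longrightarrow> ev (x * y) = ev x * ev y"
    and C_domain: "x \<in> C \<Longrightarrow> y \<in> C \<Longrightarrow> x * y = 0 \<Longrightarrow> x = 0 \<or> y = 0"
    and carrier_frac: "carrier A = {frac x q | x q. x \<in> C \<and> q \<in> C \<and> ev q \<noteq> 0}"
    and frac_eq_iff: "\<lbrakk>x \<in> C; q \<in> C; ev q \<noteq> 0; x' \<in> C; q' \<in> C; ev q' \<noteq> 0\<rbrakk>
          \<Longrightarrow> frac x q = frac x' q' \<longleftrightarrow> x * q' = x' * q"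
    and frac_mult: "\<lbrakk>x \<in> C; q \<in> C; ev q \<noteq> 0; x' \<in> C; q' \<in> C; ev q' \<noteq> 0\<rbrakk>
          \<Longrightarrow> frac x q \<otimes> frac x' q' = frac (x * x') (q * q')"
    and frac_add: "\<lbrakk>x \<in> C; q \<in> C; ev q \<noteq> 0; x' \<in> C; q' \<in> C; ev q' \<noteq> 0\<rbrakk>
          \<Longrightarrow> frac x q \<oplus> frac x' q' = frac (x * q' + x' * q) (q * q')"
    and frac_one: "\<one> = frac 1 1" and frac_zero: "\<zero> = frac 0 1"
begin

lemma C_0 [simp]: "0 \<in> C" and C_1 [simp]: "1 \<in> C"
  using C_cst[of 0] C_cst[of 1] by simp_all

lemma ev_0 [simp]: "ev 0 = 0" and ev_1 [simp]: "ev 1 = 1"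
  using ev_cst[of 0] ev_cst[of 1] by simp_all

lemma cst_uminus: "cst (- a) = - cst a"
  using cst_add[of a "- a"] by (simp add: eq_neg_iff_add_eq_0 add.commute)

lemma C_uminus [intro, simp]: "x \<in> C \<Longrightarrow> - x \<in> C"
  using C_mult[OF C_cst[of "- 1"], of x] by (simp add: cst_uminus)

lemma C_diff [intro, simp]: "x \<in> C \<Longrightarrow> y \<in> C \<Longrightarrow> x - y \<in> C"
  using C_add[OF _ C_uminus, of x y] by simp

lemma ev_uminus [simp]: "x \<in> C \<Longrightarrow> ev (- x) = - ev x"
proof -
  assume "x \<in> C"
  have "ev (- x) = ev (cst (- 1) * x)" by (simp add: cst_uminus)
  also have "\<dots> = ev (cst (- 1)) * ev x" using \<open>x \<in> C\<close> by (intro ev_mult) auto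
  also have "ev (cst (- 1)) = - 1" by (rule ev_cst)
  finally show ?thesis by simp
qed

lemma ev_diff [simp]: "x \<in> C \<Longrightarrow> y \<in> C \<Longrightarrow> ev (x - y) = ev x - ev y"
  using ev_add[OF _ C_uminus, of x y] by simp

lemma C_power [intro, simp]: "x \<in> C \<Longrightarrow> x ^ n \<in> C"
  by (induction n) auto

lemma C_sum [intro]: "(\<And>i. i \<in> I \<Longrightarrow> f i \<in> C) \<Longrightarrow> sum f I \<in> C"
  by (induction I rule: infinite_finite_induct) auto

lemma frac_closed [intro, simp]: "\<lbrakk>x \<in> C; q \<in> C; ev q \<noteq> 0\<rbrakk> \<Longrightarrow> frac x q \<in> carrier A"
  by (auto simp: carrier_frac)

lemma frac_cases:
  assumes "a \<in> carrier A"
  obtains x q where "a = frac x q" "x \<in> C" "q \<in> C" "ev q \<noteq> 0"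
  using assms by (auto simp: carrier_frac)

lemma cring_fractions: "cring A"
proof (rule cringI)
  show "abelian_group A"
  proof (rule abelian_groupI)
    fix a assume "a \<in> carrier A"
    then show "\<exists>b\<in>carrier A. b \<oplus> a = \<zero>"
    proof (cases rule: frac_cases)
      case (1 x q)
      then have "frac (- x) q \<oplus> a = \<zero>"
        by (simp add: frac_add frac_zero frac_eq_iff)
      with 1 show ?thesis by (intro bexI[of _ "frac (- x) q"]) auto
    qed
  next
    fix a b c assume "a \<in> carrier A" "b \<in> carrier A" "c \<in> carrier A"
    then show "a \<oplus> b \<oplus> c = a \<oplus> (b \<oplus> c)"
      by (auto elim!: frac_cases simp: frac_add frac_eq_iff algebra_simps)
  qed (auto elim!: frac_cases simp: frac_add frac_zero frac_eq_iff algebra_simps)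
  show "comm_monoid A"
    by (rule comm_monoidI) (auto elim!: frac_cases simp: frac_mult frac_one frac_eq_iff algebra_simps)
  fix a b c assume "a \<in> carrier A" "b \<in> carrier A" "c \<in> carrier A"
  then show "(a \<oplus> b) \<otimes> c = a \<otimes> c \<oplus> b \<otimes> c"
    by (auto elim!: frac_cases simp: frac_add frac_mult frac_eq_iff algebra_simps)
qed

text \<open>Closure under negation comes for free: it is multiplication by $-1$.\<close>
lemma fraction_idealI:
  assumes "J \<subseteq> carrier A" "\<zero> \<in> J"
    and add: "\<And>a b. a \<in> J \<Longrightarrow> b \<in> J \<Longrightarrow> a \<oplus> b \<in> J"
    and mult: "\<And>a b. a \<in> J \<Longrightarrow> b \<in> carrier A \<Longrightarrow> b \<otimes> a \<in> J"
  shows "ideal J A"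
proof (rule idealI)
  interpret cring A by (rule cring_fractions)
  show "ring A" by (rule ring_axioms)
  show "subgroup J (add_monoid A)"
  proof (rule subgroup.intro)
    fix a assume a: "a \<in> J"
    then have "\<ominus> a = (\<ominus> \<one>) \<otimes> a" using assms(1) by (simp add: subset_iff l_minus)
    then have "\<ominus> a \<in> J" using mult[OF a, of "\<ominus> \<one>"] by simp
    then show "inv\<^bsub>add_monoid A\<^esub> a \<in> J" by (simp add: a_inv_def)
  qed (use assms in auto)
  show "a \<in> J \<Longrightarrow> x \<in> carrier A \<Longrightarrow> x \<otimes> a \<in> J" for a x by (rule mult)
  show "a \<in> J \<Longrightarrow> x \<in> carrier A \<Longrightarrow> a \<otimes> x \<in> J" for a x
    using mult[of a x] assms(1) by (auto simp: m_comm)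
qed

definition max_id :: "'r set" where
  "max_id = {frac x q | x q. x \<in> C \<and> q \<in> C \<and> ev q \<noteq> 0 \<and> ev x = 0}"

lemma frac_in_max_id_iff: "\<lbrakk>x \<in> C; q \<in> C; ev q \<noteq> 0\<rbrakk> \<Longrightarrow> frac x q \<in> max_id \<longleftrightarrow> ev x = 0"
proof
  assume *: "x \<in> C" "q \<in> C" "ev q \<noteq> 0" and "frac x q \<in> max_id"
  then obtain x' q' where "frac x q = frac x' q'" "x' \<in> C" "q' \<in> C" "ev q' \<noteq> 0" "ev x' = 0"
    by (auto simp: max_id_def)
  with * have "ev (x * q') = ev (x' * q)" by (simp add: frac_eq_iff)
  with * \<open>x' \<in> C\<close> \<open>q' \<in> C\<close> \<open>ev q' \<noteq> 0\<close> \<open>ev x' = 0\<close> show "ev x = 0" by simp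
qed (auto simp: max_id_def)

lemma ideal_max_id: "ideal max_id A"
proof (rule fraction_idealI)
  show "max_id \<subseteq> carrier A" by (auto simp: max_id_def)
  show "\<zero> \<in> max_id" by (simp add: frac_zero frac_in_max_id_iff)
  show "a \<oplus> b \<in> max_id" if "a \<in> max_id" "b \<in> max_id" for a b
  proof -
    obtain x q where 1: "a = frac x q" "x \<in> C" "q \<in> C" "ev q \<noteq> 0" "ev x = 0"
      using \<open>a \<in> max_id\<close> by (auto simp: max_id_def)
    obtain y r where 2: "b = frac y r" "y \<in> C" "r \<in> C" "ev r \<noteq> 0" "ev y = 0"
      using \<open>b \<in> max_id\<close> by (auto simp: max_id_def)
    show ?thesis using 1 2 by (simp add: frac_add frac_in_max_id_iff)
  qed
  show "b \<otimes> a \<in> max_id" if "a \<in> max_id" "b \<in> carrier A" for a b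
  proof -
    obtain x q where 1: "a = frac x q" "x \<in> C" "q \<in> C" "ev q \<noteq> 0" "ev x = 0"
      using \<open>a \<in> max_id\<close> by (auto simp: max_id_def)
    obtain y r where 2: "b = frac y r" "y \<in> C" "r \<in> C" "ev r \<noteq> 0"
      using \<open>b \<in> carrier A\<close> by (blast elim: frac_cases)
    show ?thesis using 1 2 by (simp add: frac_mult frac_in_max_id_iff)
  qed
qed

text \<open>A fraction whose numerator does not vanish at the point is a unit.\<close>
lemma proper_ideal_subset:
  assumes "ideal J A" "J \<noteq> carrier A" shows "J \<subseteq> max_id"
proof (rule subsetI, rule ccontr)
  interpret ideal J A by fact
  fix a assume a: "a \<in> J" "a \<notin> max_id"
  then obtain x q where *: "a = frac x q" "x \<in> C" "q \<in> C" "ev q \<noteq> 0"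
    using a_subset by (blast elim: frac_cases)
  with a have "ev x \<noteq> 0" by (simp add: frac_in_max_id_iff)
  then have "frac q x \<otimes> a = \<one>" using * by (simp add: frac_mult frac_one frac_eq_iff algebra_simps)
  moreover have "frac q x \<otimes> a \<in> J" using a * \<open>ev x \<noteq> 0\<close> by (intro I_l_closed) auto
  ultimately have "\<one> \<in> J" by simp
  then show False using one_imp_carrier assms(2) by blast
qed

lemma max_id_proper: "max_id \<noteq> carrier A"
proof -
  have "frac 1 1 \<in> carrier A" "frac 1 1 \<notin> max_id" by (simp_all add: frac_in_max_id_iff)
  then show ?thesis by blast
qed

lemma maximalideal_max_id: "maximalideal max_id A"
proof (rule maximalidealI[OF ideal_max_id])
  show "carrier A \<noteq> max_id" using max_id_proper by simp
  show "J = max_id \<or> J = carrier A" if "ideal J A" "max_id \<subseteq> J" "J \<subseteq> carrier A" for J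
    using proper_ideal_subset[OF that(1)] that by blast
qed

lemma maximalideal_unique:
  assumes "maximalideal J A" shows "J = max_id"
proof -
  interpret maximalideal J A by fact
  have "J \<subseteq> max_id" using proper_ideal_subset[OF is_ideal] I_notcarr by blast
  moreover have "max_id \<subseteq> carrier A" by (auto simp: max_id_def)
  ultimately show ?thesis using I_maximal[OF ideal_max_id] max_id_proper by blast
qed

text \<open>A derivation at the point is a tangent vector. It vanishes as soon as it vanishes on
  generators of the maximal ideal, because the fractions on whose numerators it vanishes
  form an ideal.\<close>
lemma derivation_zero_on_generators:
  assumes \<chi>_add: "\<And>x y. x \<in> C \<Longrightarrow> y \<in> C \<Longrightarrow> \<chi> (x + y) = \<chi> x + \<chi> y"
    and \<chi>_mult: "\<And>x y. x \<in> C \<Longrightarrow> y \<in> C \<Longrightarrow> \<chi> (x * y) = ev x * \<chi> y + ev y * \<chi> x"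
    and \<chi>_cst: "\<And>a. \<chi> (cst a) = (0::'k)"
    and gen: "max_id = genideal A S"
    and S: "\<And>s. s \<in> S \<Longrightarrow> \<exists>x q. s = frac x q \<and> x \<in> C \<and> q \<in> C \<and> ev q \<noteq> 0 \<and> ev x = 0 \<and> \<chi> x = 0"
    and x: "x \<in> C"
  shows "\<chi> x = 0"
proof -
  interpret cring A by (rule cring_fractions)
  define J where "J = {frac x q | x q. x \<in> C \<and> q \<in> C \<and> ev q \<noteq> 0 \<and> ev x = 0 \<and> \<chi> x = 0}"
  have JI: "frac x q \<in> J" if "x \<in> C" "q \<in> C" "ev q \<noteq> 0" "ev x = 0" "\<chi> x = 0" for x q
    using that by (auto simp: J_def)
  have "ideal J A"
  proof (rule fraction_idealI)
    show "J \<subseteq> carrier A" by (auto simp: J_def)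
    show "\<zero> \<in> J" using \<chi>_cst[of 0] by (simp add: frac_zero JI)
    show "a \<oplus> b \<in> J" if "a \<in> J" "b \<in> J" for a b
    proof -
      obtain x q where 1: "a = frac x q" "x \<in> C" "q \<in> C" "ev q \<noteq> 0" "ev x = 0" "\<chi> x = 0"
        using \<open>a \<in> J\<close> by (auto simp: J_def)
      obtain y r where 2: "b = frac y r" "y \<in> C" "r \<in> C" "ev r \<noteq> 0" "ev y = 0" "\<chi> y = 0"
        using \<open>b \<in> J\<close> by (auto simp: J_def)
      show ?thesis using 1 2 by (auto simp: frac_add \<chi>_add \<chi>_mult intro!: JI)
    qed
    show "b \<otimes> a \<in> J" if "a \<in> J" "b \<in> carrier A" for a b
    proof -
      obtain x q where 1: "a = frac x q" "x \<in> C" "q \<in> C" "ev q \<noteq> 0" "ev x = 0" "\<chi> x = 0"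
        using \<open>a \<in> J\<close> by (auto simp: J_def)
      obtain y r where 2: "b = frac y r" "y \<in> C" "r \<in> C" "ev r \<noteq> 0"
        using \<open>b \<in> carrier A\<close> by (blast elim: frac_cases)
      show ?thesis using 1 2 by (auto simp: frac_mult \<chi>_mult intro!: JI)
    qed
  qed
  moreover have "S \<subseteq> J" using S by (auto simp: J_def)
  ultimately have "max_id \<subseteq> J" unfolding gen by (intro genideal_minimal)
  have zero: "\<chi> x = 0" if "x \<in> C" "ev x = 0" for x
  proof -
    have "frac x 1 \<in> J" using \<open>max_id \<subseteq> J\<close> that by (auto simp: frac_in_max_id_iff)
    then obtain y q where y: "frac x 1 = frac y q" "y \<in> C" "q \<in> C" "ev q \<noteq> 0" "ev y = 0" "\<chi> y = 0"
      unfolding J_def by auto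
    then have "x * q = y" using that by (simp add: frac_eq_iff)
    then have "ev x * \<chi> q + ev q * \<chi> x = 0" using \<chi>_mult[of x q] that y by simp
    then show ?thesis using that y by simp
  qed
  have "\<chi> (x - cst (ev x)) = 0" using x by (intro zero) auto
  moreover have "\<chi> x = \<chi> (x - cst (ev x)) + \<chi> (cst (ev x))"
    using \<chi>_add[of "x - cst (ev x)" "cst (ev x)"] x by simp
  ultimately show ?thesis using \<chi>_cst by simp
qed

end

subsection \<open>Chains of primes and algebraic independence\<close>

definition exps :: "nat \<Rightarrow> nat \<Rightarrow> nat list set" where
  "exps N n = {bs. set bs \<subseteq> {..<N} \<and> length bs = n}"

lemma finite_exps [simp]: "finite (exps N n)"
  unfolding exps_def by (rule finite_lists_length_eq) simp

lemma card_exps: "card (exps N n) = N ^ n"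
  unfolding exps_def by (subst card_lists_length_eq) simp_all

lemma exps_0 [simp]: "exps N 0 = {[]}"
  by (auto simp: exps_def)

lemma exps_Suc: "exps N (Suc n) = (\<lambda>(b, bs). b # bs) ` ({..<N} \<times> exps N n)"
  by (fastforce simp: exps_def length_Suc_conv image_iff)

lemma sum_exps_Suc:
  "(\<Sum>bs\<in>exps N (Suc n). f bs) = (\<Sum>b<N. \<Sum>bs\<in>exps N n. f (b # bs))"
  unfolding exps_Suc
  by (subst sum.reindex) (auto simp: inj_on_def sum.cartesian_product intro!: sum.cong)

text \<open>The value at a list of elements of the polynomial with coefficients $\kappa$ and degree less
  than $N$ in each variable.\<close>
fun peval :: "('k \<Rightarrow> 't::comm_ring_1) \<Rightarrow> nat \<Rightarrow> 't list \<Rightarrow> (nat list \<Rightarrow> 'k) \<Rightarrow> 't" where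
  "peval cst N [] \<kappa> = cst (\<kappa> [])"
| "peval cst N (z # zs) \<kappa> = (\<Sum>b<N. z ^ b * peval cst N zs (\<lambda>bs. \<kappa> (b # bs)))"

context fraction_ring
begin

text \<open>Prime ideals of $C$, which is a subset of a type and not a ring structure of its own.\<close>
definition prime_set :: "'t set \<Rightarrow> bool" where
  "prime_set P \<longleftrightarrow> P \<subseteq> C \<and> 0 \<in> P \<and> 1 \<notin> P \<and> (\<forall>x\<in>P. \<forall>y\<in>P. x + y \<in> P) \<and>
     (\<forall>x\<in>P. \<forall>y\<in>C. y * x \<in> P) \<and> (\<forall>x\<in>C. \<forall>y\<in>C. x * y \<in> P \<longrightarrow> x \<in> P \<or> y \<in> P)"

lemma prime_setD:
  assumes "prime_set P"
  shows "x \<in> P \<Longrightarrow> x \<in> C" "0 \<in> P" "1 \<notin> P" "x \<in> P \<Longrightarrow> y \<in> P \<Longrightarrow> x + y \<in> P"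
    "x \<in> P \<Longrightarrow> y \<in> C \<Longrightarrow> y * x \<in> P" "x \<in> C \<Longrightarrow> y \<in> C \<Longrightarrow> x * y \<in> P \<Longrightarrow> x \<in> P \<or> y \<in> P"
  using assms unfolding prime_set_def by blast+

lemma peval_in_C: "set zs \<subseteq> C \<Longrightarrow> peval cst N zs \<kappa> \<in> C"
  by (induction zs arbitrary: \<kappa>) (auto intro!: C_sum)

lemma peval_zero: "(\<And>bs. bs \<in> exps N (length zs) \<Longrightarrow> \<kappa> bs = 0) \<Longrightarrow> peval cst N zs \<kappa> = 0"
proof (induction zs arbitrary: \<kappa>)
  case (Cons z zs)
  have "peval cst N zs (\<lambda>bs. \<kappa> (b # bs)) = 0" if "b < N" for b
    using that by (intro Cons.IH Cons.prems) (auto simp: exps_Suc)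
  then show ?case by simp
qed simp

text \<open>Used for descent along a chain of primes: if the lowest coefficient lies in the larger prime it
  vanishes, and then a factor $z$ can be cancelled modulo the smaller prime.\<close>
lemma prime_step:
  assumes P: "prime_set P" "prime_set P'" "P \<subseteq> P'" and z: "z \<in> P'" "z \<notin> P"
    and f: "\<And>b. f b \<in> C" "\<And>b. f b \<in> P' \<Longrightarrow> f b = 0"
    and "(\<Sum>b<M. z ^ b * f b) \<in> P" "b < M"
  shows "f b = 0"
  using f assms(8,9)
proof (induction M arbitrary: f b)
  case (Suc M)
  have zC: "z \<in> C" using P(2) z(1) by (rule prime_setD)
  define g where "g = (\<Sum>b<M. z ^ b * f (Suc b))"
  have gC: "g \<in> C" unfolding g_def using Suc.prems(1) zC by (auto intro!: C_sum)
  have eq: "(\<Sum>b<Suc M. z ^ b * f b) = f 0 + z * g"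
    by (simp add: sum.lessThan_Suc_shift g_def sum_distrib_left mult_ac del: sum.lessThan_Suc)
  then have "f 0 + z * g \<in> P'" using Suc.prems(3) P(3) by auto
  moreover have "- (z * g) \<in> P'"
    using prime_setD(5)[OF P(2) z(1), of "- g"] gC by (simp add: mult.commute)
  ultimately have "f 0 \<in> P'" using prime_setD(4)[OF P(2)] by fastforce
  then have f0: "f 0 = 0" by (rule Suc.prems(2))
  then have "z * g \<in> P" using Suc.prems(3) eq by simp
  then have "g \<in> P" using prime_setD(6)[OF P(1) zC gC] z(2) by blast
  then have "f (Suc b) = 0" if "b < M" for b
    unfolding g_def using that Suc.prems(1,2) Suc.IH[of "\<lambda>b. f (Suc b)"] by blast
  then show ?case using f0 Suc.prems(4) by (cases b) auto
qed simp

text \<open>By induction on the length of the chain: modulo the second prime, a relation reduces to its terms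
  without the first element. These form a relation between the remaining elements, so they vanish,
  and then the first element can be cancelled.\<close>
lemma independent_along_chain:
  assumes "\<And>i. i \<le> length zs \<Longrightarrow> prime_set (P i)"
    and "\<And>i. i < length zs \<Longrightarrow> P i \<subseteq> P (Suc i) \<and> zs ! i \<in> P (Suc i) - P i"
    and "peval cst N zs \<kappa> \<in> P 0" "bs \<in> exps N (length zs)"
  shows "\<kappa> bs = 0"
  using assms
proof (induction zs arbitrary: P \<kappa> bs)
  case Nil
  have "\<kappa> [] = 0"
  proof (rule ccontr)
    assume "\<kappa> [] \<noteq> 0"
    have P0: "prime_set (P 0)" using Nil(1)[of 0] by simp
    have "cst (inverse (\<kappa> [])) * cst (\<kappa> []) \<in> P 0"
      using Nil(3) prime_setD(5)[OF P0] by simp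
    then show False using \<open>\<kappa> [] \<noteq> 0\<close> prime_setD(3)[OF P0] by (simp flip: cst_mult)
  qed
  then show ?case using Nil by simp
next
  case (Cons z zs)
  have zP: "P 0 \<subseteq> P 1" "z \<in> P 1" "z \<notin> P 0" using Cons.prems(2)[of 0] by auto
  have pr: "prime_set (P 0)" "prime_set (P 1)" using Cons.prems(1)[of 0] Cons.prems(1)[of 1] by auto
  have IH: "\<kappa>' bs = 0" if "peval cst N zs \<kappa>' \<in> P 1" "bs \<in> exps N (length zs)" for \<kappa>' bs
    using Cons.IH[of "\<lambda>i. P (Suc i)" \<kappa>' bs] Cons.prems(1)[of "Suc _"] Cons.prems(2)[of "Suc _"] that
    by auto
  have "zs ! i \<in> C" if "i < length zs" for i
    using Cons.prems(2)[of "Suc i"] prime_setD(1)[OF Cons.prems(1)[of "Suc (Suc i)"]] that by auto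
  then have "set zs \<subseteq> C" by (auto simp: in_set_conv_nth)
  then have C: "peval cst N zs \<kappa>' \<in> C" for \<kappa>' by (rule peval_in_C)
  obtain b bs' where bs: "bs = b # bs'" "b < N" "bs' \<in> exps N (length zs)"
    using Cons.prems(4) by (auto simp: exps_Suc)
  have "peval cst N zs (\<lambda>bs. \<kappa> (b # bs)) = 0"
  proof (rule prime_step[where f = "\<lambda>b. peval cst N zs (\<lambda>bs. \<kappa> (b # bs))", OF pr zP(1,2,3) C _ _ bs(2)])
    show "peval cst N zs (\<lambda>bs. \<kappa> (b # bs)) = 0" if "peval cst N zs (\<lambda>bs. \<kappa> (b # bs)) \<in> P 1" for b
      using IH[OF that] by (intro peval_zero)
    show "(\<Sum>b<N. z ^ b * peval cst N zs (\<lambda>bs. \<kappa> (b # bs))) \<in> P 0"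
      using Cons.prems(3) by simp
  qed
  then show ?case using IH[of "\<lambda>bs. \<kappa> (b # bs)" bs'] bs prime_setD(2)[OF pr(2)] by simp
qed

text \<open>The trace of a prime ideal on the numerators determines it, since denominators are units.\<close>
lemma prime_contraction:
  assumes "primeideal P A"
  shows "prime_set {x \<in> C. frac x 1 \<in> P}"
    and "P = {frac x q | x q. x \<in> C \<and> q \<in> C \<and> ev q \<noteq> 0 \<and> frac x 1 \<in> P}"
proof -
  interpret primeideal P A by fact
  have "frac 1 1 \<notin> P" using I_notcarr one_imp_carrier by (auto simp: frac_one)
  moreover have "frac (x + y) 1 \<in> P" if "x \<in> C" "y \<in> C" "frac x 1 \<in> P" "frac y 1 \<in> P" for x y
    using additive_subgroup.a_closed[OF additive_subgroup_axioms that(3,4)] that by (simp add: frac_add)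
  moreover have "frac (y * x) 1 \<in> P" if "x \<in> C" "y \<in> C" "frac x 1 \<in> P" for x y
    using I_l_closed[OF that(3), of "frac y 1"] that by (simp add: frac_mult)
  moreover have "frac x 1 \<in> P \<or> frac y 1 \<in> P" if "x \<in> C" "y \<in> C" "frac (x * y) 1 \<in> P" for x y
    using I_prime[of "frac x 1" "frac y 1"] that by (simp add: frac_mult)
  moreover have "frac 0 1 \<in> P" using additive_subgroup.zero_closed[OF additive_subgroup_axioms]
    by (simp add: frac_zero)
  ultimately show "prime_set {x \<in> C. frac x 1 \<in> P}"
    unfolding prime_set_def by auto
  have iff: "frac x q \<in> P \<longleftrightarrow> frac x 1 \<in> P" if "x \<in> C" "q \<in> C" "ev q \<noteq> 0" for x q
  proof
    assume "frac x q \<in> P"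
    then have "frac q 1 \<otimes> frac x q \<in> P" using that by (intro I_l_closed) auto
    moreover have "frac q 1 \<otimes> frac x q = frac x 1"
      using that by (simp add: frac_mult frac_eq_iff algebra_simps)
    ultimately show "frac x 1 \<in> P" by simp
  next
    assume "frac x 1 \<in> P"
    then have "frac 1 q \<otimes> frac x 1 \<in> P" using that by (intro I_l_closed) auto
    then show "frac x q \<in> P" using that by (simp add: frac_mult)
  qed
  show "P = {frac x q | x q. x \<in> C \<and> q \<in> C \<and> ev q \<noteq> 0 \<and> frac x 1 \<in> P}" (is "_ = ?R")
  proof
    show "?R \<subseteq> P" using iff by blast
    show "P \<subseteq> ?R"
    proof
      fix a assume "a \<in> P"
      then obtain x q where "a = frac x q" "x \<in> C" "q \<in> C" "ev q \<noteq> 0"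
        using a_subset by (blast elim: frac_cases)
      with iff \<open>a \<in> P\<close> show "a \<in> ?R" by blast
    qed
  qed
qed

text \<open>Choosing an element in each step of a chain of primes gives algebraically independent elements.\<close>
lemma krull_dim_le:
  assumes dep: "\<And>zs. set zs \<subseteq> C \<Longrightarrow> length zs > e \<Longrightarrow>
     \<exists>N \<kappa>. \<exists>bs\<in>exps N (length zs). peval cst N zs \<kappa> = 0 \<and> \<kappa> bs \<noteq> 0"
  shows "krull_dim A \<le> enat e"
  unfolding krull_dim_def
proof (rule SUP_least, clarify)
  fix n P assume P: "\<forall>i\<le>n. primeideal (P i) A" "\<forall>i<n. P i \<subset> P (Suc i)"
  define Q where "Q = (\<lambda>i. {x \<in> C. frac x 1 \<in> P i})"
  have "\<exists>z. z \<in> Q (Suc i) - Q i" if "i < n" for i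
  proof (rule ccontr)
    assume "\<nexists>z. z \<in> Q (Suc i) - Q i"
    then have "Q (Suc i) \<subseteq> Q i" by blast
    moreover have "P (Suc i) = {frac x q | x q. x \<in> C \<and> q \<in> C \<and> ev q \<noteq> 0 \<and> frac x 1 \<in> P (Suc i)}"
      "P i = {frac x q | x q. x \<in> C \<and> q \<in> C \<and> ev q \<noteq> 0 \<and> frac x 1 \<in> P i}"
      using P(1) that by (auto intro!: prime_contraction(2))
    ultimately have "P (Suc i) \<subseteq> P i" unfolding Q_def by blast
    then show False using P(2) that by blast
  qed
  then obtain z where z: "\<And>i. i < n \<Longrightarrow> z i \<in> Q (Suc i) - Q i" by metis
  define zs where "zs = map z [0..<n]"
  have "\<not> length zs > e"
  proof
    assume "length zs > e"
    moreover have "set zs \<subseteq> C" using z by (auto simp: zs_def Q_def)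
    ultimately obtain N \<kappa> bs where *: "bs \<in> exps N (length zs)" "peval cst N zs \<kappa> = 0" "\<kappa> bs \<noteq> 0"
      using dep by blast
    have pr: "prime_set (Q i)" if "i \<le> n" for i unfolding Q_def using P that by (auto intro: prime_contraction)
    have "\<kappa> bs = 0"
    proof (rule independent_along_chain[of zs Q N])
      show "peval cst N zs \<kappa> \<in> Q 0" using * prime_setD(2)[OF pr] by simp
      show "Q i \<subseteq> Q (Suc i) \<and> zs ! i \<in> Q (Suc i) - Q i" if "i < length zs" for i
        using that z P(2) by (auto simp: zs_def Q_def)
    qed (use pr * in \<open>auto simp: zs_def\<close>)
    with * show False by simp
  qed
  then show "enat n \<le> enat e" by (simp add: zs_def)
qed

end

section \<open>Polynomial functions\<close>

lemma more_unknowns_than_equations: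
  fixes a :: "'i \<Rightarrow> 'u \<Rightarrow> 'k::field"
  assumes "finite E" "finite U" "card E < card U"
  obtains x where "\<exists>u\<in>U. x u \<noteq> 0" "\<forall>i\<in>E. (\<Sum>u\<in>U. a i u * x u) = 0"
  using assms
proof (induction E arbitrary: U a thesis rule: finite_induct)
  case empty
  have "U \<noteq> {}" using empty(3) by auto
  then obtain u where "u \<in> U" by blast
  with empty(1)[of "\<lambda>_. 1"] show ?case by auto
next
  case (insert i0 E)
  show ?case
  proof (cases "\<forall>u\<in>U. a i0 u = 0")
    case True
    obtain x where x: "\<exists>u\<in>U. x u \<noteq> 0" "\<forall>i\<in>E. (\<Sum>u\<in>U. a i u * x u) = 0"
      using insert.IH[of U a] insert.prems insert.hyps by auto
    then show ?thesis using True insert.prems(1)[of x] by simp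
  next
    case False
    then obtain v where v: "v \<in> U" "a i0 v \<noteq> 0" by blast
    define a' where "a' = (\<lambda>i u. a i u - a i v * a i0 u / a i0 v)"
    have "card E < card (U - {v})" using insert v by simp
    then obtain x where x: "\<exists>u\<in>U - {v}. x u \<noteq> 0" "\<forall>i\<in>E. (\<Sum>u\<in>U - {v}. a' i u * x u) = 0"
      using insert.IH[of "U - {v}" a'] insert.prems by auto
    define y where "y = x(v := - (\<Sum>u\<in>U - {v}. a i0 u * x u) / a i0 v)"
    have sum_y: "(\<Sum>u\<in>U. a i u * y u)
        = (\<Sum>u\<in>U - {v}. a i u * x u) - a i v * (\<Sum>u\<in>U - {v}. a i0 u * x u) / a i0 v" for i
      using v(1) insert.prems(2) by (subst sum.remove[of _ v]) (auto simp: y_def intro!: sum.cong)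
    have "(\<Sum>u\<in>U. a i u * y u) = 0" if "i \<in> E" for i
    proof -
      have "(\<Sum>u\<in>U - {v}. a' i u * x u)
          = (\<Sum>u\<in>U - {v}. a i u * x u) - a i v * (\<Sum>u\<in>U - {v}. a i0 u * x u) / a i0 v"
        by (simp add: a'_def left_diff_distrib right_diff_distrib sum_subtractf sum_distrib_left sum_divide_distrib mult_ac)
      then show ?thesis using x that sum_y by simp
    qed
    moreover have "(\<Sum>u\<in>U. a i0 u * y u) = 0" using sum_y v(2) by simp
    moreover have "\<exists>u\<in>U. y u \<noteq> 0" using x(1) by (auto simp: y_def)
    ultimately show ?thesis using insert.prems(1)[of y] by blast
  qed
qed

text \<open>Over an infinite field, the polynomial ring in $e$ variables is the algebra of polynomial functions
  of the first $e$ entries of a sequence.\<close>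
inductive_set pfun :: "nat \<Rightarrow> ((nat \<Rightarrow> 'a) \<Rightarrow> 'a::comm_ring_1) set" for e where
  const [intro, simp]: "(\<lambda>t. c) \<in> pfun e"
| var [intro]: "i < e \<Longrightarrow> (\<lambda>t. t i) \<in> pfun e"
| add [intro]: "f \<in> pfun e \<Longrightarrow> g \<in> pfun e \<Longrightarrow> (\<lambda>t. f t + g t) \<in> pfun e"
| mult [intro]: "f \<in> pfun e \<Longrightarrow> g \<in> pfun e \<Longrightarrow> (\<lambda>t. f t * g t) \<in> pfun e"

lemma pfun_uminus [intro]: "f \<in> pfun e \<Longrightarrow> (\<lambda>t. - f t) \<in> pfun e"
  using pfun.mult[OF pfun.const[of "- 1"], of f e] by simp

lemma pfun_diff [intro]: "f \<in> pfun e \<Longrightarrow> g \<in> pfun e \<Longrightarrow> (\<lambda>t. f t - g t) \<in> pfun e"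
  using pfun.add[OF _ pfun_uminus, of f e g] by simp

lemma pfun_sum [intro]: "(\<And>i. i \<in> I \<Longrightarrow> f i \<in> pfun e) \<Longrightarrow> (\<lambda>t. \<Sum>i\<in>I. f i t) \<in> pfun e"
  by (induction I rule: infinite_finite_induct) auto

lemma pfun_prod [intro]: "(\<And>i. i \<in> I \<Longrightarrow> f i \<in> pfun e) \<Longrightarrow> (\<lambda>t. \<Prod>i\<in>I. f i t) \<in> pfun e"
  by (induction I rule: infinite_finite_induct) auto

lemma pfun_power [intro]: "f \<in> pfun e \<Longrightarrow> (\<lambda>t. f t ^ n) \<in> pfun e"
  by (induction n) auto

lemma pfun_curve:
  assumes "f \<in> pfun e"
  shows "\<exists>p. \<forall>s. f (\<lambda>i. poly (\<tau> i) s) = poly p s"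
  using assms
proof induction
  case (const c)
  show ?case by (intro exI[of _ "[:c:]"]) simp
next
  case (add f g)
  then obtain p q where "\<forall>s. f (\<lambda>i. poly (\<tau> i) s) = poly p s" "\<forall>s. g (\<lambda>i. poly (\<tau> i) s) = poly q s"
    by blast
  then show ?case by (intro exI[of _ "p + q"]) simp
next
  case (mult f g)
  then obtain p q where "\<forall>s. f (\<lambda>i. poly (\<tau> i) s) = poly p s" "\<forall>s. g (\<lambda>i. poly (\<tau> i) s) = poly q s"
    by blast
  then show ?case by (intro exI[of _ "p * q"]) simp
qed blast

text \<open>A set of points containing the line through any two of its points is irreducible: on a line,
  polynomial functions are polynomials in one variable.\<close>
lemma pfun_domain:
  fixes f g :: "(nat \<Rightarrow> 'a) \<Rightarrow> 'a::{field_char_0}"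
  assumes fg: "f \<in> pfun e" "g \<in> pfun e"
    and L: "\<And>t u s. t \<in> L \<Longrightarrow> u \<in> L \<Longrightarrow> (\<lambda>i. t i + s * (u i - t i)) \<in> L"
    and zero: "\<And>t. t \<in> L \<Longrightarrow> f t * g t = 0"
  shows "(\<forall>t\<in>L. f t = 0) \<or> (\<forall>t\<in>L. g t = 0)"
proof (rule ccontr)
  assume "\<not> ?thesis"
  then obtain t u where tu: "t \<in> L" "u \<in> L" "f t \<noteq> 0" "g u \<noteq> 0" by blast
  define \<tau> where "\<tau> = (\<lambda>i. [:t i, u i - t i:])"
  obtain p where p: "\<And>s. f (\<lambda>i. poly (\<tau> i) s) = poly p s" using pfun_curve[OF fg(1)] by metis
  obtain q where q: "\<And>s. g (\<lambda>i. poly (\<tau> i) s) = poly q s" using pfun_curve[OF fg(2)] by metis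
  have "poly (p * q) s = poly 0 s" for s
    using zero[OF L[OF tu(1,2)], of s] by (simp flip: p q) (simp add: \<tau>_def algebra_simps)
  then have "p * q = 0" by (metis poly_eq_poly_eq_iff ext)
  then have "p = 0 \<or> q = 0" by simp
  then show False using p[of 0] q[of 1] tu by (auto simp: \<tau>_def)
qed

subsection \<open>Degrees and algebraic dependence\<close>

definition tmono :: "nat \<Rightarrow> nat list \<Rightarrow> (nat \<Rightarrow> 'a) \<Rightarrow> 'a::comm_ring_1" where
  "tmono e bs t = (\<Prod>i<e. t i ^ (bs ! i))"

text \<open>Polynomial functions of degree at most $D$ in each variable.\<close>
definition pdeg :: "nat \<Rightarrow> nat \<Rightarrow> ((nat \<Rightarrow> 'a) \<Rightarrow> 'a::comm_ring_1) set" where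
  "pdeg D e = {f. \<exists>m. \<forall>t. f t = (\<Sum>bs\<in>exps (Suc D) e. m bs * tmono e bs t)}"

lemma pdeg_add: "f \<in> pdeg D e \<Longrightarrow> g \<in> pdeg D e \<Longrightarrow> (\<lambda>t. f t + g t) \<in> pdeg D e"
proof -
  assume "f \<in> pdeg D e" "g \<in> pdeg D e"
  then obtain m n where "\<forall>t. f t = (\<Sum>bs\<in>exps (Suc D) e. m bs * tmono e bs t)"
      "\<forall>t. g t = (\<Sum>bs\<in>exps (Suc D) e. n bs * tmono e bs t)"
    unfolding pdeg_def by blast
  then show ?thesis unfolding pdeg_def
    by (intro CollectI exI[of _ "\<lambda>bs. m bs + n bs"]) (simp add: distrib_right sum.distrib)
qed

lemma pdeg_scale: "f \<in> pdeg D e \<Longrightarrow> (\<lambda>t. c * f t) \<in> pdeg D e"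
proof -
  assume "f \<in> pdeg D e"
  then obtain m where "\<forall>t. f t = (\<Sum>bs\<in>exps (Suc D) e. m bs * tmono e bs t)"
    unfolding pdeg_def by blast
  then show ?thesis unfolding pdeg_def
    by (intro CollectI exI[of _ "\<lambda>bs. c * m bs"]) (simp add: sum_distrib_left mult_ac)
qed

lemma pdeg_sum: "(\<And>i. i \<in> I \<Longrightarrow> f i \<in> pdeg D e) \<Longrightarrow> (\<lambda>t. \<Sum>i\<in>I. f i t) \<in> pdeg D e"
proof (induction I rule: infinite_finite_induct)
  case (insert i I)
  then show ?case using pdeg_add[of "f i" D e] by simp
qed (auto simp: pdeg_def intro!: exI[of _ "\<lambda>_. 0"])

lemma tmono_in_pdeg: "bs \<in> exps (Suc D) e \<Longrightarrow> tmono e bs \<in> pdeg D e"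
  unfolding pdeg_def
  by (intro CollectI exI[of _ "\<lambda>cs. if cs = bs then 1 else 0"]) (simp add: if_distrib[of "\<lambda>x. x * _"] cong: if_cong)

lemma pdeg_mono: "f \<in> pdeg D e \<Longrightarrow> D \<le> D' \<Longrightarrow> f \<in> pdeg D' e"
proof -
  assume f: "f \<in> pdeg D e" and "D \<le> D'"
  then have "exps (Suc D) e \<subseteq> exps (Suc D') e" by (force simp: exps_def)
  then have "(\<lambda>t. \<Sum>bs\<in>exps (Suc D) e. m bs * tmono e bs t) \<in> pdeg D' e" for m :: "nat list \<Rightarrow> 'a"
    by (intro pdeg_sum pdeg_scale tmono_in_pdeg) auto
  moreover obtain m where "f = (\<lambda>t. \<Sum>bs\<in>exps (Suc D) e. m bs * tmono e bs t)"
    using f unfolding pdeg_def by blast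
  ultimately show ?thesis by simp
qed

lemma exps_nth: "bs \<in> exps N n \<Longrightarrow> i < n \<Longrightarrow> bs ! i < N"
proof -
  assume "bs \<in> exps N n" "i < n"
  then have "bs ! i \<in> set bs" "set bs \<subseteq> {..<N}" by (auto simp: exps_def)
  then show ?thesis by blast
qed

lemma pdeg_mult:
  assumes "f \<in> pdeg D e" "g \<in> pdeg D' e" shows "(\<lambda>t. f t * g t) \<in> pdeg (D + D') e"
proof -
  obtain m n where f: "f = (\<lambda>t. \<Sum>bs\<in>exps (Suc D) e. m bs * tmono e bs t)"
      and g: "g = (\<lambda>t. \<Sum>cs\<in>exps (Suc D') e. n cs * tmono e cs t)"
    using assms unfolding pdeg_def by blast
  have "(\<lambda>t. tmono e bs t * tmono e cs t :: 'a) \<in> pdeg (D + D') e"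
    if "bs \<in> exps (Suc D) e" "cs \<in> exps (Suc D') e" for bs cs
  proof -
    have "tmono e bs t * tmono e cs t = (tmono e (map2 (+) bs cs) t :: 'a)" for t
      using that by (simp add: tmono_def exps_def power_add flip: prod.distrib)
    moreover have "map2 (+) bs cs \<in> exps (Suc (D + D')) e"
    proof -
      have "bs ! i \<le> D" "cs ! i \<le> D'" if "i < e" for i
        using exps_nth[OF \<open>bs \<in> _\<close> that] exps_nth[OF \<open>cs \<in> _\<close> that] by simp_all
      then show ?thesis using that
        by (auto simp: exps_def in_set_conv_nth less_Suc_eq_le intro!: add_le_mono)
    qed
    ultimately show ?thesis using tmono_in_pdeg[of "map2 (+) bs cs" "D + D'" e] by simp
  qed
  then have "(\<lambda>t. \<Sum>bs\<in>exps (Suc D) e. \<Sum>cs\<in>exps (Suc D') e.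
      (m bs * n cs) * (tmono e bs t * tmono e cs t)) \<in> pdeg (D + D') e"
    by (intro pdeg_sum pdeg_scale)
  then show ?thesis unfolding f g by (simp add: sum_product mult_ac)
qed

lemma pdeg_const: "(\<lambda>t. c) \<in> pdeg D e"
proof -
  have "(\<lambda>t. c * tmono e (replicate e 0) t) \<in> pdeg D e"
    by (intro pdeg_scale tmono_in_pdeg) (auto simp: exps_def)
  then show ?thesis by (simp add: tmono_def)
qed

lemma pfun_pdeg: "f \<in> pfun e \<Longrightarrow> \<exists>D. f \<in> pdeg D e"
proof (induction rule: pfun.induct)
  case (var i)
  define bs where "bs = (replicate e 0)[i := Suc 0]"
  have "tmono e bs \<in> pdeg 1 e"
    by (intro tmono_in_pdeg) (auto simp: exps_def bs_def dest!: subsetD[OF set_update_subset_insert])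
  moreover have "tmono e bs t = t i" for t :: "nat \<Rightarrow> 'a"
  proof -
    have "tmono e bs t = (\<Prod>j<e. if j = i then t i else 1)"
      unfolding tmono_def bs_def using var by (intro prod.cong) (auto simp: nth_list_update)
    then show ?thesis using var by simp
  qed
  ultimately show ?case by (metis ext)
next
  case (add f g)
  then obtain D D' where "f \<in> pdeg D e" "g \<in> pdeg D' e" by blast
  then have "f \<in> pdeg (D + D') e" "g \<in> pdeg (D + D') e" by (auto intro: pdeg_mono)
  then show ?case by (blast intro: pdeg_add)
qed (use pdeg_const pdeg_mult in blast)+

lemma pdeg_power: "f \<in> pdeg D e \<Longrightarrow> (\<lambda>t. f t ^ n) \<in> pdeg (n * D) e"
  by (induction n) (auto simp: pdeg_const dest: pdeg_mult)

text \<open>Monomials in given functions, as they occur in \<open>peval\<close>.\<close>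
fun zmono :: "('b \<Rightarrow> 'a::comm_ring_1) list \<Rightarrow> nat list \<Rightarrow> 'b \<Rightarrow> 'a" where
  "zmono (z # zs) (b # bs) t = z t ^ b * zmono zs bs t"
| "zmono _ _ t = 1"

lemma zmono_Nil: "zmono [] [] = (\<lambda>t. 1)"
  by (simp add: fun_eq_iff)

lemma fun_sum_apply: "(\<Sum>i\<in>I. f i) t = (\<Sum>i\<in>I. f i t)"
  by (induction I rule: infinite_finite_induct) auto

lemma fun_power_apply: "(f ^ n) t = f t ^ n"
  by (induction n) auto

lemma peval_zmono:
  "peval (\<lambda>c _. c) N zs \<kappa> t = (\<Sum>bs\<in>exps N (length zs). \<kappa> bs * zmono zs bs t)"
proof (induction zs arbitrary: \<kappa>)
  case (Cons z zs)
  show ?case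
    by (simp add: sum_exps_Suc fun_sum_apply fun_power_apply Cons.IH sum_distrib_left mult_ac)
qed simp

lemma zmono_pdeg:
  "set zs \<subseteq> pdeg D e \<Longrightarrow> bs \<in> exps N (length zs) \<Longrightarrow> zmono zs bs \<in> pdeg (length zs * (N * D)) e"
proof (induction zs arbitrary: bs)
  case (Cons z zs)
  then obtain b bs' where bs: "bs = b # bs'" "b < N" "bs' \<in> exps N (length zs)" by (auto simp: exps_Suc)
  have "(\<lambda>t. z t ^ b) \<in> pdeg (N * D) e"
    using Cons.prems(1) bs(2) by (auto intro!: pdeg_mono[OF pdeg_power])
  from pdeg_mult[OF this Cons.IH[OF _ bs(3)]] show ?case
    using Cons.prems(1) unfolding bs(1) by simp
qed (simp add: zmono_Nil pdeg_const)

text \<open>The transcendence degree bound, by counting: the $N^n$ monomials of degree less than $N$ in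
  each of $n$ given functions lie in a space of dimension $O(N^e)$.\<close>
lemma pfun_dependent:
  fixes zs :: "((nat \<Rightarrow> 'a) \<Rightarrow> 'a::field) list"
  assumes "set zs \<subseteq> pfun e" "length zs > e"
  shows "\<exists>N \<kappa>. \<exists>bs\<in>exps N (length zs). peval (\<lambda>c _. c) N zs \<kappa> = 0 \<and> \<kappa> bs \<noteq> 0"
proof -
  define n where "n = length zs"
  have "\<exists>D. set zs \<subseteq> pdeg D e"
    using assms(1)
  proof (induction zs)
    case (Cons z zs)
    then obtain D D' where "set zs \<subseteq> pdeg D e" "z \<in> pdeg D' e" using pfun_pdeg[of z e] by auto
    then show ?case by (intro exI[of _ "D + D'"]) (auto intro: pdeg_mono)
  qed simp
  then obtain D where D: "set zs \<subseteq> pdeg D e" by blast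
  \<comment> \<open>large enough for $(nND + 1)^e < N^n$\<close>
  define N where "N = Suc ((n * D + 1) ^ e)"
  define M where "M = n * (N * D)"
  have N1: "1 \<le> N" by (simp add: N_def)
  have "\<exists>m. \<forall>t. zmono zs bs t = (\<Sum>as\<in>exps (Suc M) e. m as * tmono e as t)" if "bs \<in> exps N n" for bs
    using zmono_pdeg[OF D, of bs N] that unfolding pdeg_def M_def n_def by blast
  then obtain m where m: "\<And>bs t. bs \<in> exps N n \<Longrightarrow>
      zmono zs bs t = (\<Sum>as\<in>exps (Suc M) e. m bs as * tmono e as t)" by metis
  have "Suc M \<le> N * (n * D + 1)" using N1 by (simp add: M_def algebra_simps)
  then have "Suc M ^ e \<le> N ^ e * (n * D + 1) ^ e"
    using power_mono[of "Suc M" "N * (n * D + 1)" e] by (simp only: power_mult_distrib zero_le)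
  also have "\<dots> < N ^ e * N" using N1 by (simp add: N_def)
  also have "\<dots> \<le> N ^ n" using power_increasing[of "Suc e" n N] assms(2) N1 by (simp add: n_def mult.commute)
  finally have "card (exps (Suc M) e) < card (exps N n)" by (simp only: card_exps)
  then obtain \<kappa> where \<kappa>: "\<exists>bs\<in>exps N n. \<kappa> bs \<noteq> 0"
      "\<forall>as\<in>exps (Suc M) e. (\<Sum>bs\<in>exps N n. m bs as * \<kappa> bs) = 0"
    using more_unknowns_than_equations[of "exps (Suc M) e" "exps N n" "\<lambda>as bs. m bs as"] by auto
  have "peval (\<lambda>c _. c) N zs \<kappa> t = 0" for t
  proof -
    have "peval (\<lambda>c _. c) N zs \<kappa> t = (\<Sum>bs\<in>exps N n. \<Sum>as\<in>exps (Suc M) e. \<kappa> bs * (m bs as * tmono e as t))"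
      using m by (simp add: peval_zmono n_def sum_distrib_left)
    also have "\<dots> = (\<Sum>as\<in>exps (Suc M) e. (\<Sum>bs\<in>exps N n. m bs as * \<kappa> bs) * tmono e as t)"
      by (subst sum.swap) (simp add: sum_distrib_left sum_distrib_right mult_ac)
    finally show ?thesis using \<kappa>(2) by simp
  qed
  then have "peval (\<lambda>c _. c) N zs \<kappa> = 0" by (simp add: fun_eq_iff)
  with \<kappa>(1) show ?thesis by (auto simp: n_def)
qed

section \<open>The coordinate algebra and its derivations\<close>

definition fun_algebra :: "(('b \<Rightarrow> 'a::comm_ring_1) set) \<Rightarrow> bool" where
  "fun_algebra Z \<longleftrightarrow> (\<forall>c. (\<lambda>t. c) \<in> Z) \<and> (\<forall>f\<in>Z. \<forall>g\<in>Z. (\<lambda>t. f t + g t) \<in> Z \<and> (\<lambda>t. f t * g t) \<in> Z)"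

lemma fun_algebraD:
  assumes "fun_algebra Z"
  shows "(\<lambda>t. c) \<in> Z" "f \<in> Z \<Longrightarrow> g \<in> Z \<Longrightarrow> (\<lambda>t. f t + g t) \<in> Z"
    "f \<in> Z \<Longrightarrow> g \<in> Z \<Longrightarrow> (\<lambda>t. f t * g t) \<in> Z"
  using assms by (auto simp: fun_algebra_def)

lemma fun_algebra_sum:
  assumes "fun_algebra Z" "\<And>i. i \<in> I \<Longrightarrow> f i \<in> Z" shows "(\<lambda>t. \<Sum>i\<in>I. f i t) \<in> Z"
  using assms(2)
  by (induction I rule: infinite_finite_induct) (auto intro: fun_algebraD[OF assms(1)])

lemma fun_algebra_coeff_mult:
  assumes "fun_algebra Z" "\<And>j. (\<lambda>t. coeff (P t) j) \<in> Z" "\<And>j. (\<lambda>t. coeff (Q t) j) \<in> Z"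
  shows "(\<lambda>t. coeff (P t * Q t) j) \<in> Z"
  unfolding coeff_mult by (intro fun_algebra_sum fun_algebraD(3) assms)

lemma fun_algebra_coeff_power:
  assumes "fun_algebra Z" "\<And>j. (\<lambda>t. coeff (P t) j) \<in> Z"
  shows "(\<lambda>t. coeff (P t ^ n) j) \<in> Z"
proof (induction n arbitrary: j)
  case 0
  show ?case using fun_algebraD(1)[OF assms(1)] by simp
next
  case (Suc n)
  then show ?case unfolding power_Suc by (intro fun_algebra_coeff_mult assms)
qed

lemma fun_algebra_coeff_prod:
  assumes "fun_algebra Z" "\<And>i j. i \<in> I \<Longrightarrow> (\<lambda>t. coeff (P i t) j) \<in> Z"
  shows "(\<lambda>t. coeff (\<Prod>i\<in>I. P i t) j) \<in> Z"
  using assms(2)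
proof (induction I arbitrary: j rule: infinite_finite_induct)
  case (insert i I)
  then have "(\<lambda>t. coeff (P i t * (\<Prod>i\<in>I. P i t)) j) \<in> Z"
    by (intro fun_algebra_coeff_mult assms(1)) auto
  with insert show ?case by simp
qed (use fun_algebraD(1)[OF assms(1)] in auto)

lemma fun_algebra_pfun: "fun_algebra (pfun e)"
  by (auto simp: fun_algebra_def)

lemma pfun_coeff_linear: "i < e \<Longrightarrow> (\<lambda>t. coeff [:- t i, 1:] j) \<in> pfun e"
  by (cases j; cases "j - 1") (auto simp: coeff_pCons split: nat.split)

text \<open>The coordinate ring of a coincident root locus in the chart, pulled back to the space of roots:
  functions of the roots that are polynomials in the coefficients of the product.\<close>
inductive_set coeff_algebra :: "nat list \<Rightarrow> ((nat \<Rightarrow> 'a) \<Rightarrow> 'a::comm_ring_1) set" for l where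
  const [intro, simp]: "(\<lambda>t. c) \<in> coeff_algebra l"
| coeff [intro]: "(\<lambda>t. coeff (root_prod l t) j) \<in> coeff_algebra l"
| add [intro]: "f \<in> coeff_algebra l \<Longrightarrow> g \<in> coeff_algebra l \<Longrightarrow> (\<lambda>t. f t + g t) \<in> coeff_algebra l"
| mult [intro]: "f \<in> coeff_algebra l \<Longrightarrow> g \<in> coeff_algebra l \<Longrightarrow> (\<lambda>t. f t * g t) \<in> coeff_algebra l"

lemma fun_algebra_coeff_algebra: "fun_algebra (coeff_algebra l)"
  by (auto simp: fun_algebra_def)

lemma coeff_algebra_least:
  assumes "fun_algebra Z" "\<And>j. (\<lambda>t. coeff (root_prod l t) j) \<in> Z"
  shows "coeff_algebra l \<subseteq> Z"
proof
  show "x \<in> Z" if "x \<in> coeff_algebra l" for x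
    using that by induction (auto intro: fun_algebraD[OF assms(1)] assms(2))
qed

lemma coeff_root_prod_pfun: "(\<lambda>t. coeff (root_prod l t) j) \<in> pfun (length l)"
  unfolding root_prod_def
  by (intro fun_algebra_coeff_prod fun_algebra_coeff_power fun_algebra_pfun pfun_coeff_linear) auto

lemma coeff_algebra_pfun: "coeff_algebra l \<subseteq> pfun (length l)"
  by (intro coeff_algebra_least fun_algebra_pfun coeff_root_prod_pfun)

lemma coeff_algebra_root_prod_eq:
  "x \<in> coeff_algebra l \<Longrightarrow> root_prod l t = root_prod l u \<Longrightarrow> x t = x u"
  by (induction rule: coeff_algebra.induct) auto

definition derivation_at :: "(nat \<Rightarrow> 'a::field) \<Rightarrow> ((nat \<Rightarrow> 'a) \<Rightarrow> 'a) set \<Rightarrow> (((nat \<Rightarrow> 'a) \<Rightarrow> 'a) \<Rightarrow> 'a) \<Rightarrow> bool" where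
  "derivation_at t0 C \<chi> \<longleftrightarrow> (\<forall>c. \<chi> (\<lambda>t. c) = 0) \<and>
     (\<forall>x\<in>C. \<forall>y\<in>C. \<chi> (\<lambda>t. x t + y t) = \<chi> x + \<chi> y \<and> \<chi> (\<lambda>t. x t * y t) = x t0 * \<chi> y + y t0 * \<chi> x)"

subsection \<open>First order variation along a curve\<close>

text \<open>The expansion $x(\tau(s) + \epsilon\,w(s)) = x_0(s) + \epsilon\,x_1(s) + O(\epsilon^2)$ of a function along a curve $\tau$
  with a field of velocities $w$. It is stated pointwise in $s$, with polynomials in $\epsilon$.\<close>
definition lift :: "(nat \<Rightarrow> 'a::field_char_0 poly) \<Rightarrow> (nat \<Rightarrow> 'a poly) \<Rightarrow> ((nat \<Rightarrow> 'a) \<Rightarrow> 'a) \<Rightarrow> 'a poly \<Rightarrow> 'a poly \<Rightarrow> bool" where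
  "lift \<tau> w x x0 x1 \<longleftrightarrow> (\<forall>s. \<exists>P. (\<forall>\<epsilon>. x (\<lambda>i. poly (\<tau> i) s + \<epsilon> * poly (w i) s) = poly P \<epsilon>) \<and>
      coeff P 0 = poly x0 s \<and> coeff P 1 = poly x1 s)"

lemma lift_const: "lift \<tau> w (\<lambda>t. c) [:c:] 0"
  unfolding lift_def by (intro allI exI[of _ "[:c:]"]) simp

lemma lift_var: "lift \<tau> w (\<lambda>t. t i) (\<tau> i) (w i)"
  unfolding lift_def
proof
  fix s
  show "\<exists>P. (\<forall>\<epsilon>. poly (\<tau> i) s + \<epsilon> * poly (w i) s = poly P \<epsilon>) \<and>
      coeff P 0 = poly (\<tau> i) s \<and> coeff P 1 = poly (w i) s"
    by (intro exI[of _ "[:poly (\<tau> i) s, poly (w i) s:]"]) simp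
qed

lemma lift_add:
  assumes "lift \<tau> w x x0 x1" "lift \<tau> w y y0 y1"
  shows "lift \<tau> w (\<lambda>t. x t + y t) (x0 + y0) (x1 + y1)"
  unfolding lift_def
proof
  fix s
  obtain P where "\<forall>\<epsilon>. x (\<lambda>i. poly (\<tau> i) s + \<epsilon> * poly (w i) s) = poly P \<epsilon>" "coeff P 0 = poly x0 s" "coeff P 1 = poly x1 s"
    using assms(1) unfolding lift_def by metis
  moreover obtain Q where "\<forall>\<epsilon>. y (\<lambda>i. poly (\<tau> i) s + \<epsilon> * poly (w i) s) = poly Q \<epsilon>" "coeff Q 0 = poly y0 s" "coeff Q 1 = poly y1 s"
    using assms(2) unfolding lift_def by metis
  ultimately show "\<exists>P. (\<forall>\<epsilon>. x (\<lambda>i. poly (\<tau> i) s + \<epsilon> * poly (w i) s) + y (\<lambda>i. poly (\<tau> i) s + \<epsilon> * poly (w i) s) = poly P \<epsilon>) \<and>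
      coeff P 0 = poly (x0 + y0) s \<and> coeff P 1 = poly (x1 + y1) s"
    by (intro exI[of _ "P + Q"]) simp
qed

lemma lift_mult:
  assumes "lift \<tau> w x x0 x1" "lift \<tau> w y y0 y1"
  shows "lift \<tau> w (\<lambda>t. x t * y t) (x0 * y0) (x0 * y1 + x1 * y0)"
  unfolding lift_def
proof
  fix s
  obtain P where "\<forall>\<epsilon>. x (\<lambda>i. poly (\<tau> i) s + \<epsilon> * poly (w i) s) = poly P \<epsilon>" "coeff P 0 = poly x0 s" "coeff P 1 = poly x1 s"
    using assms(1) unfolding lift_def by metis
  moreover obtain Q where "\<forall>\<epsilon>. y (\<lambda>i. poly (\<tau> i) s + \<epsilon> * poly (w i) s) = poly Q \<epsilon>" "coeff Q 0 = poly y0 s" "coeff Q 1 = poly y1 s"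
    using assms(2) unfolding lift_def by metis
  ultimately show "\<exists>P. (\<forall>\<epsilon>. x (\<lambda>i. poly (\<tau> i) s + \<epsilon> * poly (w i) s) * y (\<lambda>i. poly (\<tau> i) s + \<epsilon> * poly (w i) s) = poly P \<epsilon>) \<and>
      coeff P 0 = poly (x0 * y0) s \<and> coeff P 1 = poly (x0 * y1 + x1 * y0) s"
    by (intro exI[of _ "P * Q"]) (simp add: coeff_mult_01)
qed

lemma lift_sum:
  assumes "\<And>i. i \<in> I \<Longrightarrow> lift \<tau> w (x i) (x0 i) (x1 i)"
  shows "lift \<tau> w (\<lambda>t. \<Sum>i\<in>I. x i t) (\<Sum>i\<in>I. x0 i) (\<Sum>i\<in>I. x1 i)"
  using assms
proof (induction I rule: infinite_finite_induct)
  case (insert i I)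
  then show ?case using lift_add[of \<tau> w "x i" "x0 i" "x1 i"] by simp
qed (use lift_const[of \<tau> w 0] in auto)

lemma lift_unique:
  assumes "lift \<tau> w x x0 x1" "lift \<tau> w x y0 y1" shows "x0 = y0" "x1 = y1"
proof -
  have "poly x0 s = poly y0 s \<and> poly x1 s = poly y1 s" for s
  proof -
    obtain P where P: "\<forall>\<epsilon>. x (\<lambda>i. poly (\<tau> i) s + \<epsilon> * poly (w i) s) = poly P \<epsilon>" "coeff P 0 = poly x0 s" "coeff P 1 = poly x1 s"
      using assms(1) unfolding lift_def by metis
    obtain Q where Q: "\<forall>\<epsilon>. x (\<lambda>i. poly (\<tau> i) s + \<epsilon> * poly (w i) s) = poly Q \<epsilon>" "coeff Q 0 = poly y0 s" "coeff Q 1 = poly y1 s"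
      using assms(2) unfolding lift_def by metis
    have "P = Q" by (rule poly_ext) (use P(1) Q(1) in simp)
    with P Q show ?thesis by simp
  qed
  then show "x0 = y0" "x1 = y1" by (auto intro: poly_ext)
qed

definition plift where
  "plift \<tau> w P P0 P1 \<longleftrightarrow> (\<forall>j. lift \<tau> w (\<lambda>t. coeff (P t) j) (coeff P0 j) (coeff P1 j))"

lemma plift_mult:
  assumes "plift \<tau> w P P0 P1" "plift \<tau> w Q Q0 Q1"
  shows "plift \<tau> w (\<lambda>t. P t * Q t) (P0 * Q0) (P0 * Q1 + P1 * Q0)"
  unfolding plift_def
proof
  fix j
  have "lift \<tau> w (\<lambda>t. \<Sum>i\<le>j. coeff (P t) i * coeff (Q t) (j - i)) (\<Sum>i\<le>j. coeff P0 i * coeff Q0 (j - i))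
     (\<Sum>i\<le>j. coeff P0 i * coeff Q1 (j - i) + coeff P1 i * coeff Q0 (j - i))"
    using assms unfolding plift_def by (intro lift_sum lift_mult) auto
  then show "lift \<tau> w (\<lambda>t. coeff (P t * Q t) j) (coeff (P0 * Q0) j) (coeff (P0 * Q1 + P1 * Q0) j)"
    by (simp add: coeff_mult sum.distrib)
qed

lemma plift_1: "plift \<tau> w (\<lambda>t. 1) 1 0"
  using lift_const[of \<tau> w 1, folded one_pCons] lift_const[of \<tau> w 0]
  by (auto simp: plift_def of_bool_def)

lemma plift_linear: "plift \<tau> w (\<lambda>t. [:- t i, 1:]) [:- \<tau> i, 1:] [:- w i:]"
  unfolding plift_def
proof
  fix j
  have "lift \<tau> w (\<lambda>t. - 1 * t i) ([:- 1:] * \<tau> i) ([:- 1:] * w i + 0 * \<tau> i)"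
    by (intro lift_mult lift_const lift_var)
  then have "lift \<tau> w (\<lambda>t. - t i) (- \<tau> i) (- w i)" by simp
  then show "lift \<tau> w (\<lambda>t. coeff [:- t i, 1:] j) (coeff [:- \<tau> i, 1:] j) (coeff [:- w i:] j)"
    using lift_const[of \<tau> w 1] lift_const[of \<tau> w 0]
    by (auto simp: coeff_pCons one_pCons split: nat.split)
qed

lemma plift_linear_power:
  "plift \<tau> w (\<lambda>t. [:- t i, 1:] ^ Suc n) ([:- \<tau> i, 1:] ^ Suc n) (- ([:- \<tau> i, 1:] ^ n * [:of_nat (Suc n) * w i:]))"
proof (induction n)
  case 0
  then show ?case using plift_linear[of \<tau> w i] by simp
next
  case (Suc n)
  define L where "L = [:- \<tau> i, 1:]"
  have sm: "[:of_nat (Suc (Suc n)) * w i:] = [:of_nat (Suc n) * w i:] + [:w i:]"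
    by (simp add: algebra_simps)
  have gen: "L * (- (M * Y)) + (- X) * (L * M) = - ((L * M) * (Y + X))" for X Y M
    by (simp add: algebra_simps)
  have "[:- w i:] = - [:w i:]" by simp
  then have "L * (- (L ^ n * [:of_nat (Suc n) * w i:])) + [:- w i:] * L ^ Suc n = - (L ^ Suc n * [:of_nat (Suc (Suc n)) * w i:])"
    unfolding sm power_Suc by (simp only: gen)
  then show ?case using plift_mult[OF plift_linear Suc, of i] unfolding L_def power_Suc[of _ "Suc n"] by simp
qed

text \<open>Moving all roots along the curve with velocities $w_i$ changes the product of the linear factors
  by $- Q \cdot \sum_i m_i w_i E / (X - \tau_i)$, where $Q$ has the exponents $m_i - 1$ and $E$ is the
  product of the distinct factors.\<close>
lemma plift_prod:
  assumes "\<And>i. i < n \<Longrightarrow> m i \<ge> 1"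
  shows "plift \<tau> w (\<lambda>t. \<Prod>i<n. [:- t i, 1:] ^ m i) (\<Prod>i<n. [:- \<tau> i, 1:] ^ m i)
     (- ((\<Prod>i<n. [:- \<tau> i, 1:] ^ (m i - 1)) * (\<Sum>i<n. [:of_nat (m i) * w i:] * (\<Prod>j\<in>{..<n} - {i}. [:- \<tau> j, 1:]))))"
  using assms
proof (induction n)
  case 0
  then show ?case using plift_1 by simp
next
  case (Suc n)
  define L where "L = (\<lambda>i. [:- \<tau> i, 1:])"
  define Q where "Q = (\<Prod>i<n. L i ^ (m i - 1))"
  define S where "S = (\<Sum>i<n. [:of_nat (m i) * w i:] * (\<Prod>j\<in>{..<n} - {i}. L j))"
  obtain k where k: "m n = Suc k" using Suc.prems[of n] by (cases "m n") auto
  have "{..<Suc n} - {i} = insert n ({..<n} - {i})" if "i < n" for i using that by auto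
  then have S': "(\<Sum>i<Suc n. [:of_nat (m i) * w i:] * (\<Prod>j\<in>{..<Suc n} - {i}. L j))
      = L n * S + [:of_nat (m n) * w n:] * (\<Prod>j<n. L j)"
    by (simp add: S_def sum_distrib_left lessThan_Suc mult_ac)
  have "L i ^ m i = L i ^ (m i - 1) * L i" if "i < n" for i
    using power_minus_mult[of "m i" "L i"] Suc.prems[of i] that by simp
  then have "(\<Prod>i<n. L i ^ m i) = (\<Prod>i<n. L i ^ (m i - 1) * L i)"
    by (intro prod.cong) auto
  then have P0: "(\<Prod>i<n. L i ^ m i) = Q * (\<Prod>j<n. L j)" by (simp add: Q_def prod.distrib)
  have gen: "(Q * T) * (- (M * Y)) + (- (Q * S)) * (L' * M) = - ((Q * M) * (L' * S + Y * T))" for T M Y L'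
    by (simp add: algebra_simps)
  have "plift \<tau> w (\<lambda>t. (\<Prod>i<n. [:- t i, 1:] ^ m i) * [:- t n, 1:] ^ m n) ((\<Prod>i<n. L i ^ m i) * L n ^ m n)
     ((\<Prod>i<n. L i ^ m i) * (- (L n ^ k * [:of_nat (m n) * w n:])) + (- (Q * S)) * L n ^ m n)"
    using plift_mult[OF Suc.IH plift_linear_power[of \<tau> w n k]] Suc.prems
    unfolding k L_def Q_def S_def by simp
  also have "(\<Prod>i<n. L i ^ m i) * (- (L n ^ k * [:of_nat (m n) * w n:])) + (- (Q * S)) * L n ^ m n
     = - ((Q * L n ^ (m n - 1)) * (L n * S + [:of_nat (m n) * w n:] * (\<Prod>j<n. L j)))"
    unfolding P0 k power_Suc diff_Suc_1 by (rule gen)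
  finally show ?case unfolding S'[unfolded L_def] L_def Q_def by (simp only: prod.lessThan_Suc)
qed

text \<open>The velocities for which the variation is $D \cdot Q X^h$. They come from Lagrange interpolation
  of $X^h$ in the points $\tau_i$, multiplied by the common denominator $D$.\<close>
lemma lagrange_identity:
  fixes \<tau> :: "nat \<Rightarrow> 'b::idom"
  assumes inj: "inj_on \<tau> {..<n}" and h: "h < n"
  defines "E \<equiv> \<lambda>i. \<Prod>j\<in>{..<n} - {i}. (\<tau> i - \<tau> j)"
  shows "(\<Sum>i<n. [:\<tau> i ^ h * (\<Prod>j\<in>{..<n} - {i}. E j):] * (\<Prod>j\<in>{..<n} - {i}. [:- \<tau> j, 1:]))
      = [:\<Prod>i<n. E i:] * [:0, 1:] ^ h"
proof -
  define p where "p = (\<Sum>i<n. [:\<tau> i ^ h * (\<Prod>j\<in>{..<n} - {i}. E j):] * (\<Prod>j\<in>{..<n} - {i}. [:- \<tau> j, 1:]))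
      - [:\<Prod>i<n. E i:] * [:0, 1:] ^ h"
  have "poly p (\<tau> k) = 0" if k: "k < n" for k
  proof -
    have 0: "(\<Prod>j\<in>{..<n} - {i}. (\<tau> k - \<tau> j)) = 0" if "i \<noteq> k" for i
      using that k by (intro prod_zero) auto
    have "poly p (\<tau> k) = (\<Sum>i<n. \<tau> i ^ h * (\<Prod>j\<in>{..<n} - {i}. E j) * (\<Prod>j\<in>{..<n} - {i}. (\<tau> k - \<tau> j)))
        - (\<Prod>i<n. E i) * \<tau> k ^ h"
      by (simp add: p_def poly_sum poly_prod)
    also have "(\<Sum>i<n. \<tau> i ^ h * (\<Prod>j\<in>{..<n} - {i}. E j) * (\<Prod>j\<in>{..<n} - {i}. (\<tau> k - \<tau> j)))
        = \<tau> k ^ h * (\<Prod>j\<in>{..<n} - {k}. E j) * E k"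
      using k 0 by (subst sum.remove[of _ k]) (auto simp: E_def intro!: sum.neutral)
    also have "\<dots> = (\<Prod>i<n. E i) * \<tau> k ^ h"
      using k prod.remove[of "{..<n}" k E] by (simp add: mult_ac)
    finally show ?thesis by simp
  qed
  then have roots: "\<tau> ` {..<n} \<subseteq> {x. poly p x = 0}" by auto
  have "p = 0"
  proof (rule ccontr)
    assume p: "p \<noteq> 0"
    have "n = card (\<tau> ` {..<n})" using inj by (simp add: card_image)
    also have "\<dots> \<le> card {x. poly p x = 0}" using roots p by (intro card_mono poly_roots_finite)
    also have "\<dots> \<le> degree p" using p by (rule card_poly_roots_bound)
    also have "\<dots> \<le> n - 1"
      unfolding p_def
    proof (intro degree_diff_le degree_sum_le)
      show "degree ([:\<Prod>i<n. E i:] * [:0, 1:] ^ h) \<le> n - 1"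
        using h by (intro order.trans[OF degree_mult_le]) (simp add: degree_power_eq)
      show "degree ([:\<tau> i ^ h * (\<Prod>j\<in>{..<n} - {i}. E j):] * (\<Prod>j\<in>{..<n} - {i}. [:- \<tau> j, 1:])) \<le> n - 1"
        if "i \<in> {..<n}" for i
      proof -
        have "degree (\<Prod>j\<in>{..<n} - {i}. [:- \<tau> j, 1:]) \<le> (\<Sum>j\<in>{..<n} - {i}. degree [:- \<tau> j, 1:])"
          using degree_prod_sum_le[of "{..<n} - {i}" "\<lambda>j. [:- \<tau> j, 1:]"] by (simp add: comp_def)
        then show ?thesis using that by (intro order.trans[OF degree_mult_le]) simp
      qed
    qed simp
    finally show False using h by simp
  qed
  then show ?thesis by (simp add: p_def)
qed

lemma poly_X2_dvd_iff: "[:0, 1:] ^ 2 dvd p \<longleftrightarrow> coeff p 0 = 0 \<and> coeff p (Suc 0) = 0" for p :: "'a::field poly"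
proof -
  have "[:0, 1:] ^ 2 = monom (1::'a) 2" by (simp add: monom_altdef)
  moreover have "monom 1 2 dvd p \<longleftrightarrow> (\<forall>k<2. coeff p k = 0)" by (rule monom_1_dvd_iff')
  ultimately show ?thesis by (auto simp: less_2_cases_iff)
qed

lemma coeff_mult_mod_X2:
  fixes p q :: "'a::field poly"
  assumes "[:0, 1:] ^ 2 dvd p - [:c:]" "b \<le> 1"
  shows "coeff (p * q) b = c * coeff q b"
proof -
  have "coeff p 0 = c" "coeff p (Suc 0) = 0" using assms(1) unfolding poly_X2_dvd_iff by auto
  moreover have "b = 0 \<or> b = Suc 0" using assms(2) by auto
  ultimately show ?thesis by (auto simp: coeff_mult_01)
qed

text \<open>Along a curve with distinct roots the variation is divisible by \<open>D\<close>, and the quotient makes sense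
  also at $s = 0$, where roots may collide: tangent vectors are obtained as limits. If the
  curve agrees with the point to first order, not only the constant coefficient of the quotient is a
  derivation, but also the coefficient of $s$.\<close>
lemma tangent_vector_of_curve:
  fixes \<tau> :: "nat \<Rightarrow> 'a::field_char_0 poly"
  assumes l: "0 \<notin> set l" and inj: "inj_on \<tau> {..<length l}" and h: "h < length l" and b: "b \<le> 1"
    and start: "\<And>j. [:0, 1:] ^ 2 dvd coeff (root_prod l \<tau>) j - [:coeff (root_prod l t0) j:]"
  shows "\<exists>\<chi>. derivation_at t0 (coeff_algebra l) \<chi> \<and>
     (\<forall>j. \<chi> (\<lambda>t. coeff (root_prod l t) j) = coeff (coeff (root_prod (map (\<lambda>n. n - 1) l) \<tau> * [:0, 1:] ^ h) j) b)"
proof -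
  define n where "n = length l"
  define E where "E = (\<lambda>i. \<Prod>j\<in>{..<n} - {i}. (\<tau> i - \<tau> j))"
  define D where "D = (\<Prod>i<n. E i)"
  define w where "w = (\<lambda>i. smult (- 1 / of_nat (l ! i)) (\<tau> i ^ h * (\<Prod>j\<in>{..<n} - {i}. E j)))"
  define Q where "Q = root_prod (map (\<lambda>n. n - 1) l) \<tau>"
  have l1: "l ! i \<ge> 1" if "i < n" for i using l that unfolding n_def by (metis One_nat_def Suc_leI not_gr_zero nth_mem)
  have "\<tau> i \<noteq> \<tau> j" if "i < n" "j < n" "i \<noteq> j" for i j using inj that by (auto simp: inj_on_def n_def)
  then have D0: "D \<noteq> 0" by (auto simp: D_def E_def)
  have wl: "[:of_nat (l ! i) * w i:] = - [:\<tau> i ^ h * (\<Prod>j\<in>{..<n} - {i}. E j):]" if "i < n" for i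
    using l1[OF that] by (simp add: w_def of_nat_poly)
  have "(\<Sum>i<n. [:of_nat (l ! i) * w i:] * (\<Prod>j\<in>{..<n} - {i}. [:- \<tau> j, 1:]))
      = - (\<Sum>i<n. [:\<tau> i ^ h * (\<Prod>j\<in>{..<n} - {i}. E j):] * (\<Prod>j\<in>{..<n} - {i}. [:- \<tau> j, 1:]))"
    unfolding sum_negf[symmetric] using wl by (intro sum.cong) simp_all
  also have "\<dots> = - ([:D:] * [:0, 1:] ^ h)"
    unfolding D_def E_def using lagrange_identity[OF inj[folded n_def] h[folded n_def]] by simp
  finally have lag: "(\<Sum>i<n. [:of_nat (l ! i) * w i:] * (\<Prod>j\<in>{..<n} - {i}. [:- \<tau> j, 1:])) = - ([:D:] * [:0, 1:] ^ h)" .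
  have Qp: "Q = (\<Prod>i<n. [:- \<tau> i, 1:] ^ (l ! i - 1))"
    unfolding Q_def root_prod_def n_def by (simp cong: prod.cong_simp)
  have "plift \<tau> w (root_prod l) (root_prod l \<tau>) (- (Q * (- ([:D:] * [:0, 1:] ^ h))))"
    unfolding lag[symmetric] Qp root_prod_def[abs_def] n_def[symmetric] using l1 by (intro plift_prod)
  moreover have "- (Q * (- ([:D:] * [:0, 1:] ^ h))) = smult D (Q * [:0, 1:] ^ h)" by (simp add: mult.commute)
  ultimately have pl: "lift \<tau> w (\<lambda>t. coeff (root_prod l t) j) (coeff (root_prod l \<tau>) j)
      (D * coeff (Q * [:0, 1:] ^ h) j)" for j
    unfolding plift_def by simp
  have ex: "\<exists>x0 z. lift \<tau> w x x0 (D * z) \<and> [:0, 1:] ^ 2 dvd x0 - [:x t0:]" if "x \<in> coeff_algebra l" for x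
    using that
  proof induction
    case (const c)
    have "lift \<tau> w (\<lambda>t. c) [:c:] (D * 0) \<and> [:0, 1:] ^ 2 dvd [:c:] - [:c:]" using lift_const[of \<tau> w c] by simp
    then show ?case by blast
  next
    case (coeff j)
    then show ?case using pl[of j] start[of j] by blast
  next
    case (add x y)
    then obtain x0 z y0 z' where *: "lift \<tau> w x x0 (D * z)" "[:0, 1:] ^ 2 dvd x0 - [:x t0:]"
      "lift \<tau> w y y0 (D * z')" "[:0, 1:] ^ 2 dvd y0 - [:y t0:]" by blast
    have "lift \<tau> w (\<lambda>t. x t + y t) (x0 + y0) (D * (z + z'))"
      using lift_add[OF *(1,3)] by (simp add: algebra_simps)
    moreover have "[:0, 1:] ^ 2 dvd (x0 + y0) - [:x t0 + y t0:]" using *(2,4) unfolding poly_X2_dvd_iff by auto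
    ultimately show ?case by blast
  next
    case (mult x y)
    then obtain x0 z y0 z' where *: "lift \<tau> w x x0 (D * z)" "[:0, 1:] ^ 2 dvd x0 - [:x t0:]"
      "lift \<tau> w y y0 (D * z')" "[:0, 1:] ^ 2 dvd y0 - [:y t0:]" by blast
    have "lift \<tau> w (\<lambda>t. x t * y t) (x0 * y0) (D * (x0 * z' + z * y0))"
      using lift_mult[OF *(1,3)] by (simp add: algebra_simps)
    moreover have "[:0, 1:] ^ 2 dvd (x0 * y0) - [:x t0 * y t0:]"
      using *(2,4) unfolding poly_X2_dvd_iff by (auto simp: coeff_mult_01)
    ultimately show ?case by blast
  qed
  define \<chi> where "\<chi> = (\<lambda>x. coeff (SOME z. \<exists>x0. lift \<tau> w x x0 (D * z)) b)"
  have \<chi>: "\<chi> x = coeff z b" if "lift \<tau> w x x0 (D * z)" for x x0 z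
  proof -
    define z' where "z' = (SOME z. \<exists>x0. lift \<tau> w x x0 (D * z))"
    have "\<exists>x0. lift \<tau> w x x0 (D * z')" unfolding z'_def using that by (intro someI[of "\<lambda>z. \<exists>x0. lift \<tau> w x x0 (D * z)"]) blast
    then obtain x0' where "lift \<tau> w x x0' (D * z')" by blast
    then have "D * z' = D * z" using lift_unique(2)[OF _ that] by blast
    then show ?thesis using D0 by (simp add: \<chi>_def z'_def[symmetric])
  qed
  have "derivation_at t0 (coeff_algebra l) \<chi>"
    unfolding derivation_at_def
  proof (intro conjI allI ballI)
    show "\<chi> (\<lambda>t. c) = 0" for c using \<chi>[of "\<lambda>t. c" "[:c:]" 0] lift_const[of \<tau> w c] by simp
    fix x y :: "(nat \<Rightarrow> 'a) \<Rightarrow> 'a" assume "x \<in> coeff_algebra l" "y \<in> coeff_algebra l"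
    then obtain x0 z y0 z' where *: "lift \<tau> w x x0 (D * z)" "[:0, 1:] ^ 2 dvd x0 - [:x t0:]"
      "lift \<tau> w y y0 (D * z')" "[:0, 1:] ^ 2 dvd y0 - [:y t0:]" using ex by metis
    have "lift \<tau> w (\<lambda>t. x t + y t) (x0 + y0) (D * (z + z'))"
      using lift_add[OF *(1,3)] by (simp add: algebra_simps)
    from \<chi>[OF this] show "\<chi> (\<lambda>t. x t + y t) = \<chi> x + \<chi> y" by (simp add: \<chi>[OF *(1)] \<chi>[OF *(3)])
    have "lift \<tau> w (\<lambda>t. x t * y t) (x0 * y0) (D * (x0 * z' + y0 * z))"
      using lift_mult[OF *(1,3)] by (simp add: algebra_simps)
    from \<chi>[OF this] show "\<chi> (\<lambda>t. x t * y t) = x t0 * \<chi> y + y t0 * \<chi> x"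
      using coeff_mult_mod_X2[OF *(2) b] coeff_mult_mod_X2[OF *(4) b] by (simp add: \<chi>[OF *(1)] \<chi>[OF *(3)])
  qed
  moreover have "\<chi> (\<lambda>t. coeff (root_prod l t) j) = coeff (coeff (Q * [:0, 1:] ^ h) j) b" for j
    by (rule \<chi>[OF pl])
  ultimately show ?thesis unfolding Q_def by blast
qed

section \<open>Tangent vectors at a nonsingular point\<close>

text \<open>The $e + 1$ vectors $Q, Q X, \dots, Q X^{e-1}, v$ are linearly dependent, and a nonzero multiple of \<open>v\<close>
  cannot be a multiple of \<open>Q\<close>, for reasons of degree.\<close>
lemma tangent_vector_vanishes:
  fixes Q v :: "'a::field poly"
  assumes dim: "\<And>\<chi>s. (\<And>i. i \<le> e \<Longrightarrow> derivation_at t0 C (\<chi>s i)) \<Longrightarrow>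
      \<exists>\<beta>. (\<exists>i\<le>e. \<beta> i \<noteq> 0) \<and> (\<forall>x\<in>C. (\<Sum>i\<le>e. \<beta> i * \<chi>s i x) = 0)"
    and C: "\<And>j. c j \<in> C"
    and Q: "Q \<noteq> 0" "v \<noteq> 0 \<Longrightarrow> degree v < degree Q"
    and T: "\<And>h. h < e \<Longrightarrow> \<exists>\<chi>. derivation_at t0 C \<chi> \<and> (\<forall>j. \<chi> (c j) = coeff (Q * [:0, 1:] ^ h) j)"
    and Tv: "\<exists>\<chi>. derivation_at t0 C \<chi> \<and> (\<forall>j. \<chi> (c j) = coeff v j)"
  shows "v = 0"
proof (rule ccontr)
  assume v: "v \<noteq> 0"
  obtain \<chi> where \<chi>: "\<And>h. h < e \<Longrightarrow> derivation_at t0 C (\<chi> h) \<and> (\<forall>j. \<chi> h (c j) = coeff (Q * [:0, 1:] ^ h) j)"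
    using T by metis
  obtain \<chi>v where \<chi>v: "derivation_at t0 C \<chi>v" "\<And>j. \<chi>v (c j) = coeff v j" using Tv by blast
  define \<chi>s where "\<chi>s = (\<lambda>i. if i < e then \<chi> i else \<chi>v)"
  have "derivation_at t0 C (\<chi>s i)" if "i \<le> e" for i using \<chi> \<chi>v by (simp add: \<chi>s_def)
  then obtain \<beta> where \<beta>: "\<exists>i\<le>e. \<beta> i \<noteq> 0" "\<And>x. x \<in> C \<Longrightarrow> (\<Sum>i\<le>e. \<beta> i * \<chi>s i x) = 0"
    using dim[of \<chi>s] by blast
  define B where "B = (\<Sum>h<e. monom (\<beta> h) h)"
  have "Q * B + smult (\<beta> e) v = 0"
  proof (rule poly_eqI)
    fix j
    have "Q * B = (\<Sum>h<e. smult (\<beta> h) (Q * [:0, 1:] ^ h))"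
      by (simp add: B_def sum_distrib_left monom_altdef)
    then have "coeff (Q * B + smult (\<beta> e) v) j = (\<Sum>h<e. \<beta> h * coeff (Q * [:0, 1:] ^ h) j) + \<beta> e * coeff v j"
      by (simp add: coeff_sum)
    also have "\<dots> = (\<Sum>i\<le>e. \<beta> i * \<chi>s i (c j))"
      using \<chi> \<chi>v by (simp add: \<chi>s_def flip: lessThan_Suc_atMost)
    finally show "coeff (Q * B + smult (\<beta> e) v) j = coeff 0 j" using \<beta>(2)[OF C] by simp
  qed
  then have eq: "Q * B = smult (- \<beta> e) v" by (simp add: add_eq_0_iff)
  have "B = 0"
  proof (rule ccontr)
    assume "B \<noteq> 0"
    then have "degree Q \<le> degree (Q * B)" using Q(1) by (simp add: degree_mult_eq)
    also have "\<dots> \<le> degree v" unfolding eq by (rule degree_smult_le)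
    finally show False using Q(2) v by simp
  qed
  then have "\<beta> e = 0" using eq v by simp
  moreover have "\<beta> h = 0" if "h < e" for h
  proof -
    have "coeff B h = \<beta> h" using that by (simp add: B_def coeff_sum coeff_monom)
    with \<open>B = 0\<close> show ?thesis by simp
  qed
  ultimately show False using \<beta>(1) by (metis le_neq_implies_less)
qed

text \<open>First order Taylor expansion in $s$ of a polynomial over $K[s]$.\<close>
definition first_order :: "'a::comm_ring_1 poly poly \<Rightarrow> 'a poly \<Rightarrow> 'a poly \<Rightarrow> bool" where
  "first_order P p q \<longleftrightarrow> (\<forall>j. coeff (coeff P j) 0 = coeff p j \<and> coeff (coeff P j) (Suc 0) = coeff q j)"

lemma first_order_mult:
  assumes "first_order P p q" "first_order P' p' q'"
  shows "first_order (P * P') (p * p') (p * q' + q * p')"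
  using assms by (simp add: first_order_def coeff_mult[of P] coeff_mult[of p] coeff_mult[of q] coeff_sum
      coeff_mult_01 sum.distrib)

lemma first_order_1: "first_order 1 1 0"
  by (auto simp: first_order_def of_bool_def)

lemma first_order_linear: "first_order [:- \<tau>, 1:] [:- coeff \<tau> 0, 1:] [:- coeff \<tau> 1:]"
  by (auto simp: first_order_def coeff_pCons split: nat.split)

lemma first_order_power:
  assumes "first_order P p q" shows "first_order (P ^ n) (p ^ n) (of_nat n * q * p ^ (n - 1))"
proof (induction n)
  case 0
  show ?case using first_order_1 by simp
next
  case (Suc n)
  have "p * (of_nat n * q * p ^ (n - 1)) + q * p ^ n = of_nat (Suc n) * q * p ^ (Suc n - 1)"
    by (cases n) (simp_all add: algebra_simps)
  then show ?case using first_order_mult[OF assms Suc] by (simp add: mult.commute)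
qed

lemma first_order_prod:
  assumes "finite I" "\<And>i. i \<in> I \<Longrightarrow> first_order (P i) (p i) (q i)"
  shows "first_order (\<Prod>i\<in>I. P i) (\<Prod>i\<in>I. p i) (\<Sum>i\<in>I. q i * (\<Prod>j\<in>I - {i}. p j))"
  using assms
proof (induction I rule: finite_induct)
  case (insert i I)
  have "(\<Prod>j\<in>insert i I - {k}. p j) = p i * (\<Prod>j\<in>I - {k}. p j)" if "k \<in> I" for k
  proof -
    have "insert i I - {k} = insert i (I - {k})" using that insert by auto
    then show ?thesis using insert by simp
  qed
  then have eq: "(\<Sum>k\<in>insert i I. q k * (\<Prod>j\<in>insert i I - {k}. p j))
      = p i * (\<Sum>k\<in>I. q k * (\<Prod>j\<in>I - {k}. p j)) + q i * (\<Prod>j\<in>I. p j)"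
    using insert by (simp add: sum_distrib_left mult_ac add.commute cong: sum.cong_simp)
  show ?case unfolding eq prod.insert[OF insert.hyps]
    by (rule first_order_mult) (use insert in auto)
qed (simp add: first_order_1)

lemma first_order_X_power:
  assumes "first_order P p q" shows "first_order (P * [:0, 1:] ^ h) (p * [:0, 1:] ^ h) (q * [:0, 1:] ^ h)"
proof -
  have "first_order [:0, 1:] [:0, 1:] 0" using first_order_linear[of 0] by simp
  from first_order_mult[OF assms first_order_power[OF this, of h]] show ?thesis by simp
qed

lemma first_order_root_prod:
  "first_order (root_prod m \<tau>) (root_prod m (\<lambda>i. coeff (\<tau> i) 0))
    (\<Sum>i<length m. of_nat (m ! i) * [:- coeff (\<tau> i) 1:] * [:- coeff (\<tau> i) 0, 1:] ^ (m ! i - 1)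
       * (\<Prod>j\<in>{..<length m} - {i}. [:- coeff (\<tau> j) 0, 1:] ^ (m ! j)))"
  unfolding root_prod_def by (intro first_order_prod first_order_power first_order_linear) auto

lemma first_order_root_prod_const:
  assumes "\<And>i. i < length m \<Longrightarrow> coeff (\<tau> i) 1 = 0"
  shows "first_order (root_prod m \<tau>) (root_prod m (\<lambda>i. coeff (\<tau> i) 0)) 0"
  using first_order_root_prod[of m \<tau>] assms by simp

text \<open>Two coinciding roots move with different velocities. Only their factors contribute, and both
  contributions are multiples of the product divided by $X - x$.\<close>
lemma first_order_root_prod_two:
  fixes \<tau> :: "nat \<Rightarrow> 'a::field poly"
  assumes pq: "p < length m" "q < length m" "p \<noteq> q" "coeff (\<tau> p) 0 = x" "coeff (\<tau> q) 0 = x"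
    and zero: "\<And>i. i < length m \<Longrightarrow> i \<noteq> p \<Longrightarrow> i \<noteq> q \<Longrightarrow> coeff (\<tau> i) 1 = 0"
  obtains v where "first_order (root_prod m \<tau>) (root_prod m (\<lambda>i. coeff (\<tau> i) 0)) v"
    "[:- x, 1:] * v = smult (- (of_nat (m ! p) * coeff (\<tau> p) 1 + of_nat (m ! q) * coeff (\<tau> q) 1))
        (root_prod m (\<lambda>i. coeff (\<tau> i) 0))"
proof -
  define R where "R = root_prod m (\<lambda>i. coeff (\<tau> i) 0)"
  define s where "s = (\<lambda>i. of_nat (m ! i) * [:- coeff (\<tau> i) 1:] * [:- coeff (\<tau> i) 0, 1:] ^ (m ! i - 1)
       * (\<Prod>j\<in>{..<length m} - {i}. [:- coeff (\<tau> j) 0, 1:] ^ (m ! j)))"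
  have s: "[:- x, 1:] * s i = smult (- (of_nat (m ! i) * coeff (\<tau> i) 1)) R"
    if i: "i < length m" "coeff (\<tau> i) 0 = x" for i
  proof (cases "m ! i")
    case 0
    then show ?thesis by (simp add: s_def)
  next
    case (Suc n)
    have R: "R = [:- x, 1:] ^ Suc n * (\<Prod>j\<in>{..<length m} - {i}. [:- coeff (\<tau> j) 0, 1:] ^ (m ! j))"
      unfolding R_def root_prod_def using i by (subst prod.remove[of _ i]) (auto simp: Suc simp del: power_Suc)
    have "of_nat (m ! i) * [:- coeff (\<tau> i) 1:] = [:- (of_nat (m ! i) * coeff (\<tau> i) 1):]"
      by (simp add: of_nat_poly)
    then have "s i = [:- (of_nat (m ! i) * coeff (\<tau> i) 1):] * ([:- x, 1:] ^ n
        * (\<Prod>j\<in>{..<length m} - {i}. [:- coeff (\<tau> j) 0, 1:] ^ (m ! j)))"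
      unfolding s_def using i(2) Suc by (simp only: mult.assoc diff_Suc_1)
    then have "[:- x, 1:] * s i = [:- (of_nat (m ! i) * coeff (\<tau> i) 1):] * R"
      unfolding R power_Suc by (simp only: mult_ac)
    then show ?thesis by simp
  qed
  have "(\<Sum>i<length m. s i) = (\<Sum>i\<in>{p, q}. s i)"
    using pq zero by (intro sum.mono_neutral_right) (auto simp: s_def)
  then have sum: "(\<Sum>i<length m. s i) = s p + s q" using pq by simp
  show ?thesis
  proof (rule that)
    show "first_order (root_prod m \<tau>) (root_prod m (\<lambda>i. coeff (\<tau> i) 0)) (\<Sum>i<length m. s i)"
      using first_order_root_prod[of m \<tau>] by (simp add: s_def)
    show "[:- x, 1:] * (\<Sum>i<length m. s i) = smult (- (of_nat (m ! p) * coeff (\<tau> p) 1 + of_nat (m ! q) * coeff (\<tau> q) 1))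
        (root_prod m (\<lambda>i. coeff (\<tau> i) 0))"
      unfolding sum distrib_left s[OF pq(1,4)] s[OF pq(2,5)] R_def[symmetric]
      by (simp only: minus_add_distrib smult_add_left)
  qed
qed

context
  fixes l mu :: "nat list" and a t0 :: "nat \<Rightarrow> 'a::field_char_0"
  assumes l: "0 \<notin> set l" "l \<noteq> []" and start: "root_prod l t0 = root_prod mu a"
    \<comment> \<open>the tangent space has at most the dimension of the locus\<close>
    and dim: "\<And>\<chi>s. (\<And>i. i \<le> length l \<Longrightarrow> derivation_at t0 (coeff_algebra l) (\<chi>s i)) \<Longrightarrow>
      \<exists>\<beta>. (\<exists>i\<le>length l. \<beta> i \<noteq> 0) \<and> (\<forall>x\<in>coeff_algebra l. (\<Sum>i\<le>length l. \<beta> i * \<chi>s i x) = 0)"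
begin

text \<open>A derivation of the algebra of coefficients is recorded by its values on the coefficients, as a
  polynomial.\<close>
definition tangent :: "'a poly \<Rightarrow> bool" where
  "tangent v \<longleftrightarrow> (\<exists>\<chi>. derivation_at t0 (coeff_algebra l) \<chi> \<and> (\<forall>j. \<chi> (\<lambda>t. coeff (root_prod l t) j) = coeff v j))"

text \<open>The product $\prod_i (X - a_{\kappa(i)})^{\lambda_i - 1}$, a common factor of all the partial derivatives of
  $\prod_i (X - t_i)^{\lambda_i}$ at the point.\<close>
abbreviation reduced :: "(nat \<Rightarrow> nat) \<Rightarrow> 'a poly" where
  "reduced \<kappa> \<equiv> root_prod (map (\<lambda>n. n - 1) l) (\<lambda>i. a (\<kappa> i))"

lemma tangent_diff: "tangent v \<Longrightarrow> tangent w \<Longrightarrow> tangent (v - w)"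
proof -
  assume "tangent v" "tangent w"
  then obtain \<chi> \<psi> where *: "derivation_at t0 (coeff_algebra l) \<chi>" "\<And>j. \<chi> (\<lambda>t. coeff (root_prod l t) j) = coeff v j"
    "derivation_at t0 (coeff_algebra l) \<psi>" "\<And>j. \<psi> (\<lambda>t. coeff (root_prod l t) j) = coeff w j"
    unfolding tangent_def by blast
  have "derivation_at t0 (coeff_algebra l) (\<lambda>x. \<chi> x - \<psi> x)"
    using *(1,3) by (simp add: derivation_at_def algebra_simps)
  with * show ?thesis unfolding tangent_def by (intro exI[of _ "\<lambda>x. \<chi> x - \<psi> x"]) simp
qed

text \<open>The terms $i s^2$ keep the roots apart for $s \neq 0$ and are invisible to first order.\<close>
lemma tangent_of_curve:
  assumes \<kappa>: "\<kappa> \<in> assignments l mu" and \<tau>: "\<And>i. \<tau> i = [:a (\<kappa> i), u i, of_nat i:]"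
    and fo: "first_order (root_prod l \<tau>) (root_prod l (\<lambda>i. a (\<kappa> i))) 0"
    and red: "first_order (root_prod (map (\<lambda>n. n - 1) l) \<tau>) (reduced \<kappa>) v"
    and h: "h < length l"
  shows "tangent (reduced \<kappa> * [:0, 1:] ^ h)" "tangent (v * [:0, 1:] ^ h)"
proof -
  have inj: "inj_on \<tau> {..<length l}" by (auto simp: inj_on_def \<tau>)
  have eq: "root_prod l (\<lambda>i. a (\<kappa> i)) = root_prod l t0"
    using root_prod_of_assignment[OF \<kappa>, of a] start by simp
  have st: "[:0, 1:] ^ 2 dvd coeff (root_prod l \<tau>) j - [:coeff (root_prod l t0) j:]" for j
    using fo unfolding eq poly_X2_dvd_iff by (simp add: first_order_def)
  note * = first_order_X_power[OF red, of h, unfolded first_order_def]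
  show "tangent (reduced \<kappa> * [:0, 1:] ^ h)"
    using tangent_vector_of_curve[OF l(1) inj h _ st, of 0] * by (simp add: tangent_def)
  show "tangent (v * [:0, 1:] ^ h)"
    using tangent_vector_of_curve[OF l(1) inj h _ st, of 1] * by (simp add: tangent_def)
qed

lemma tangent_reduced:
  assumes \<kappa>: "\<kappa> \<in> assignments l mu" and h: "h < length l"
  shows "tangent (reduced \<kappa> * [:0, 1:] ^ h)"
proof -
  define \<tau> where "\<tau> = (\<lambda>i. [:a (\<kappa> i), 0, of_nat i:])"
  have "first_order (root_prod m \<tau>) (root_prod m (\<lambda>i. a (\<kappa> i))) 0" for m
    using first_order_root_prod_const[of m \<tau>] by (simp add: \<tau>_def)
  from tangent_of_curve(1)[OF \<kappa> _ this this h, of "\<lambda>_. 0"] show ?thesis by (simp add: \<tau>_def)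
qed

lemma tangent_small_zero:
  assumes "\<kappa> \<in> assignments l mu" "tangent v" "v \<noteq> 0 \<Longrightarrow> degree v < degree (reduced \<kappa>)"
  shows "v = 0"
proof (rule tangent_vector_vanishes[OF dim])
  show "reduced \<kappa> \<noteq> 0" using root_prod_monic monics_nonzero by blast
qed (use assms tangent_reduced[OF assms(1)] in \<open>auto simp: tangent_def\<close>)

text \<open>The difference of two of these monic polynomials is a tangent vector of smaller degree.\<close>
lemma reduced_unique:
  assumes "\<kappa> \<in> assignments l mu" "\<kappa>' \<in> assignments l mu"
  shows "reduced \<kappa> = reduced \<kappa>'"
proof -
  have "tangent (reduced \<kappa>)" if "\<kappa> \<in> assignments l mu" for \<kappa>
    using tangent_reduced[OF that, of 0] l(2) by simp
  then have "tangent (reduced \<kappa>' - reduced \<kappa>)" using assms by (intro tangent_diff)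
  moreover have "degree (reduced \<kappa>' - reduced \<kappa>) < degree (reduced \<kappa>)" if "reduced \<kappa>' - reduced \<kappa> \<noteq> 0"
  proof -
    define k where "k = sum_list (map (\<lambda>n. n - 1) l)"
    have m: "reduced \<kappa> \<in> monics k" "reduced \<kappa>' \<in> monics k" unfolding k_def by (rule root_prod_monic)+
    have "degree (reduced \<kappa>' - reduced \<kappa>) \<le> k" using m by (intro degree_diff_le) (auto simp: monics_def)
    moreover have "degree (reduced \<kappa>' - reduced \<kappa>) \<noteq> k"
    proof
      assume d: "degree (reduced \<kappa>' - reduced \<kappa>) = k"
      have "coeff (reduced \<kappa>' - reduced \<kappa>) k = 0" using m by (auto simp: monics_def)
      then show False using that d by (metis leading_coeff_0_iff)
    qed
    ultimately show ?thesis using m by (simp add: monics_def)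
  qed
  ultimately have "reduced \<kappa>' - reduced \<kappa> = 0" using tangent_small_zero[OF assms(1)] by blast
  then show ?thesis by simp
qed

text \<open>If a block had parts $m \neq n$, let their roots move with velocities $n$ and $- m$. The product with
  exponents $\lambda_i$ does not change to first order, but the product with exponents $\lambda_i - 1$ does, and its
  variation is a tangent vector of smaller degree.\<close>
lemma blocks_constant:
  assumes \<kappa>: "\<kappa> \<in> assignments l mu" and pq: "p < length l" "q < length l" "\<kappa> p = \<kappa> q"
  shows "l ! p = l ! q"
proof (rule ccontr)
  assume ne: "l ! p \<noteq> l ! q"
  then have "p \<noteq> q" by auto
  define u where "u = (\<lambda>i. if i = p then of_nat (l ! q) else if i = q then - of_nat (l ! p) else (0::'a))"
  define \<tau> where "\<tau> = (\<lambda>i. [:a (\<kappa> i), u i, of_nat i:])"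
  define A where "A = [:- a (\<kappa> p), 1:]"
  have \<tau>0: "coeff (\<tau> i) 0 = a (\<kappa> i)" "coeff (\<tau> i) 1 = u i" for i by (simp_all add: \<tau>_def)
  have two: "\<exists>v. first_order (root_prod m \<tau>) (root_prod m (\<lambda>i. a (\<kappa> i))) v \<and>
      A * v = smult (- (of_nat (m ! p) * of_nat (l ! q) - of_nat (m ! q) * of_nat (l ! p))) (root_prod m (\<lambda>i. a (\<kappa> i)))"
    if "length m = length l" for m
  proof -
    have P: "p < length m" "q < length m" "coeff (\<tau> p) 0 = a (\<kappa> p)" "coeff (\<tau> q) 0 = a (\<kappa> p)"
      using pq that by (simp_all add: \<tau>0)
    have Z: "coeff (\<tau> i) 1 = 0" if "i < length m" "i \<noteq> p" "i \<noteq> q" for i using that by (simp add: \<tau>_def u_def)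
    obtain v where "first_order (root_prod m \<tau>) (root_prod m (\<lambda>i. coeff (\<tau> i) 0)) v"
      "[:- a (\<kappa> p), 1:] * v = smult (- (of_nat (m ! p) * coeff (\<tau> p) 1 + of_nat (m ! q) * coeff (\<tau> q) 1))
        (root_prod m (\<lambda>i. coeff (\<tau> i) 0))"
      by (rule first_order_root_prod_two[OF P(1,2) \<open>p \<noteq> q\<close> P(3,4) Z])
    then show ?thesis using \<open>p \<noteq> q\<close> unfolding A_def \<tau>0 by (intro exI[of _ v]) (simp add: u_def)
  qed
  have A0: "A \<noteq> 0" by (simp add: A_def)
  obtain v0 where v0: "first_order (root_prod l \<tau>) (root_prod l (\<lambda>i. a (\<kappa> i))) v0" "A * v0 = 0"
    using two[of l] by (auto simp: mult.commute)
  then have "v0 = 0" using A0 by simp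
  define m where "m = map (\<lambda>n. n - 1) l"
  obtain v where v: "first_order (root_prod m \<tau>) (reduced \<kappa>) v"
      "A * v = smult (- (of_nat (m ! p) * of_nat (l ! q) - of_nat (m ! q) * of_nat (l ! p))) (reduced \<kappa>)"
    using two[of m] by (auto simp: m_def)
  have "l ! p \<ge> 1" "l ! q \<ge> 1" using l(1) pq by (metis One_nat_def Suc_leI not_gr_zero nth_mem)+
  then have c: "- (of_nat (m ! p) * of_nat (l ! q) - of_nat (m ! q) * of_nat (l ! p)) = (of_nat (l ! q) - of_nat (l ! p) :: 'a)"
    using pq by (simp add: m_def of_nat_diff algebra_simps)
  have R0: "reduced \<kappa> \<noteq> 0" using root_prod_monic monics_nonzero by blast
  have "(of_nat (l ! q) - of_nat (l ! p) :: 'a) \<noteq> 0" using ne by simp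
  then have "A * v \<noteq> 0" unfolding v(2) c using R0 by simp
  then have "v \<noteq> 0" by auto
  have "degree (reduced \<kappa>) = degree (A * v)"
    unfolding v(2) c using \<open>(of_nat (l ! q) - of_nat (l ! p) :: 'a) \<noteq> 0\<close> by simp
  also have "\<dots> = 1 + degree v" using A0 \<open>v \<noteq> 0\<close> by (subst degree_mult_eq) (auto simp: A_def)
  finally have "degree v < degree (reduced \<kappa>)" by simp
  moreover have "tangent v"
    using tangent_of_curve(2)[OF \<kappa> _ _ v(1)[unfolded m_def], of u 0] v0(1) \<open>v0 = 0\<close> l(2) by (simp add: \<tau>_def)
  ultimately have "v = 0" using tangent_small_zero[OF \<kappa>] by blast
  with \<open>v \<noteq> 0\<close> show False ..
qed

text \<open>The multiplicity of $a_k$ in the reduced product is $\mu_k$ minus the number of parts in the $k$-th block.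
  Since the reduced product does not depend on the assignment, the number of parts does not either, and
  it determines a block of equal parts with sum $\mu_k$.\<close>
lemma unique_even_splitting:
  assumes inj: "inj_on a {..<length mu}" and ne: "assignments l mu \<noteq> {}"
  shows "\<exists>\<delta>. splittings mu (mset l) = {\<delta>} \<and> (\<forall>k<length mu. even_partition (\<delta> ! k))"
proof -
  define B where "B = (\<lambda>(\<kappa> :: nat \<Rightarrow> nat) k. {i. i < length l \<and> \<kappa> i = k})"
  have fB: "finite (B \<kappa> k)" for \<kappa> k by (simp add: B_def)
  have l1: "l ! i \<ge> 1" if "i \<in> B \<kappa> k" for \<kappa> k i
    using l(1) that unfolding B_def by (metis (no_types, lifting) One_nat_def Suc_leI mem_Collect_eq not_gr_zero nth_mem)
  have sum: "(\<Sum>i\<in>B \<kappa> k. l ! i) = mu ! k" if "\<kappa> \<in> assignments l mu" "k < length mu" for \<kappa> k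
    using that by (auto simp: assignments_def B_def)
  have ord: "order (a k) (reduced \<kappa>) + card (B \<kappa> k) = mu ! k" if "\<kappa> \<in> assignments l mu" "k < length mu" for \<kappa> k
  proof -
    have img: "\<kappa> ` {..<length (map (\<lambda>n. n - 1) l)} \<subseteq> {..<length mu}" using that by (auto simp: assignments_def)
    have "reduced \<kappa> = (\<Prod>k<length mu. [:- a k, 1:] ^ (\<Sum>i\<in>B \<kappa> k. l ! i - 1))"
      unfolding root_prod_assignment[OF img, of a]
      by (intro prod.cong refl arg_cong[of _ _ "\<lambda>n. _ ^ n"] sum.cong) (auto simp: B_def)
    then have "order (a k) (reduced \<kappa>) = (\<Sum>i\<in>B \<kappa> k. l ! i - 1)"
      using order_prod_linear[OF inj, of k] that by simp
    moreover have "(\<Sum>i\<in>B \<kappa> k. l ! i - 1) + card (B \<kappa> k) = (\<Sum>i\<in>B \<kappa> k. (l ! i - 1) + 1)"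
      by (simp only: sum.distrib card_eq_sum)
    moreover have "(\<Sum>i\<in>B \<kappa> k. (l ! i - 1) + 1) = (\<Sum>i\<in>B \<kappa> k. l ! i)"
    proof (intro sum.cong refl)
      show "(l ! i - 1) + 1 = l ! i" if "i \<in> B \<kappa> k" for i using l1[OF that] by simp
    qed
    ultimately show ?thesis using sum[OF that] by simp
  qed
  have rep: "\<exists>r. split_of l (length mu) \<kappa> ! k = replicate_mset (card (B \<kappa> k)) r \<and> card (B \<kappa> k) * r = mu ! k"
    if \<kappa>: "\<kappa> \<in> assignments l mu" and k: "k < length mu" for \<kappa> k
  proof -
    have "\<exists>r. \<forall>i\<in>B \<kappa> k. l ! i = r"
    proof (cases "B \<kappa> k = {}")
      case False
      then obtain i0 where "i0 \<in> B \<kappa> k" by blast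
      then have "l ! i = l ! i0" if "i \<in> B \<kappa> k" for i
        using that by (intro blocks_constant[OF \<kappa>]) (auto simp: B_def)
      then show ?thesis by blast
    qed simp
    then obtain r where r: "\<And>i. i \<in> B \<kappa> k \<Longrightarrow> l ! i = r" by blast
    have "split_of l (length mu) \<kappa> ! k = image_mset ((!) l) (mset_set (B \<kappa> k))" using k by (simp add: split_of_def B_def)
    also have "\<dots> = image_mset (\<lambda>_. r) (mset_set (B \<kappa> k))" using r fB by (intro image_mset_cong) auto
    also have "\<dots> = replicate_mset (card (B \<kappa> k)) r" by (simp add: image_mset_const_eq)
    finally show ?thesis using sum[OF \<kappa> k] r by (intro exI[of _ r]) simp
  qed
  obtain \<kappa>0 where \<kappa>0: "\<kappa>0 \<in> assignments l mu" using ne by blast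
  have "split_of l (length mu) \<kappa> = split_of l (length mu) \<kappa>0" if \<kappa>: "\<kappa> \<in> assignments l mu" for \<kappa>
  proof (rule nth_equalityI)
    fix k assume "k < length (split_of l (length mu) \<kappa>)"
    then have k: "k < length mu" by (simp add: split_of_def)
    have card: "card (B \<kappa> k) = card (B \<kappa>0 k)"
      using ord[OF \<kappa> k] ord[OF \<kappa>0 k] reduced_unique[OF \<kappa> \<kappa>0] by simp
    obtain r where r: "split_of l (length mu) \<kappa> ! k = replicate_mset (card (B \<kappa> k)) r" "card (B \<kappa> k) * r = mu ! k"
      using rep[OF \<kappa> k] by blast
    obtain r0 where r0: "split_of l (length mu) \<kappa>0 ! k = replicate_mset (card (B \<kappa>0 k)) r0" "card (B \<kappa>0 k) * r0 = mu ! k"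
      using rep[OF \<kappa>0 k] by blast
    show "split_of l (length mu) \<kappa> ! k = split_of l (length mu) \<kappa>0 ! k"
    proof (cases "card (B \<kappa>0 k) = 0")
      case False
      have "card (B \<kappa>0 k) * r = card (B \<kappa>0 k) * r0" using r(2) r0(2) card by simp
      then show ?thesis using r(1) r0(1) card False by simp
    qed (use r r0 card in simp)
  qed (simp add: split_of_def)
  then have "splittings mu (mset l) = {split_of l (length mu) \<kappa>0}"
    unfolding splittings_eq[OF l(1)] using \<kappa>0 by blast
  moreover have "even_partition (split_of l (length mu) \<kappa>0 ! k)" if "k < length mu" for k
    using rep[OF \<kappa>0 that] by (auto simp: even_partition_def split: if_splits)
  ultimately show ?thesis by blast
qed

end

section \<open>Homogeneous polynomials\<close>

definition monoev :: "(nat \<Rightarrow> 'a::comm_ring_1) \<Rightarrow> (nat \<Rightarrow>\<^sub>0 nat) \<Rightarrow> 'a" where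
  "monoev a m = (\<Prod>i\<in>Poly_Mapping.keys m. a i ^ Poly_Mapping.lookup m i)"

definition mdeg :: "(nat \<Rightarrow>\<^sub>0 nat) \<Rightarrow> nat" where
  "mdeg m = (\<Sum>i\<in>Poly_Mapping.keys m. Poly_Mapping.lookup m i)"

lemma monoev_superset:
  assumes "finite S" "Poly_Mapping.keys m \<subseteq> S"
  shows "monoev a m = (\<Prod>i\<in>S. a i ^ Poly_Mapping.lookup m i)"
  unfolding monoev_def using assms by (intro prod.mono_neutral_left) (auto simp: in_keys_iff)

lemma mdeg_superset:
  assumes "finite S" "Poly_Mapping.keys m \<subseteq> S"
  shows "mdeg m = (\<Sum>i\<in>S. Poly_Mapping.lookup m i)"
  unfolding mdeg_def using assms by (intro sum.mono_neutral_left) (auto simp: in_keys_iff)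

lemma monoev_add: "monoev a (m + n) = monoev a m * monoev a n"
  and mdeg_add: "mdeg (m + n) = mdeg m + mdeg n"
proof -
  define S where "S = Poly_Mapping.keys m \<union> Poly_Mapping.keys n"
  have S: "finite S" "Poly_Mapping.keys m \<subseteq> S" "Poly_Mapping.keys n \<subseteq> S" "Poly_Mapping.keys (m + n) \<subseteq> S"
    using keys_add[of m n] by (auto simp: S_def)
  show "monoev a (m + n) = monoev a m * monoev a n"
    using S by (simp add: monoev_superset[of S] lookup_add power_add prod.distrib)
  show "mdeg (m + n) = mdeg m + mdeg n"
    using S by (simp add: mdeg_superset[of S] lookup_add sum.distrib)
qed

lemma mpoly_eval_superset:
  assumes "finite S" "Poly_Mapping.keys p \<subseteq> S"
  shows "mpoly_eval a p = (\<Sum>m\<in>S. Poly_Mapping.lookup p m * monoev a m)"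
  unfolding mpoly_eval_def monoev_def[symmetric] using assms
  by (intro sum.mono_neutral_left) (auto simp: in_keys_iff)

lemma mpoly_eval_add: "mpoly_eval a (p + q) = mpoly_eval a p + mpoly_eval a q"
proof -
  define S where "S = Poly_Mapping.keys p \<union> Poly_Mapping.keys q"
  have S: "finite S" "Poly_Mapping.keys p \<subseteq> S" "Poly_Mapping.keys q \<subseteq> S" "Poly_Mapping.keys (p + q) \<subseteq> S"
    using keys_add[of p q] by (auto simp: S_def)
  then show ?thesis by (simp add: mpoly_eval_superset[of S] lookup_add distrib_right sum.distrib)
qed

lemma mpoly_eval_diff: "mpoly_eval a (p - q) = mpoly_eval a p - mpoly_eval a q"
  using mpoly_eval_add[of a "p - q" q] by simp

lemma mpoly_eval_0 [simp]: "mpoly_eval a 0 = 0"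
  by (simp add: mpoly_eval_def)

lemma mpoly_eval_single: "mpoly_eval a (Poly_Mapping.single m v) = v * monoev a m"
  by (subst mpoly_eval_superset[of "{m}"]) auto

lemma mpoly_induct:
  assumes "P 0" "\<And>m v p. P p \<Longrightarrow> P (Poly_Mapping.single m v + p)"
  shows "P (p :: 'a::comm_monoid_add mpoly)"
proof (induction p rule: update_induct)
  case (update p m v)
  have "Poly_Mapping.update m v p = Poly_Mapping.single m v + p"
    using update(1) by (intro poly_mapping_eqI) (auto simp: lookup_update lookup_add lookup_single in_keys_iff)
  then show ?case using assms(2)[OF update(3)] by simp
qed (rule assms(1))

lemma mpoly_eval_mult: "mpoly_eval a (p * q) = mpoly_eval a p * mpoly_eval a q"
proof (induction p rule: mpoly_induct)
  case (2 m v p)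
  have "mpoly_eval a (Poly_Mapping.single m v * q) = v * monoev a m * mpoly_eval a q"
  proof (induction q rule: mpoly_induct)
    case (2 n w q)
    then show ?case
      by (simp add: distrib_left mpoly_eval_add mult_single mpoly_eval_single monoev_add algebra_simps)
  qed simp
  with 2 show ?case by (simp add: distrib_right mpoly_eval_add mpoly_eval_single)
qed simp

lemma mpoly_eval_1 [simp]: "mpoly_eval a 1 = 1"
  using mpoly_eval_single[of a 0 1] by (simp add: monoev_def flip: single_one)

lemma hom_polys_iff:
  "p \<in> hom_polys d n \<longleftrightarrow> (\<forall>m\<in>Poly_Mapping.keys p. Poly_Mapping.keys m \<subseteq> {0..d} \<and> mdeg m = n)"
  by (simp add: hom_polys_def mdeg_def)

lemma hom_polys_0 [simp]: "0 \<in> hom_polys d n"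
  by (simp add: hom_polys_iff)

lemma hom_polys_add: "p \<in> hom_polys d n \<Longrightarrow> q \<in> hom_polys d n \<Longrightarrow> p + q \<in> hom_polys d n"
  unfolding hom_polys_iff using keys_add[of p q] by blast

lemma hom_polys_diff: "p \<in> hom_polys d n \<Longrightarrow> q \<in> hom_polys d n \<Longrightarrow> p - q \<in> hom_polys d n"
  unfolding hom_polys_iff using keys_diff[of p q] by blast

lemma hom_polys_mult:
  assumes "p \<in> hom_polys d n" "q \<in> hom_polys d k" shows "p * q \<in> hom_polys d (n + k)"
  unfolding hom_polys_iff
proof
  fix m assume "m \<in> Poly_Mapping.keys (p * q)"
  then obtain m1 m2 where m: "m = m1 + m2" "m1 \<in> Poly_Mapping.keys p" "m2 \<in> Poly_Mapping.keys q"
    using keys_mult[of p q] by blast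
  then show "Poly_Mapping.keys m \<subseteq> {0..d} \<and> mdeg m = n + k"
    using assms keys_add[of m1 m2] by (fastforce simp: hom_polys_iff mdeg_add)
qed

lemma hom_polys_const: "Poly_Mapping.single 0 v \<in> hom_polys d 0"
  by (simp add: hom_polys_iff mdeg_def)

lemma hom_polys_sum: "(\<And>i. i \<in> I \<Longrightarrow> p i \<in> hom_polys d n) \<Longrightarrow> sum p I \<in> hom_polys d n"
  by (induction I rule: infinite_finite_induct) (auto intro: hom_polys_add)

definition linform :: "nat \<Rightarrow> (nat \<Rightarrow> 'a::field) \<Rightarrow> 'a mpoly" where
  "linform d b = (\<Sum>j\<le>d. Poly_Mapping.single (Poly_Mapping.single j 1) (b j))"

lemma linform_hom: "linform d b \<in> hom_polys d 1"
  unfolding linform_def by (intro hom_polys_sum) (auto simp: hom_polys_iff mdeg_def)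

lemma linform_eval: "mpoly_eval a (linform d b) = (\<Sum>j\<le>d. b j * a j)"
proof -
  have "mpoly_eval a (sum p I) = (\<Sum>i\<in>I. mpoly_eval a (p i))" for p :: "nat \<Rightarrow> 'a mpoly" and I
    by (induction I rule: infinite_finite_induct) (auto simp: mpoly_eval_add)
  then show ?thesis by (simp add: linform_def mpoly_eval_single monoev_def)
qed

lemma mpoly_eval_scale:
  assumes "p \<in> hom_polys d n" shows "mpoly_eval (\<lambda>i. c * a i) p = c ^ n * mpoly_eval a p"
proof -
  have "monoev (\<lambda>i. c * a i) m = c ^ mdeg m * monoev a m" for m
    by (simp add: monoev_def mdeg_def power_mult_distrib prod.distrib power_sum)
  then have "Poly_Mapping.lookup p m * monoev (\<lambda>i. c * a i) m = c ^ n * (Poly_Mapping.lookup p m * monoev a m)"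
    if "m \<in> Poly_Mapping.keys p" for m
    using assms that by (auto simp: hom_polys_iff)
  then show ?thesis
    unfolding mpoly_eval_def monoev_def[symmetric] sum_distrib_left by (intro sum.cong) auto
qed

lemma zero_at_class:
  assumes "p \<in> hom_polys d n"
  shows "zero_at d p (prop_rel `` {G}) \<longleftrightarrow> mpoly_eval (coords d G) p = 0"
proof -
  have "mpoly_eval (coords d (smult [:a:] G)) p = a ^ n * mpoly_eval (coords d G) p" for a
    using mpoly_eval_scale[OF assms, of a "coords d G"] by (simp add: coords_smult[abs_def] fun_eq_iff)
  then show ?thesis unfolding zero_at_def prop_class by (auto intro: exI[of _ 1])
qed

section \<open>The local ring as a ring of fractions\<close>

lemma UN_UN_const:
  assumes "(p0, r0) \<in> S" "(p1, r1) \<in> T"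
    and "\<And>p r p' r'. (p, r) \<in> S \<Longrightarrow> (p', r') \<in> T \<Longrightarrow> f p r p' r' = Z"
  shows "(\<Union>(p, r)\<in>S. \<Union>(p', r')\<in>T. f p r p' r') = Z"
proof (rule SUP_eq_const)
  fix pr assume "pr \<in> S"
  then obtain p r where pr: "pr = (p, r)" "(p, r) \<in> S" by (cases pr) auto
  have "(\<Union>(p', r')\<in>T. f p r p' r') = Z"
    by (rule SUP_eq_const) (use assms(2,3) pr(2) in auto)
  then show "(case pr of (p, r) \<Rightarrow> \<Union>(p', r')\<in>T. f p r p' r') = Z" by (simp add: pr(1))
qed (use assms(1) in auto)

locale locus_chart =
  fixes d :: nat and l :: "nat list" and c :: "'a::{alg_closed_field, field_char_0}" and t0 :: "nat \<Rightarrow> 'a"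
  assumes part: "partition_of d (mset l)"
begin

abbreviation "X \<equiv> X_locus d (mset l) :: 'a poly poly set set"
abbreviation "F \<equiv> pt d c (root_prod l t0)"
abbreviation "C \<equiv> coeff_algebra l :: ((nat \<Rightarrow> 'a) \<Rightarrow> 'a) set"

text \<open>Homogeneous polynomials become functions on the space of roots by evaluating them at the
  representatives which are monic in the chart.\<close>
definition pull :: "'a mpoly \<Rightarrow> (nat \<Rightarrow> 'a) \<Rightarrow> 'a" where
  "pull p t = mpoly_eval (coords d (homog c d (root_prod l t))) p"

text \<open>The linear form that takes the value of a form at $(1 : c)$, that is, the equation of the complement
  of the chart.\<close>
definition lead :: "'a mpoly" where
  "lead = linform d (\<lambda>j. coeff ([:0, 1:] ^ (d - j) * [:1, c:] ^ j) d)"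

lemma root_prod_monics: "root_prod l t \<in> monics d"
  using root_prod_monic[of l t] partition_ofD(4)[OF part] by (simp add: sum_mset_sum_list)

lemma pull_simps [simp]:
  "pull (p + q) = pull p + pull q" "pull (p - q) = pull p - pull q" "pull (p * q) = pull p * pull q"
  "pull 0 = 0" "pull 1 = 1"
  by (auto simp: pull_def fun_eq_iff mpoly_eval_add mpoly_eval_diff mpoly_eval_mult)

lemma C_closed:
  "x \<in> C \<Longrightarrow> y \<in> C \<Longrightarrow> x + y \<in> C" "x \<in> C \<Longrightarrow> y \<in> C \<Longrightarrow> x * y \<in> C" "(\<lambda>t. a) \<in> C"
  using coeff_algebra.add[of x l y] coeff_algebra.mult[of x l y] by (auto simp: plus_fun_def times_fun_def)

lemma coeff_form_eval:
  assumes "G \<in> forms d"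
  shows "coeff (dehom c G) j = mpoly_eval (coords d G) (linform d (\<lambda>i. coeff ([:0, 1:] ^ (d - i) * [:1, c:] ^ i) j))"
  unfolding linform_eval dehom_form[OF assms] by (simp add: coeff_sum mult.commute)

lemma pull_lead: "pull lead = 1"
proof
  fix t
  have "pull lead t = coeff (dehom c (homog c d (root_prod l t))) d"
    unfolding pull_def lead_def by (rule coeff_form_eval[symmetric]) simp
  also have "\<dots> = 1" using root_prod_monics[of t] by (auto simp: dehom_homog monics_def)
  finally show "pull lead t = 1 t" by simp
qed

lemma pull_power_lead: "pull (p * lead ^ n) = pull p"
  by (induction n) (simp_all add: pull_lead mult.left_commute)

lemma lead_power_hom: "lead ^ n \<in> hom_polys d n"
proof (induction n)
  case 0
  show ?case using hom_polys_const[of 1 d] by (simp add: single_one)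
next
  case (Suc n)
  then show ?case using hom_polys_mult[OF linform_hom Suc] by (simp add: lead_def)
qed

lemma pull_in_C: "pull p \<in> C"
proof -
  have coord: "(\<lambda>t. coords d (homog c d (root_prod l t)) j) \<in> C" for j
    unfolding coords_homog
    by (intro fun_algebra_sum[OF fun_algebra_coeff_algebra] coeff_algebra.mult coeff_algebra.coeff coeff_algebra.const)
  have pow: "(\<lambda>t. x t ^ n) \<in> C" if "x \<in> C" for x n using that by (induction n) auto
  have pr: "(\<lambda>t. \<Prod>i\<in>I. f i t) \<in> C" if "\<And>i. f i \<in> C" for I :: "nat set" and f
    by (induction I rule: infinite_finite_induct) (auto intro: that)
  show ?thesis unfolding pull_def[abs_def] mpoly_eval_def
    by (intro fun_algebra_sum[OF fun_algebra_coeff_algebra] coeff_algebra.mult coeff_algebra.const pr pow coord)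
qed

text \<open>Multiplication by \<open>lead\<close> adjusts degrees without changing the function.\<close>
lemma exists_pull: "x \<in> C \<Longrightarrow> \<exists>n. \<exists>p\<in>hom_polys d n. pull p = x"
proof (induction rule: coeff_algebra.induct)
  case (const a)
  have "pull (Poly_Mapping.single 0 a) = (\<lambda>t. a)"
    by (simp add: pull_def fun_eq_iff mpoly_eval_single monoev_def)
  then show ?case using hom_polys_const by blast
next
  case (coeff j)
  have "degree (root_prod l t) \<le> d" for t :: "nat \<Rightarrow> 'a" using root_prod_monics[of t] by (simp add: monics_def)
  then have "pull (linform d (\<lambda>i. coeff ([:0, 1:] ^ (d - i) * [:1, c:] ^ i) j)) = (\<lambda>t. coeff (root_prod l t) j)"
    by (simp add: pull_def fun_eq_iff dehom_homog flip: coeff_form_eval)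
  then show ?case using linform_hom by blast
next
  case (add x y)
  then obtain n p k q where *: "p \<in> hom_polys d n" "pull p = x" "q \<in> hom_polys d k" "pull q = y" by blast
  have "p * lead ^ k + q * lead ^ n \<in> hom_polys d (n + k)"
    using hom_polys_mult[OF *(1) lead_power_hom[of k]] hom_polys_mult[OF *(3) lead_power_hom[of n]]
    by (intro hom_polys_add) (simp_all add: add.commute)
  moreover have "pull (p * lead ^ k + q * lead ^ n) = (\<lambda>t. x t + y t)"
    by (simp only: pull_simps(1) pull_power_lead *(2,4) plus_fun_def)
  ultimately show ?case by blast
next
  case (mult x y)
  then obtain n p k q where *: "p \<in> hom_polys d n" "pull p = x" "q \<in> hom_polys d k" "pull q = y" by blast
  have "pull (p * q) = (\<lambda>t. x t * y t)" by (simp add: * times_fun_def)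
  then show ?case using hom_polys_mult[OF *(1,3)] by blast
qed

lemma C_pfun: "x \<in> C \<Longrightarrow> x \<in> pfun (length l)"
  using coeff_algebra_pfun by blast

lemma C_no_zero_divisors: assumes "x \<in> C" "y \<in> C" "x * y = 0" shows "x = 0 \<or> y = 0"
proof -
  have "(\<forall>t\<in>UNIV. x t = 0) \<or> (\<forall>t\<in>UNIV. y t = 0)"
    using assms(3) by (intro pfun_domain[OF C_pfun[OF assms(1)] C_pfun[OF assms(2)]]) (auto simp: fun_eq_iff)
  then show ?thesis by (auto simp: fun_eq_iff)
qed

lemma zero_at_pt: "p \<in> hom_polys d n \<Longrightarrow> zero_at d p (pt d c (root_prod l t)) \<longleftrightarrow> pull p t = 0"
  unfolding pt_def pull_def by (rule zero_at_class)

text \<open>The chart is dense in the locus: multiplication by the linear form \<open>lead\<close> removes the points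
  outside of it, and germs of functions agree as soon as the functions agree on the parameter space.\<close>
lemma zero_near_iff:
  assumes p: "p \<in> hom_polys d m"
  shows "(\<exists>n s. s \<in> hom_polys d n \<and> \<not> zero_at d s F \<and> (\<forall>P\<in>X. zero_at d (s * p) P)) \<longleftrightarrow> pull p = 0"
proof
  assume "\<exists>n s. s \<in> hom_polys d n \<and> \<not> zero_at d s F \<and> (\<forall>P\<in>X. zero_at d (s * p) P)"
  then obtain n s where s: "s \<in> hom_polys d n" "pull s t0 \<noteq> 0" "\<And>P. P \<in> X \<Longrightarrow> zero_at d (s * p) P"
    using zero_at_pt by blast
  have "pull (s * p) t = 0" for t
  proof -
    have "pt d c (root_prod l t) \<in> X" using X_locus_chart[OF part root_prod_monics] by blast
    then show ?thesis using s(3) zero_at_pt[OF hom_polys_mult[OF s(1) p]] by blast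
  qed
  then have "pull s * pull p = 0" by (simp add: fun_eq_iff)
  then show "pull p = 0" using C_no_zero_divisors[OF pull_in_C pull_in_C] s(2) by fastforce
next
  assume 0: "pull p = 0"
  have lh: "lead \<in> hom_polys d 1" unfolding lead_def by (rule linform_hom)
  have "zero_at d (lead * p) P" if P: "P \<in> X" for P
  proof -
    obtain G where G: "G \<in> forms d" "P = prop_rel `` {G}" using X_locus_proj[OF part P] by (auto simp: proj_forms_iff)
    show ?thesis
    proof (cases "coeff (dehom c G) d = 0")
      case True
      then have "mpoly_eval (coords d G) (lead * p) = 0"
        by (simp add: mpoly_eval_mult lead_def coeff_form_eval[OF G(1)])
      then show ?thesis using zero_at_class[OF hom_polys_mult[OF lh p]] G(2) by blast
    next
      case False
      then obtain f where f: "f \<in> monics d" "P = pt d c f" using chart_point[OF G(1)] G(2) by blast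
      then obtain t where "f = root_prod l t" using X_locus_chart[OF part f(1)] P by blast
      moreover have "pull (lead * p) t = 0" by (simp add: 0)
      ultimately show ?thesis using zero_at_pt[OF hom_polys_mult[OF lh p]] f(2) by blast
    qed
  qed
  moreover have "\<not> zero_at d lead F" using zero_at_pt[OF lh] by (simp add: pull_lead)
  ultimately show "\<exists>n s. s \<in> hom_polys d n \<and> \<not> zero_at d s F \<and> (\<forall>P\<in>X. zero_at d (s * p) P)" using lh by blast
qed

lemma fracs_at_iff:
  "(p, q) \<in> fracs_at d F \<longleftrightarrow> (\<exists>n. p \<in> hom_polys d n \<and> q \<in> hom_polys d n) \<and> pull q t0 \<noteq> 0"
  unfolding fracs_at_def using zero_at_pt by auto

lemma germ_rel_iff:
  "((p, q), (p', q')) \<in> germ_rel d X F \<longleftrightarrow>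
     (p, q) \<in> fracs_at d F \<and> (p', q') \<in> fracs_at d F \<and> pull p * pull q' = pull p' * pull q"
proof (cases "(p, q) \<in> fracs_at d F \<and> (p', q') \<in> fracs_at d F")
  case True
  then obtain n k where "p \<in> hom_polys d n" "q \<in> hom_polys d n" "p' \<in> hom_polys d k" "q' \<in> hom_polys d k"
    by (auto simp: fracs_at_iff)
  then have "p * q' - p' * q \<in> hom_polys d (n + k)"
    using hom_polys_mult[of p d n q' k] hom_polys_mult[of p' d k q n] by (intro hom_polys_diff) (simp_all add: add.commute)
  from zero_near_iff[OF this] True show ?thesis by (auto simp: germ_rel_def)
qed (auto simp: germ_rel_def)

text \<open>All pairs that represent the germ $x/q$.\<close>
definition fraction :: "((nat \<Rightarrow> 'a) \<Rightarrow> 'a) \<Rightarrow> ((nat \<Rightarrow> 'a) \<Rightarrow> 'a) \<Rightarrow> ('a mpoly \<times> 'a mpoly) set" where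
  "fraction x q = {(p, r) \<in> fracs_at d F. pull p * q = x * pull r}"

lemma germ_class: "(p, q) \<in> fracs_at d F \<Longrightarrow> germ_rel d X F `` {(p, q)} = fraction (pull p) (pull q)"
  by (auto simp: fraction_def germ_rel_iff)

lemma exists_frac:
  assumes "x \<in> C" "q \<in> C" "q t0 \<noteq> 0"
  obtains p r where "(p, r) \<in> fracs_at d F" "pull p = x" "pull r = q"
proof -
  obtain n p k r where *: "p \<in> hom_polys d n" "pull p = x" "r \<in> hom_polys d k" "pull r = q"
    using exists_pull assms by metis
  have "(p * lead ^ k, r * lead ^ n) \<in> fracs_at d F"
    unfolding fracs_at_iff pull_power_lead *(4)
    using hom_polys_mult[OF *(1) lead_power_hom[of k]] hom_polys_mult[OF *(3) lead_power_hom[of n]] assms(3)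
    by (auto simp: add.commute)
  then show ?thesis using that pull_power_lead * by metis
qed

lemma mult_cancel_C: "x \<in> C \<Longrightarrow> y \<in> C \<Longrightarrow> q \<in> C \<Longrightarrow> q \<noteq> 0 \<Longrightarrow> q * x = q * y \<Longrightarrow> x = y"
proof -
  assume *: "x \<in> C" "y \<in> C" "q \<in> C" "q \<noteq> 0" "q * x = q * y"
  have "(\<lambda>t. - 1) * y \<in> C" using *(2) C_closed by blast
  then have "x + (\<lambda>t. - 1) * y \<in> C" using *(1) C_closed by blast
  moreover have "x + (\<lambda>t. - 1) * y = x - y" by (simp add: fun_eq_iff)
  ultimately have "q = 0 \<or> x - y = 0" using * by (intro C_no_zero_divisors) (auto simp: right_diff_distrib)
  then show "x = y" using *(4) by simp
qed

lemma fraction_eqI: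
  assumes C: "x \<in> C" "q \<in> C" "x' \<in> C" "q' \<in> C" and nz: "q \<noteq> 0" "q' \<noteq> 0" and eq: "x * q' = x' * q"
  shows "fraction x q \<subseteq> fraction x' q'"
proof
  fix pr assume "pr \<in> fraction x q"
  then obtain p r where pr: "pr = (p, r)" "(p, r) \<in> fracs_at d F" "pull p * q = x * pull r"
    by (auto simp: fraction_def)
  have "q * (pull p * q') = (pull p * q) * q'" by (simp add: mult_ac)
  also have "\<dots> = (x * pull r) * q'" by (simp only: pr(3))
  also have "\<dots> = (x * q') * pull r" by (simp add: mult_ac)
  also have "\<dots> = q * (x' * pull r)" unfolding eq by (simp add: mult_ac)
  finally have "pull p * q' = x' * pull r"
    by (rule mult_cancel_C[OF C_closed(2)[OF pull_in_C C(4)] C_closed(2)[OF C(3) pull_in_C] C(2) nz(1)])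
  then show "pr \<in> fraction x' q'" using pr by (simp add: fraction_def)
qed

lemma fraction_eq_iff:
  assumes "x \<in> C" "q \<in> C" "q t0 \<noteq> 0" "x' \<in> C" "q' \<in> C" "q' t0 \<noteq> 0"
  shows "fraction x q = fraction x' q' \<longleftrightarrow> x * q' = x' * q"
proof
  assume eq: "fraction x q = fraction x' q'"
  obtain p r where pr: "(p, r) \<in> fracs_at d F" "pull p = x" "pull r = q" using exists_frac assms by metis
  then have "(p, r) \<in> fraction x q" by (simp add: fraction_def)
  then show "x * q' = x' * q" using pr unfolding eq by (simp add: fraction_def)
next
  assume eq: "x * q' = x' * q"
  have nz: "q \<noteq> 0" "q' \<noteq> 0" using assms by auto
  show "fraction x q = fraction x' q'"
    using fraction_eqI[OF assms(1,2,4,5) nz eq] fraction_eqI[OF assms(4,5,1,2) nz(2,1) eq[symmetric]] by blast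
qed

lemma fracs_at_mult: "(p, q) \<in> fracs_at d F \<Longrightarrow> (p', q') \<in> fracs_at d F \<Longrightarrow> (p * p', q * q') \<in> fracs_at d F"
  unfolding fracs_at_iff using hom_polys_mult by fastforce

lemma fracs_at_add:
  assumes "(p, q) \<in> fracs_at d F" "(p', q') \<in> fracs_at d F"
  shows "(p * q' + p' * q, q * q') \<in> fracs_at d F"
proof -
  obtain n k where *: "p \<in> hom_polys d n" "q \<in> hom_polys d n" "p' \<in> hom_polys d k" "q' \<in> hom_polys d k"
    "pull q t0 \<noteq> 0" "pull q' t0 \<noteq> 0" using assms by (auto simp: fracs_at_iff)
  have "p * q' + p' * q \<in> hom_polys d (n + k)" "q * q' \<in> hom_polys d (n + k)"
    using hom_polys_mult[OF *(1,4)] hom_polys_mult[OF *(3,2)] hom_polys_mult[OF *(2,4)]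
    by (auto intro: hom_polys_add simp: add.commute)
  with * show ?thesis unfolding fracs_at_iff by auto
qed

lemma fraction_pull:
  assumes "(p, r) \<in> fraction x q" shows "(p, r) \<in> fracs_at d F" "pull p * q = x * pull r" "pull r t0 \<noteq> 0"
  using assms by (auto simp: fraction_def fracs_at_iff)

sublocale fraction_ring "local_ring d X F" C "\<lambda>x. x t0" "\<lambda>a _. a" fraction
proof
  show "carrier (local_ring d X F) = {fraction x q |x q. x \<in> C \<and> q \<in> C \<and> q t0 \<noteq> 0}"
  proof (intro subset_antisym subsetI)
    fix z assume "z \<in> carrier (local_ring d X F)"
    then obtain p q where "(p, q) \<in> fracs_at d F" "z = germ_rel d X F `` {(p, q)}"
      by (auto simp: local_ring_def quotient_def)
    then show "z \<in> {fraction x q |x q. x \<in> C \<and> q \<in> C \<and> q t0 \<noteq> 0}"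
      using pull_in_C germ_class fracs_at_iff by blast
  next
    fix z assume "z \<in> {fraction x q |x q. x \<in> C \<and> q \<in> C \<and> q t0 \<noteq> 0}"
    then obtain x q where "z = fraction x q" "x \<in> C" "q \<in> C" "q t0 \<noteq> 0" by blast
    moreover from this obtain p r where "(p, r) \<in> fracs_at d F" "pull p = x" "pull r = q" using exists_frac by metis
    ultimately show "z \<in> carrier (local_ring d X F)" using germ_class[of p r] by (auto simp: local_ring_def quotient_def)
  qed
  fix x q x' q' assume *: "x \<in> C" "q \<in> C" "q t0 \<noteq> 0" "x' \<in> C" "q' \<in> C" "q' t0 \<noteq> 0"
  show "fraction x q = fraction x' q' \<longleftrightarrow> x * q' = x' * q" by (rule fraction_eq_iff[OF *])
  obtain p0 r0 where "(p0, r0) \<in> fracs_at d F" "pull p0 = x" "pull r0 = q" by (rule exists_frac[OF *(1-3)])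
  then have 0: "(p0, r0) \<in> fraction x q" by (simp add: fraction_def)
  obtain p1 r1 where "(p1, r1) \<in> fracs_at d F" "pull p1 = x'" "pull r1 = q'" by (rule exists_frac[OF *(4-6)])
  then have 1: "(p1, r1) \<in> fraction x' q'" by (simp add: fraction_def)
  have m: "germ_rel d X F `` {(p * p', r * r')} = fraction (x * x') (q * q')"
    if "(p, r) \<in> fraction x q" "(p', r') \<in> fraction x' q'" for p r p' r'
  proof -
    note a = fraction_pull[OF that(1)] and b = fraction_pull[OF that(2)]
    have "pull p * pull p' * (q * q') = (pull p * q) * (pull p' * q')" by (simp add: mult_ac)
    also have "\<dots> = x * x' * (pull r * pull r')" unfolding a(2) b(2) by (simp add: mult_ac)
    finally have "fraction (pull p * pull p') (pull r * pull r') = fraction (x * x') (q * q')"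
      using * a(3) b(3) by (subst fraction_eq_iff) (auto intro!: C_closed pull_in_C)
    then show ?thesis using germ_class[OF fracs_at_mult[OF a(1) b(1)]] by simp
  qed
  show "fraction x q \<otimes>\<^bsub>local_ring d X F\<^esub> fraction x' q' = fraction (x * x') (q * q')"
    using UN_UN_const[OF 0 1 m] by (simp add: local_ring_def)
  have s: "germ_rel d X F `` {(p * r' + p' * r, r * r')} = fraction (x * q' + x' * q) (q * q')"
    if "(p, r) \<in> fraction x q" "(p', r') \<in> fraction x' q'" for p r p' r'
  proof -
    note a = fraction_pull[OF that(1)] and b = fraction_pull[OF that(2)]
    have "(pull p * pull r' + pull p' * pull r) * (q * q')
        = (pull p * q) * pull r' * q' + (pull p' * q') * pull r * q" by (simp add: algebra_simps)
    also have "\<dots> = (x * q' + x' * q) * (pull r * pull r')" unfolding a(2) b(2) by (simp add: algebra_simps)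
    finally have "fraction (pull p * pull r' + pull p' * pull r) (pull r * pull r') = fraction (x * q' + x' * q) (q * q')"
      using * a(3) b(3) by (subst fraction_eq_iff) (auto intro!: C_closed pull_in_C)
    then show ?thesis using germ_class[OF fracs_at_add[OF a(1) b(1)]] by simp
  qed
  show "fraction x q \<oplus>\<^bsub>local_ring d X F\<^esub> fraction x' q' = fraction (x * q' + x' * q) (q * q')"
    using UN_UN_const[OF 0 1 s] by (simp add: local_ring_def)
next
  have fr: "(1, 1) \<in> fracs_at d F" "(0, 1) \<in> fracs_at d F"
    using hom_polys_const[of 1 d] by (auto simp: fracs_at_iff single_one intro!: exI[of _ 0])
  show "\<one>\<^bsub>local_ring d X F\<^esub> = fraction 1 1" using germ_class[OF fr(1)] by (simp add: local_ring_def)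
  show "\<zero>\<^bsub>local_ring d X F\<^esub> = fraction 0 1" using germ_class[OF fr(2)] by (simp add: local_ring_def)
  show "x = 0 \<or> y = 0" if "x \<in> C" "y \<in> C" "x * y = 0" for x y
    using that by (rule C_no_zero_divisors)
qed (auto simp: fun_eq_iff intro: C_closed)

end

section \<open>Dimension and regularity of the local ring\<close>

lemma pcompose_as_sum:
  fixes p :: "'a::field_char_0 poly"
  assumes "degree p \<le> n"
  shows "pcompose p q = (\<Sum>i\<le>n. smult (coeff p i) (q ^ i))"
proof (rule poly_ext)
  fix z
  have "poly p y = (\<Sum>i\<le>n. coeff p i * y ^ i)" for y
    unfolding poly_altdef using assms by (intro sum.mono_neutral_left) (auto simp: coeff_eq_0)
  then show "poly (pcompose p q) z = poly (\<Sum>i\<le>n. smult (coeff p i) (q ^ i)) z"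
    by (simp add: poly_pcompose poly_sum)
qed

context locus_chart
begin

abbreviation "A \<equiv> local_ring d X F"

lemma krull_dim_upper: "krull_dim A \<le> enat (length l)"
proof (rule krull_dim_le)
  fix zs :: "((nat \<Rightarrow> 'a) \<Rightarrow> 'a) list"
  assume "set zs \<subseteq> C" "length l < length zs"
  moreover from this have "set zs \<subseteq> pfun (length l)" using C_pfun by blast
  ultimately show "\<exists>N \<kappa>. \<exists>bs\<in>exps N (length zs). peval (\<lambda>a _. a) N zs \<kappa> = 0 \<and> \<kappa> bs \<noteq> 0"
    by (intro pfun_dependent)
qed

definition flag :: "nat \<Rightarrow> (nat \<Rightarrow> 'a) set" where
  "flag j = {t. \<forall>i<j. t i = t0 i}"

text \<open>Functions vanishing on the image of a linear subspace of the space of roots. The images for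
  $j = 0, \dots, e$ decrease from the locus to the point itself.\<close>
definition flag_prime where
  "flag_prime j = {fraction x q | x q. x \<in> C \<and> q \<in> C \<and> q t0 \<noteq> 0 \<and> (\<forall>t\<in>flag j. x t = 0)}"

lemma t0_flag [simp]: "t0 \<in> flag j"
  by (simp add: flag_def)

lemma flag_domain:
  assumes "x \<in> C" "y \<in> C" "\<And>t. t \<in> flag j \<Longrightarrow> x t * y t = 0"
  shows "(\<forall>t\<in>flag j. x t = 0) \<or> (\<forall>t\<in>flag j. y t = 0)"
  by (rule pfun_domain[OF C_pfun[OF assms(1)] C_pfun[OF assms(2)] _ assms(3)]) (auto simp: flag_def)

lemma fraction_in_flag_prime:
  assumes "x \<in> C" "q \<in> C" "q t0 \<noteq> 0"
  shows "fraction x q \<in> flag_prime j \<longleftrightarrow> (\<forall>t\<in>flag j. x t = 0)"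
proof
  assume "fraction x q \<in> flag_prime j"
  then obtain y r where y: "fraction x q = fraction y r" "y \<in> C" "r \<in> C" "r t0 \<noteq> 0" "\<forall>t\<in>flag j. y t = 0"
    unfolding flag_prime_def by blast
  then have "x * r = y * q" using fraction_eq_iff assms by blast
  then have "x t * r t = y t * q t" for t by (auto simp: fun_eq_iff)
  with y(5) have "x t * r t = 0" if "t \<in> flag j" for t using that by simp
  then show "\<forall>t\<in>flag j. x t = 0" using flag_domain[OF assms(1) y(3)] y(4) t0_flag by blast
qed (use assms in \<open>auto simp: flag_prime_def\<close>)

lemma primeideal_flag_prime: "primeideal (flag_prime j) A"
proof (rule primeidealI)
  show "cring A" by (rule cring_fractions)
  show "ideal (flag_prime j) A"
  proof (rule fraction_idealI)
    show "flag_prime j \<subseteq> carrier A" by (auto simp: flag_prime_def)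
    show "\<zero>\<^bsub>A\<^esub> \<in> flag_prime j" by (simp add: frac_zero fraction_in_flag_prime)
    fix z z' assume "z \<in> flag_prime j"
    then obtain x q where x: "z = fraction x q" "x \<in> C" "q \<in> C" "q t0 \<noteq> 0" "\<forall>t\<in>flag j. x t = 0"
      by (auto simp: flag_prime_def)
    {
      assume "z' \<in> flag_prime j"
      then obtain y r where y: "z' = fraction y r" "y \<in> C" "r \<in> C" "r t0 \<noteq> 0" "\<forall>t\<in>flag j. y t = 0"
        by (auto simp: flag_prime_def)
      show "z \<oplus>\<^bsub>A\<^esub> z' \<in> flag_prime j" using x y by (simp add: frac_add fraction_in_flag_prime C_closed)
    }
    {
      assume "z' \<in> carrier A"
      then obtain y r where y: "z' = fraction y r" "y \<in> C" "r \<in> C" "r t0 \<noteq> 0" by (rule frac_cases)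
      show "z' \<otimes>\<^bsub>A\<^esub> z \<in> flag_prime j" using x y by (simp add: frac_mult fraction_in_flag_prime C_closed)
    }
  qed
  have "fraction 1 1 \<notin> flag_prime j"
  proof
    assume "fraction 1 1 \<in> flag_prime j"
    then have "\<forall>t\<in>flag j. (1 :: (nat \<Rightarrow> 'a) \<Rightarrow> 'a) t = 0" by (subst (asm) fraction_in_flag_prime) auto
    from bspec[OF this t0_flag] show False by simp
  qed
  moreover have "fraction 1 1 \<in> carrier A" by simp
  ultimately show "carrier A \<noteq> flag_prime j" by blast
  fix z z' assume "z \<in> carrier A" "z' \<in> carrier A" and zz: "z \<otimes>\<^bsub>A\<^esub> z' \<in> flag_prime j"
  obtain x q where x: "z = fraction x q" "x \<in> C" "q \<in> C" "q t0 \<noteq> 0" using \<open>z \<in> carrier A\<close> by (rule frac_cases)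
  obtain y r where y: "z' = fraction y r" "y \<in> C" "r \<in> C" "r t0 \<noteq> 0" using \<open>z' \<in> carrier A\<close> by (rule frac_cases)
  have "\<forall>t\<in>flag j. x t * y t = 0" using zz x y by (simp add: frac_mult fraction_in_flag_prime C_closed)
  then show "z \<in> flag_prime j \<or> z' \<in> flag_prime j"
    using flag_domain[OF x(2) y(2)] x y by (simp add: fraction_in_flag_prime)
qed

text \<open>If the first $j$ roots are fixed, the multiplicity of $b = t_0(j)$ as a root is generically
  \<open>m\<close>. It jumps when the $j$-th root is fixed too (counting from $0$), and the Taylor coefficient of order
  \<open>m\<close> at $b$ detects this.\<close>
lemma flag_prime_strict:
  assumes j: "j < length l"
  shows "flag_prime j \<subset> flag_prime (Suc j)"
proof
  have "flag (Suc j) \<subseteq> flag j" by (auto simp: flag_def)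
  then show "flag_prime j \<subseteq> flag_prime (Suc j)" unfolding flag_prime_def by blast
  define b where "b = t0 j"
  define m where "m = (\<Sum>i | i < j \<and> t0 i = b. l ! i)"
  define x where "x = (\<lambda>t. coeff (pcompose (root_prod l t) [:b, 1:]) m)"
  have "x \<in> C"
  proof -
    have "degree (root_prod l t) \<le> d" for t :: "nat \<Rightarrow> 'a" using root_prod_monics[of t] by (simp add: monics_def)
    then have "x = (\<lambda>t. \<Sum>i\<le>d. coeff (root_prod l t) i * coeff ([:b, 1:] ^ i) m)"
      unfolding x_def by (simp add: pcompose_as_sum[of _ d] coeff_sum)
    moreover have "\<dots> \<in> C"
      by (intro fun_algebra_sum[OF fun_algebra_coeff_algebra] coeff_algebra.mult coeff_algebra.coeff coeff_algebra.const)
    ultimately show ?thesis by simp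
  qed
  define J where "J = {i. i < j \<and> t0 i = b}"
  have J: "finite J" "J \<subseteq> {..<length l}" "j \<notin> J" using j by (auto simp: J_def)
  have lj: "l ! j \<noteq> 0" using partition_ofD(3)[OF part] j by (metis nth_mem set_mset_mset)
  have val: "x t = (\<Prod>i\<in>{..<length l} - J. (b - t i) ^ (l ! i))" if "t \<in> flag j" for t
  proof -
    have "pcompose (root_prod l t) [:b, 1:] = (\<Prod>i<length l. [:b - t i, 1:] ^ (l ! i))"
      by (rule poly_ext) (simp add: root_prod_def poly_pcompose poly_prod algebra_simps)
    also have "\<dots> = (\<Prod>i\<in>J. [:b - t i, 1:] ^ (l ! i)) * (\<Prod>i\<in>{..<length l} - J. [:b - t i, 1:] ^ (l ! i))"
      using J by (subst prod.subset_diff[of J]) (auto simp: mult.commute)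
    also have "(\<Prod>i\<in>J. [:b - t i, 1:] ^ (l ! i)) = (\<Prod>i\<in>J. [:0, 1:] ^ (l ! i))"
      using that by (intro prod.cong) (auto simp: flag_def J_def)
    also have "\<dots> = monom 1 m" by (simp add: m_def J_def monom_altdef power_sum)
    finally show ?thesis
      unfolding x_def by (simp add: coeff_monom_mult poly_prod flip: poly_0_coeff_0)
  qed
  have "x t = 0" if "t \<in> flag (Suc j)" for t
  proof -
    have "t \<in> flag j" "t j = b" using that by (auto simp: flag_def b_def)
    then show ?thesis unfolding val[OF \<open>t \<in> flag j\<close>] using j J lj by (intro prod_zero) (auto intro!: bexI[of _ j])
  qed
  then have "fraction x 1 \<in> flag_prime (Suc j)" using \<open>x \<in> C\<close> by (simp add: fraction_in_flag_prime)
  moreover have "fraction x 1 \<notin> flag_prime j"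
  proof -
    define t where "t = (\<lambda>i. if i < j then t0 i else b + 1)"
    have t: "t \<in> flag j" by (simp add: flag_def t_def)
    have "(b - t i) ^ (l ! i) \<noteq> 0" if "i \<in> {..<length l} - J" for i using that by (auto simp: t_def J_def)
    then have "x t \<noteq> 0" unfolding val[OF t] by simp
    with t \<open>x \<in> C\<close> show ?thesis by (auto simp: fraction_in_flag_prime)
  qed
  ultimately show "flag_prime j \<noteq> flag_prime (Suc j)" by blast
qed

lemma krull_dim_eq: "krull_dim A = enat (length l)"
proof (rule antisym[OF krull_dim_upper])
  have "length l \<in> {n. \<exists>P. (\<forall>i\<le>n. primeideal (P i) A) \<and> (\<forall>i<n. P i \<subset> P (Suc i))}"
    using primeideal_flag_prime flag_prime_strict by blast
  then show "enat (length l) \<le> krull_dim A" unfolding krull_dim_def by (rule SUP_upper)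
qed

lemma nonsingular_iff:
  "nonsingular_at d X F \<longleftrightarrow> (\<exists>S \<subseteq> carrier A. finite S \<and> genideal A S = max_id \<and> card S = length l)"
proof -
  have "maximalideal (genideal A S) A \<longleftrightarrow> genideal A S = max_id" for S
    using maximalideal_unique maximalideal_max_id by metis
  then show ?thesis unfolding nonsingular_at_def Let_def by (simp add: krull_dim_eq)
qed

text \<open>The tangent space has at most as many dimensions as the maximal ideal has generators: a combination of
  the derivations which vanishes on the generators is zero.\<close>
lemma derivations_dependent:
  assumes S: "S \<subseteq> carrier A" "finite S" "genideal A S = max_id" "card S \<le> e"
    and \<chi>s: "\<And>i. i \<le> e \<Longrightarrow> derivation_at t0 C (\<chi>s i)"
  shows "\<exists>\<beta>. (\<exists>i\<le>e. \<beta> i \<noteq> 0) \<and> (\<forall>x\<in>C. (\<Sum>i\<le>e. \<beta> i * \<chi>s i x) = 0)"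
proof -
  interpret cring A by (rule cring_fractions)
  have "S \<subseteq> max_id" using genideal_self[OF S(1)] S(3) by simp
  then have "\<exists>x q. s = fraction x q \<and> x \<in> C \<and> q \<in> C \<and> q t0 \<noteq> 0 \<and> x t0 = 0" if "s \<in> S" for s
    using that unfolding max_id_def by blast
  then obtain x q where xq: "\<And>s. s \<in> S \<Longrightarrow> s = fraction (x s) (q s) \<and> x s \<in> C \<and> q s \<in> C \<and> q s t0 \<noteq> 0 \<and> x s t0 = 0"
    by metis
  obtain \<beta> where \<beta>: "\<exists>i\<in>{..e}. \<beta> i \<noteq> 0" "\<forall>s\<in>S. (\<Sum>i\<in>{..e}. \<chi>s i (x s) * \<beta> i) = 0"
    using more_unknowns_than_equations[OF S(2), of "{..e}" "\<lambda>s i. \<chi>s i (x s)"] S(4) by auto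
  define \<psi> where "\<psi> = (\<lambda>x. \<Sum>i\<le>e. \<beta> i * \<chi>s i x)"
  have "\<psi> y = 0" if "y \<in> C" for y
  proof (rule derivation_zero_on_generators[of \<psi> S])
    show "\<psi> (y + z) = \<psi> y + \<psi> z" if "y \<in> C" "z \<in> C" for y z
      using \<chi>s that by (simp add: \<psi>_def derivation_at_def plus_fun_def distrib_left sum.distrib)
    show "\<psi> (y * z) = y t0 * \<psi> z + z t0 * \<psi> y" if "y \<in> C" "z \<in> C" for y z
      using \<chi>s that
      by (simp add: \<psi>_def derivation_at_def times_fun_def distrib_left sum.distrib sum_distrib_left mult_ac)
    show "\<psi> (\<lambda>_. a) = 0" for a using \<chi>s by (simp add: \<psi>_def derivation_at_def)
    show "max_id = genideal A S" using S(3) by simp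
    show "\<exists>y r. s = fraction y r \<and> y \<in> C \<and> r \<in> C \<and> r t0 \<noteq> 0 \<and> y t0 = 0 \<and> \<psi> y = 0" if "s \<in> S" for s
      using xq[OF that] \<beta>(2) that by (intro exI[of _ "x s"] exI[of _ "q s"]) (simp add: \<psi>_def mult.commute)
  qed (rule that)
  with \<beta>(1) show ?thesis by (auto simp: \<psi>_def)
qed

lemma unique_even_splitting_if_nonsingular:
  assumes "nonsingular_at d X F" "d \<ge> 1" "root_prod l t0 = root_prod mu a" "inj_on a {..<length mu}"
  shows "\<exists>\<delta>. splittings mu (mset l) = {\<delta>} \<and> (\<forall>k<length mu. even_partition (\<delta> ! k))"
proof -
  obtain S where S: "S \<subseteq> carrier A" "finite S" "genideal A S = max_id" "card S = length l"
    using assms(1) unfolding nonsingular_iff by blast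
  have l: "0 \<notin> set l" using partition_ofD(3)[OF part] by simp
  have "l \<noteq> []" using partition_ofD(4)[OF part] assms(2) by auto
  obtain \<kappa> where "\<kappa> \<in> assignments l mu" using assignment_of_root_prod[OF assms(3) l assms(4)] by blast
  then show ?thesis
    using derivations_dependent[OF S(1-3)] S(4)
    by (intro unique_even_splitting[OF l \<open>l \<noteq> []\<close> assms(3) _ assms(4)]) auto
qed

end

section \<open>Power sums and idempotents\<close>

text \<open>For $R = \prod_i (1 - t_i X)^{m_i}$, $D = \sum_i m_i$ and $P = \sum_i m_i / (1 - t_i X)$ logarithmic differentiation gives
  $X R' / R = D - P$. Both sides are additive in products, and comparison of coefficients gives Newton's
  identities for weighted power sums.\<close>
definition newton_fps :: "'a::field_char_0 fps \<Rightarrow> 'a fps \<Rightarrow> 'a \<Rightarrow> bool" where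
  "newton_fps R P D \<longleftrightarrow> fps_X * fps_deriv R = fps_const D * R - R * P"

lemma newton_fps_mult:
  assumes "newton_fps R P D" "newton_fps R' P' D'" shows "newton_fps (R * R') (P + P') (D + D')"
proof -
  have "fps_X * fps_deriv (R * R') = (fps_X * fps_deriv R) * R' + R * (fps_X * fps_deriv R')"
    by (simp add: algebra_simps)
  also have "\<dots> = (fps_const D * R - R * P) * R' + R * (fps_const D' * R' - R' * P')"
    using assms by (simp only: newton_fps_def)
  also have "\<dots> = fps_const (D + D') * (R * R') - (R * R') * (P + P')"
    by (simp add: algebra_simps flip: fps_const_add)
  finally show ?thesis unfolding newton_fps_def .
qed

lemma newton_fps_linear: "newton_fps (fps_of_poly [:1, - t:]) (Abs_fps (\<lambda>n. t ^ n)) 1"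
proof -
  define R where "R = fps_of_poly [:1, - t:]"
  have nth: "fps_nth R n = (if n = 0 then 1 else if n = 1 then - t else 0)" for n
    by (auto simp: R_def coeff_pCons split: nat.split)
  have R: "R = 1 - fps_const t * fps_X" by (intro fps_ext) (auto simp: nth)
  have "R * Abs_fps (\<lambda>n. t ^ n) = 1"
  proof (rule fps_ext)
    fix n show "fps_nth (R * Abs_fps (\<lambda>n. t ^ n)) n = fps_nth 1 n"
      unfolding R by (cases n) (auto simp: algebra_simps mult.assoc)
  qed
  then show ?thesis unfolding newton_fps_def R_def[symmetric] by (simp add: R)
qed

lemma newton_fps_power:
  assumes "newton_fps R P D" shows "newton_fps (R ^ n) (of_nat n * P) (of_nat n * D)"
proof (induction n)
  case 0
  show ?case by (simp add: newton_fps_def)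
next
  case (Suc n)
  from newton_fps_mult[OF assms Suc] show ?case by (simp add: algebra_simps)
qed

lemma newton_fps_prod:
  assumes "\<And>i. i \<in> I \<Longrightarrow> newton_fps (R i) (P i) (D i)"
  shows "newton_fps (\<Prod>i\<in>I. R i) (\<Sum>i\<in>I. P i) (\<Sum>i\<in>I. D i)"
  using assms
proof (induction I rule: infinite_finite_induct)
  case (insert i I)
  then show ?case using newton_fps_mult[of "R i" "P i" "D i"] by simp
qed (auto simp: newton_fps_def)

definition power_sum_at :: "nat list \<Rightarrow> nat \<Rightarrow> (nat \<Rightarrow> 'a::field_char_0) \<Rightarrow> 'a" where
  "power_sum_at l N t = (\<Sum>i<length l. of_nat (l ! i) * t i ^ N)"

lemma newton_identity:
  fixes t :: "nat \<Rightarrow> 'a::field_char_0" and l :: "nat list"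
  defines "b \<equiv> \<lambda>j. if j \<le> sum_list l then coeff (root_prod l t) (sum_list l - j) else 0"
  shows "(\<Sum>j\<le>N. b j * power_sum_at l (N - j) t) = (of_nat (sum_list l) - of_nat N) * b N"
proof -
  define R where "R = (\<Prod>i<length l. fps_of_poly [:1, - t i:] ^ (l ! i))"
  define P where "P = (\<Sum>i<length l. of_nat (l ! i) * Abs_fps (\<lambda>n. t i ^ n))"
  have "newton_fps R P (\<Sum>i<length l. of_nat (l ! i) * 1)"
    unfolding R_def P_def by (intro newton_fps_prod newton_fps_power newton_fps_linear)
  moreover have "(\<Sum>i<length l. of_nat (l ! i) * (1::'a)) = of_nat (sum_list l)"
    by (simp add: sum_list_sum_nth atLeast0LessThan)
  ultimately have eq: "fps_X * fps_deriv R = fps_const (of_nat (sum_list l)) * R - R * P"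
    by (simp add: newton_fps_def)
  have refl: "reflect_poly [:- x, 1:] = [:1, - x:]" for x :: 'a
    by (cases "x = 0") (auto simp: reflect_poly_def)
  have "R = fps_of_poly (reflect_poly (root_prod l t))"
    by (simp add: R_def root_prod_def reflect_poly_prod reflect_poly_power refl fps_of_poly_prod fps_of_poly_power)
  moreover have "degree (root_prod l t) = sum_list l" using root_prod_monic[of l t] by (simp add: monics_def)
  ultimately have Rn: "fps_nth R j = b j" for j by (simp add: b_def coeff_reflect_poly not_less)
  have Pn: "fps_nth P m = power_sum_at l m t" for m
    by (simp add: P_def power_sum_at_def fps_sum_nth fps_of_nat[symmetric] del: fps_of_nat)
  have "fps_nth (fps_X * fps_deriv R) N = of_nat N * b N"
    by (cases N) (auto simp: Rn)
  moreover have "fps_nth (fps_const (of_nat (sum_list l)) * R - R * P) N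
      = of_nat (sum_list l) * b N - (\<Sum>j\<le>N. b j * power_sum_at l (N - j) t)"
  proof -
    have "fps_nth (fps_const (of_nat (sum_list l)) * R) N = of_nat (sum_list l) * b N"
      by (simp add: Rn)
    moreover have "fps_nth (R * P) N = (\<Sum>j\<le>N. b j * power_sum_at l (N - j) t)"
      by (simp add: fps_mult_nth Rn Pn atLeast0AtMost)
    ultimately show ?thesis by simp
  qed
  ultimately show ?thesis using eq by (simp add: algebra_simps)
qed

definition comaximal :: "'b::comm_ring_1 \<Rightarrow> 'b \<Rightarrow> bool" where
  "comaximal A B \<longleftrightarrow> (\<exists>u v. u * A + v * B = 1)"

lemma comaximal_sym: "comaximal A B \<Longrightarrow> comaximal B A"
  unfolding comaximal_def by (metis add.commute)

lemma comaximal_mult: assumes "comaximal A B" "comaximal A C" shows "comaximal A (B * C)"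
proof -
  obtain u v u' v' where *: "u * A + v * B = 1" "u' * A + v' * C = 1" using assms by (auto simp: comaximal_def)
  have "(u * A + v * B) * (u' * A + v' * C) = 1" by (simp only: *) simp
  then have "(u * A * u' + u * v' * C + v * B * u') * A + (v * v') * (B * C) = 1" by (simp add: algebra_simps)
  then show ?thesis unfolding comaximal_def by blast
qed

lemma comaximal_power: "comaximal A B \<Longrightarrow> comaximal A (B ^ n)"
proof (induction n)
  case 0
  have "0 * A + 1 * 1 = (1::'a)" by simp
  then show ?case unfolding comaximal_def power_0 by blast
qed (auto intro: comaximal_mult)

lemma comaximal_prod: "(\<And>i. i \<in> I \<Longrightarrow> comaximal A (B i)) \<Longrightarrow> comaximal A (prod B I)"
proof (induction I rule: infinite_finite_induct)
  case (insert i I)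
  then show ?case by (auto intro: comaximal_mult)
qed (use comaximal_power[of A _ 0] in \<open>auto simp: comaximal_def intro: exI[of _ 0] exI[of _ 1]\<close>)

lemma comaximal_linear: assumes "x \<noteq> y" shows "comaximal [:- x, 1:] [:- y, 1:: 'a::field:]"
proof -
  define u where "u = 1 / (y - x)"
  have "[:u:] * [:- x, 1:] + [:- u:] * [:- y, 1:] = [:u * (y - x):]" by (simp add: algebra_simps)
  also have "u * (y - x) = 1" using assms by (simp add: u_def)
  finally have "[:u:] * [:- x, 1:] + [:- u:] * [:- y, 1:] = 1" by (simp add: one_pCons)
  then show ?thesis unfolding comaximal_def by blast
qed

text \<open>Orthogonal idempotents modulo a product of powers of distinct linear factors, from the Chinese
  remainder theorem.\<close>
lemma exists_idempotents:
  fixes a :: "nat \<Rightarrow> 'a::field" and m :: "nat \<Rightarrow> nat"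
  assumes inj: "inj_on a {..<c}"
  defines "f \<equiv> \<Prod>k<c. [:- a k, 1:] ^ m k"
  obtains h where "\<And>k k'. k < c \<Longrightarrow> k' < c \<Longrightarrow> k \<noteq> k' \<Longrightarrow> f dvd h k * h k'"
    "f dvd (\<Sum>k<c. h k) - 1"
    "\<And>k k'. k < c \<Longrightarrow> k' < c \<Longrightarrow> m k' > 0 \<Longrightarrow> poly (h k) (a k') = (if k = k' then 1 else 0)"
proof -
  define L where "L = (\<lambda>k. [:- a k, 1:] ^ m k)"
  define P where "P = (\<lambda>k. \<Prod>j\<in>{..<c} - {k}. L j)"
  have "comaximal (L k) (P k)" if "k < c" for k
  proof -
    have "comaximal (L k) (L j)" if "j \<in> {..<c} - {k}" for j
    proof -
      have "a k \<noteq> a j" using inj that \<open>k < c\<close> by (auto simp: inj_on_def)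
      then have "comaximal [:- a k, 1:] (L j)" unfolding L_def by (intro comaximal_power comaximal_linear)
      from comaximal_power[OF comaximal_sym[OF this], of "m k"] show ?thesis
        unfolding L_def by (rule comaximal_sym)
    qed
    then show ?thesis unfolding P_def by (rule comaximal_prod)
  qed
  then have "\<exists>u v. u * L k + v * P k = 1" if "k < c" for k using that by (simp add: comaximal_def)
  then obtain u v where uv: "\<And>k. k < c \<Longrightarrow> u k * L k + v k * P k = 1" by metis
  define h where "h = (\<lambda>k. v k * P k)"
  have f: "f = L k * P k" if "k < c" for k
    unfolding f_def L_def[symmetric] P_def using that by (intro prod.remove) auto
  have LP: "L k' dvd P k" if "k' < c" "k \<noteq> k'" for k k'
    unfolding P_def using that by (intro dvd_prodI) auto
  show ?thesis
  proof (rule that)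
    show "f dvd h k * h k'" if "k < c" "k' < c" "k \<noteq> k'" for k k'
    proof -
      have "L k' * P k' dvd P k * P k'" using LP[OF that(2,3)] by (intro mult_dvd_mono) auto
      then have "f dvd P k * P k'" using f[OF that(2)] by simp
      then have "f dvd (v k * v k') * (P k * P k')" by (rule dvd_mult)
      then show ?thesis by (simp add: h_def mult_ac)
    qed
    define y where "y = (\<Sum>k<c. h k) - 1"
    have Ly: "L j dvd y" if "j < c" for j
    proof -
      have "y = (\<Sum>k\<in>{..<c} - {j}. h k) + (h j - 1)"
        unfolding y_def using that by (subst sum.remove[of _ j]) auto
      moreover have "h j - 1 = - u j * L j" using uv[OF that] by (simp add: h_def algebra_simps)
      moreover have "L j dvd (\<Sum>k\<in>{..<c} - {j}. h k)"
        unfolding h_def using LP that by (intro dvd_sum dvd_mult) auto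
      ultimately show ?thesis by simp
    qed
    show "f dvd (\<Sum>k<c. h k) - 1"
    proof (cases "y = 0")
      case False
      have "f dvd y" unfolding f_def
        using Ly False unfolding L_def by (intro linear_prod_dvd[OF _ inj]) (auto simp: order_divides)
      then show ?thesis by (simp add: y_def)
    qed (simp add: y_def)
    show "poly (h k) (a k') = (if k = k' then 1 else 0)" if "k < c" "k' < c" "m k' > 0" for k k'
    proof -
      have Lz: "poly (L k') (a k') = 0" using that by (simp add: L_def)
      show ?thesis
      proof (cases "k = k'")
        case True
        have "poly (u k * L k + v k * P k) (a k') = 1" using uv[OF that(1)] by simp
        then show ?thesis using Lz True by (simp add: h_def)
      next
        case False
        with that(2) have "L k' dvd P k" by (rule LP)
        then obtain z where "P k = L k' * z" by (rule dvdE)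
        then show ?thesis using Lz False by (simp add: h_def)
      qed
    qed
  qed
qed

section \<open>Regularity at a point with a unique even splitting\<close>

text \<open>Nakayama's lemma as Gaussian elimination: the system for the unknowns $v_\alpha$ is diagonal at
  the point, so all pivots are units of the local ring.\<close>
lemma (in fraction_ring) nakayama_elimination:
  assumes "finite B" "D0 \<in> C" "ev D0 \<noteq> 0"
    and "\<And>\<alpha>. \<alpha> \<in> B \<Longrightarrow> k \<alpha> \<in> C \<and> (\<forall>\<beta>\<in>B. m \<alpha> \<beta> \<in> C \<and> ev (m \<alpha> \<beta>) = 0) \<and> D0 * v \<alpha> = k \<alpha> + (\<Sum>\<beta>\<in>B. m \<alpha> \<beta> * v \<beta>)"
  shows "\<exists>D\<in>C. ev D \<noteq> 0 \<and> (\<forall>\<alpha>\<in>B. D * v \<alpha> \<in> C)"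
  using assms
proof (induction B arbitrary: D0 k m rule: finite_induct)
  case empty
  then show ?case by blast
next
  case (insert b B)
  have mC: "m \<alpha> \<beta> \<in> C" "ev (m \<alpha> \<beta>) = 0" if "\<alpha> \<in> insert b B" "\<beta> \<in> insert b B" for \<alpha> \<beta>
    using insert.prems(3)[OF that(1)] that(2) by blast+
  have kC: "k \<alpha> \<in> C" and eq: "D0 * v \<alpha> = k \<alpha> + (m \<alpha> b * v b + (\<Sum>\<beta>\<in>B. m \<alpha> \<beta> * v \<beta>))" if "\<alpha> \<in> insert b B" for \<alpha>
    using insert.prems(3)[OF that] insert.hyps by auto
  define D1 where "D1 = D0 - m b b"
  have D1: "D1 \<in> C" "ev D1 \<noteq> 0" using insert.prems(1,2) mC[of b b] by (auto simp: D1_def)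
  have vb: "D1 * v b = k b + (\<Sum>\<beta>\<in>B. m b \<beta> * v \<beta>)" using eq[of b] by (simp add: D1_def algebra_simps)
  have "\<exists>D\<in>C. ev D \<noteq> 0 \<and> (\<forall>\<alpha>\<in>B. D * v \<alpha> \<in> C)"
  proof (rule insert.IH[of "D1 * D0" "\<lambda>\<alpha>. D1 * k \<alpha> + m \<alpha> b * k b" "\<lambda>\<alpha> \<beta>. D1 * m \<alpha> \<beta> + m \<alpha> b * m b \<beta>"])
    show "D1 * D0 \<in> C" "ev (D1 * D0) \<noteq> 0" using D1 insert.prems by auto
    fix \<alpha> assume \<alpha>: "\<alpha> \<in> B"
    have "D1 * D0 * v \<alpha> = D1 * (D0 * v \<alpha>)" by (simp add: mult.assoc)
    also have "\<dots> = D1 * k \<alpha> + m \<alpha> b * (D1 * v b) + D1 * (\<Sum>\<beta>\<in>B. m \<alpha> \<beta> * v \<beta>)"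
      using eq[of \<alpha>] \<alpha> by (simp add: algebra_simps)
    also have "\<dots> = (D1 * k \<alpha> + m \<alpha> b * k b) + (\<Sum>\<beta>\<in>B. (D1 * m \<alpha> \<beta> + m \<alpha> b * m b \<beta>) * v \<beta>)"
      unfolding vb by (simp add: algebra_simps sum_distrib_left sum.distrib)
    finally show "D1 * k \<alpha> + m \<alpha> b * k b \<in> C \<and>
        (\<forall>\<beta>\<in>B. D1 * m \<alpha> \<beta> + m \<alpha> b * m b \<beta> \<in> C \<and> ev (D1 * m \<alpha> \<beta> + m \<alpha> b * m b \<beta>) = 0) \<and>
        D1 * D0 * v \<alpha> = (D1 * k \<alpha> + m \<alpha> b * k b) + (\<Sum>\<beta>\<in>B. (D1 * m \<alpha> \<beta> + m \<alpha> b * m b \<beta>) * v \<beta>)"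
      using \<alpha> D1 kC mC by auto
  qed
  then obtain D where D: "D \<in> C" "ev D \<noteq> 0" "\<And>\<alpha>. \<alpha> \<in> B \<Longrightarrow> D * v \<alpha> \<in> C" by blast
  have "D * D1 * v b = D * k b + (\<Sum>\<beta>\<in>B. m b \<beta> * (D * v \<beta>))"
    using arg_cong[OF vb, of "\<lambda>x. D * x"] by (simp add: algebra_simps sum_distrib_left)
  moreover have "D * k b + (\<Sum>\<beta>\<in>B. m b \<beta> * (D * v \<beta>)) \<in> C"
    using D(3) C_mult[OF D(1) kC[of b]] mC[of b] by (intro C_add C_sum C_mult[of "m b _"]) auto
  ultimately have b: "D * D1 * v b \<in> C" by simp
  have "D * D1 * v \<alpha> \<in> C" if "\<alpha> \<in> B" for \<alpha>
    using C_mult[OF D1(1) D(3)[OF that]] by (simp add: mult_ac)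
  with b D D1 show ?case by (intro bexI[of _ "D * D1"]) auto
qed

lemma pfun_poly: "i < e \<Longrightarrow> (\<lambda>t. poly g (t i)) \<in> pfun e"
  unfolding poly_altdef by (intro pfun_sum pfun.mult pfun.const pfun_power pfun.var)

context locus_chart
begin

abbreviation "e \<equiv> length l"

lemma coeff_root_prod_high: "j \<ge> d \<Longrightarrow> coeff (root_prod l t) j = coeff (root_prod l u) j"
  for t u :: "nat \<Rightarrow> 'a"
  using root_prod_monics[of t] root_prod_monics[of u]
  by (cases "j = d") (auto simp: monics_def coeff_eq_0)

definition cdiff :: "nat \<Rightarrow> (nat \<Rightarrow> 'a) \<Rightarrow> 'a" where
  "cdiff j t = coeff (root_prod l t) j - coeff (root_prod l t0) j"

text \<open>The ideal of the fibre: its zeros are the ways of writing the form as a product of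
  labelled factors.\<close>
definition fibre_ideal :: "((nat \<Rightarrow> 'a) \<Rightarrow> 'a) set" where
  "fibre_ideal = {x. \<exists>b. (\<forall>j<d. b j \<in> pfun e) \<and> (\<forall>t. x t = (\<Sum>j<d. b j t * cdiff j t))}"

lemma fibre_ideal_add:
  assumes "x \<in> fibre_ideal" "y \<in> fibre_ideal" shows "(\<lambda>t. x t + y t) \<in> fibre_ideal"
proof -
  obtain b b' where *: "\<forall>j<d. b j \<in> pfun e" "\<forall>t. x t = (\<Sum>j<d. b j t * cdiff j t)"
    "\<forall>j<d. b' j \<in> pfun e" "\<forall>t. y t = (\<Sum>j<d. b' j t * cdiff j t)"
    using assms unfolding fibre_ideal_def by blast
  have "x t + y t = (\<Sum>j<d. (b j t + b' j t) * cdiff j t)" for t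
    using * by (simp add: distrib_right sum.distrib)
  then show ?thesis unfolding fibre_ideal_def using * by (intro CollectI exI[of _ "\<lambda>j t. b j t + b' j t"]) auto
qed

lemma fibre_ideal_mult:
  assumes "p \<in> pfun e" "x \<in> fibre_ideal" shows "(\<lambda>t. p t * x t) \<in> fibre_ideal"
proof -
  obtain b where *: "\<forall>j<d. b j \<in> pfun e" "\<forall>t. x t = (\<Sum>j<d. b j t * cdiff j t)"
    using assms unfolding fibre_ideal_def by blast
  have "p t * x t = (\<Sum>j<d. (p t * b j t) * cdiff j t)" for t
    using * by (simp add: sum_distrib_left mult.assoc)
  then show ?thesis unfolding fibre_ideal_def using * assms(1) by (intro CollectI exI[of _ "\<lambda>j t. p t * b j t"]) auto
qed

lemma fibre_ideal_0: "(\<lambda>t. 0) \<in> fibre_ideal"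
  unfolding fibre_ideal_def by (intro CollectI exI[of _ "\<lambda>_ _. 0"] conjI allI impI pfun.const) simp

lemma zero_in_fibre_ideal [simp]: "0 \<in> fibre_ideal"
  unfolding zero_fun_def by (rule fibre_ideal_0)

lemma fibre_ideal_uminus: "x \<in> fibre_ideal \<Longrightarrow> (\<lambda>t. - x t) \<in> fibre_ideal"
  using fibre_ideal_mult[OF pfun.const[of "- 1"], of x] by simp

lemma fibre_ideal_diff: "x \<in> fibre_ideal \<Longrightarrow> y \<in> fibre_ideal \<Longrightarrow> (\<lambda>t. x t - y t) \<in> fibre_ideal"
  using fibre_ideal_add[OF _ fibre_ideal_uminus, of x y] by simp

lemma fibre_ideal_sum:
  "(\<And>i. i \<in> I \<Longrightarrow> x i \<in> fibre_ideal) \<Longrightarrow> (\<lambda>t. \<Sum>i\<in>I. x i t) \<in> fibre_ideal"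
proof (induction I rule: infinite_finite_induct)
  case (insert i I)
  then show ?case using fibre_ideal_add[of "x i" "\<lambda>t. \<Sum>i\<in>I. x i t"] by simp
qed (use fibre_ideal_0 in simp_all)

lemma cdiff_in_fibre_ideal: "cdiff j \<in> fibre_ideal"
proof (cases "j < d")
  case True
  have "cdiff j t = (\<Sum>i<d. (if i = j then 1 else 0) * cdiff i t)" for t
    using True by (simp add: if_distrib[of "\<lambda>x. x * _"] cong: if_cong)
  then show ?thesis unfolding fibre_ideal_def
    by (intro CollectI exI[of _ "\<lambda>i t. if i = j then 1 else 0"]) auto
next
  case False
  then have "cdiff j t = 0" for t unfolding cdiff_def using coeff_root_prod_high[of j t t0] by simp
  then have "cdiff j = (\<lambda>t. 0)" by blast
  then show ?thesis using fibre_ideal_0 by simp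
qed

lemma fibre_ideal_t0: "x \<in> fibre_ideal \<Longrightarrow> x t0 = 0"
  by (auto simp: fibre_ideal_def cdiff_def)

text \<open>Functions which are constant on the fibre, as a scheme.\<close>
definition fibre_const :: "((nat \<Rightarrow> 'a) \<Rightarrow> 'a) set" where
  "fibre_const = {x \<in> pfun e. (\<lambda>t. x t - x t0) \<in> fibre_ideal}"

lemma fun_algebra_fibre_const: "fun_algebra fibre_const"
  unfolding fun_algebra_def
proof (intro conjI ballI allI)
  show "(\<lambda>t. a) \<in> fibre_const" for a using fibre_ideal_0 by (simp add: fibre_const_def)
  fix x y assume *: "x \<in> fibre_const" "y \<in> fibre_const"
  have "(\<lambda>t. (x t - x t0) + (y t - y t0)) \<in> fibre_ideal" using * by (intro fibre_ideal_add) (auto simp: fibre_const_def)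
  then show "(\<lambda>t. x t + y t) \<in> fibre_const" using * by (auto simp: fibre_const_def algebra_simps)
  have "(\<lambda>t. x t * (y t - y t0) + y t0 * (x t - x t0)) \<in> fibre_ideal"
    using * by (intro fibre_ideal_add fibre_ideal_mult) (auto simp: fibre_const_def)
  then show "(\<lambda>t. x t * y t) \<in> fibre_const" using * by (auto simp: fibre_const_def algebra_simps)
qed

lemmas fibre_const_closed = fun_algebraD[OF fun_algebra_fibre_const]
lemmas fibre_const_sum = fun_algebra_sum[OF fun_algebra_fibre_const]

lemma fibre_const_cong:
  assumes "x \<in> fibre_const" "y \<in> pfun e" "(\<lambda>t. y t - x t) \<in> fibre_ideal" shows "y \<in> fibre_const"
proof -
  have "y t0 = x t0" using fibre_ideal_t0[OF assms(3)] by simp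
  moreover have "(\<lambda>t. (y t - x t) + (x t - x t0)) \<in> fibre_ideal"
    using assms by (intro fibre_ideal_add) (auto simp: fibre_const_def)
  ultimately show ?thesis using assms(2) by (simp add: fibre_const_def)
qed

lemma coeff_fibre_const: "(\<lambda>t. coeff (root_prod l t) j) \<in> fibre_const"
  using cdiff_in_fibre_ideal[of j] coeff_root_prod_pfun[of l j] by (simp add: fibre_const_def cdiff_def[abs_def])

text \<open>By Newton's identities, where the leading coefficient is $1$, so that no division is needed.\<close>
lemma power_sum_fibre_const: "power_sum_at l N \<in> fibre_const"
proof (induction N rule: less_induct)
  case (less N)
  define b where "b = (\<lambda>t j. if j \<le> d then coeff (root_prod l t) (d - j) else (0::'a))"
  have bK: "(\<lambda>t. b t j) \<in> fibre_const" for j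
    unfolding b_def using coeff_fibre_const fibre_const_closed(1)[of 0] by (cases "j \<le> d") auto
  have d: "sum_list l = d" using partition_ofD(4)[OF part] by (simp add: sum_mset_sum_list)
  have "power_sum_at l N t = (of_nat d - of_nat N) * b t N + (\<Sum>j\<in>{1..N}. (- 1) * (b t j * power_sum_at l (N - j) t))" for t
  proof -
    have "b t 0 = 1" using root_prod_monics[of t] by (auto simp: b_def monics_def)
    moreover have "{..N} = insert 0 {1..N}" by auto
    ultimately have "(\<Sum>j\<le>N. b t j * power_sum_at l (N - j) t)
        = power_sum_at l N t + (\<Sum>j\<in>{1..N}. b t j * power_sum_at l (N - j) t)" by simp
    then show ?thesis using newton_identity[where l = l and t = t and N = N] unfolding d b_def[symmetric]
      by (simp add: sum_negf algebra_simps b_def)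
  qed
  moreover have "(\<lambda>t. (of_nat d - of_nat N) * b t N + (\<Sum>j\<in>{1..N}. (- 1) * (b t j * power_sum_at l (N - j) t))) \<in> fibre_const"
    using less by (intro fibre_const_closed fibre_const_sum bK) auto
  ultimately show ?case by (simp add: fun_eq_iff[symmetric])
qed

lemma weighted_sum_fibre_const: "(\<lambda>t. \<Sum>i<e. of_nat (l ! i) * poly h (t i)) \<in> fibre_const"
proof -
  have "(\<Sum>i<e. of_nat (l ! i) * poly h (t i)) = (\<Sum>k\<le>degree h. coeff h k * power_sum_at l k t)" for t
    unfolding poly_altdef power_sum_at_def sum_distrib_left
    by (subst sum.swap) (simp add: mult_ac)
  moreover have "(\<lambda>t. \<Sum>k\<le>degree h. coeff h k * power_sum_at l k t) \<in> fibre_const"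
    by (intro fibre_const_sum fibre_const_closed power_sum_fibre_const)
  ultimately show ?thesis by simp
qed

text \<open>Since $t_i$ is a root of the product with roots $t$, the value at $t_i$ of the product with roots $t_0$ is
  a combination of the differences of the coefficients.\<close>
lemma multiple_in_fibre_ideal:
  assumes "root_prod l t0 dvd g" "i < e" shows "(\<lambda>t. poly g (t i)) \<in> fibre_ideal"
proof -
  obtain z where z: "g = root_prod l t0 * z" using assms(1) by (rule dvdE)
  have deg: "degree (root_prod l t) \<le> d" for t :: "nat \<Rightarrow> 'a" using root_prod_monics[of t] by (simp add: monics_def)
  have "poly (root_prod l t0) (t i) = (\<Sum>j\<le>d. - (t i ^ j) * cdiff j t)" for t
  proof -
    have "l ! i \<noteq> 0" using partition_ofD(3)[OF part] assms(2) by (metis nth_mem set_mset_mset)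
    then have "poly (root_prod l t) (t i) = 0" using assms(2) by (auto simp: root_prod_def poly_prod)
    then have "poly (root_prod l t0) (t i) = poly (root_prod l t0) (t i) - poly (root_prod l t) (t i)" by simp
    also have "\<dots> = (\<Sum>j\<le>d. - (t i ^ j) * cdiff j t)"
    proof -
      have "poly (root_prod l u) y = (\<Sum>j\<le>d. coeff (root_prod l u) j * y ^ j)" for u :: "nat \<Rightarrow> 'a" and y
        unfolding poly_altdef using deg[of u] by (intro sum.mono_neutral_left) (auto simp: coeff_eq_0)
      then show ?thesis by (simp add: cdiff_def algebra_simps flip: sum_subtractf)
    qed
    finally show ?thesis .
  qed
  then have "(\<lambda>t. poly g (t i)) = (\<lambda>t. poly z (t i) * (\<Sum>j\<le>d. - (t i ^ j) * cdiff j t))"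
    by (simp add: z mult.commute)
  also have "\<dots> \<in> fibre_ideal"
    by (intro fibre_ideal_mult fibre_ideal_sum pfun_poly pfun_uminus pfun_power pfun.var assms(2) cdiff_in_fibre_ideal)
  finally show ?thesis .
qed

end

text \<open>A point with a unique and even splitting: in every way of distributing the parts of \<open>l\<close> over
  the roots, the root $a_k$ receives parts equal to $\rho_k$ only.\<close>
locale even_point = locus_chart +
  fixes mu :: "nat list" and a :: "nat \<Rightarrow> 'a" and \<rho> :: "nat \<Rightarrow> nat"
  assumes start: "root_prod l t0 = root_prod mu a" and inj_a: "inj_on a {..<length mu}"
    and mu_pos: "0 \<notin> set mu" and d_pos: "d \<ge> 1"
    and \<rho>: "\<And>\<kappa> i. \<kappa> \<in> assignments l mu \<Longrightarrow> i < length l \<Longrightarrow> l ! i = \<rho> (\<kappa> i)"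
begin

text \<open>On the fibre the functions $h_k(t_i)$ are orthogonal idempotents, one for each root $t_i$ and each of its
  possible values $a_k$. A product $\prod_i h_{\kappa(i)}(t_i)$ vanishes unless $\kappa$ is an assignment, since
  the weighted power sums $\sum_i \lambda_i h_k(t_i)$ are constant on the fibre. Hence $h_k(t_i)$ vanishes unless
  $\lambda_i = \rho_k$, and in $\sum_i \lambda_i g(t_i) h_k(t_i)$ the weight $\rho_k$ can be divided out; the sum over all $k$ with
  $\rho_k = r$ is the power sum of a block.\<close>
lemma block_sum_fibre_const: "(\<lambda>t. \<Sum>i | i < e \<and> l ! i = r. poly g (t i)) \<in> fibre_const"
proof -
  define f where "f = root_prod l t0"
  have f: "f = (\<Prod>k<length mu. [:- a k, 1:] ^ (mu ! k))" unfolding f_def start by (simp add: root_prod_def)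
  obtain h where h: "\<And>k k'. k < length mu \<Longrightarrow> k' < length mu \<Longrightarrow> k \<noteq> k' \<Longrightarrow> f dvd h k * h k'"
    "f dvd (\<Sum>k<length mu. h k) - 1"
    "\<And>k k'. k < length mu \<Longrightarrow> k' < length mu \<Longrightarrow> mu ! k' > 0 \<Longrightarrow> poly (h k) (a k') = (if k = k' then 1 else 0)"
    by (rule exists_idempotents[OF inj_a, of "\<lambda>k. mu ! k", folded f]) (rule that; assumption)
  have mupos: "mu ! k > 0" if "k < length mu" for k using mu_pos that by (metis not_gr_zero nth_mem)
  have l0: "0 \<notin> set l" using partition_ofD(3)[OF part] by simp
  obtain \<kappa>0 where \<kappa>0: "\<kappa>0 \<in> assignments l mu" "\<And>i. i < e \<Longrightarrow> t0 i = a (\<kappa>0 i)"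
    using assignment_of_root_prod[OF start l0 inj_a] by blast
  have \<kappa>0r: "\<kappa>0 i < length mu" if "i < e" for i using \<kappa>0(1) that by (auto simp: assignments_def)
  note van = multiple_in_fibre_ideal[folded f_def]
  have idem: "f dvd h k * h k' - (if k = k' then h k' else 0)" if k: "k < length mu" "k' < length mu" for k k'
  proof (cases "k = k'")
    case True
    have "h k * h k - h k = h k * ((\<Sum>j<length mu. h j) - 1) - (\<Sum>j\<in>{..<length mu} - {k}. h k * h j)"
      using k by (subst sum.remove[of "{..<length mu}" k]) (auto simp: algebra_simps sum_distrib_left)
    moreover have "f dvd (\<Sum>j\<in>{..<length mu} - {k}. h k * h j)" using h(1) k by (intro dvd_sum) auto
    ultimately show ?thesis using True h(2) by (simp add: dvd_diff)
  qed (use h(1) k in simp)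
  \<comment> \<open>\<open>\<epsilon>\<close> is an eigenvector of \<open>w\<close>, with an eigenvalue different from the value of \<open>w\<close> on the fibre\<close>
  have prod_van: "(\<lambda>t. \<Prod>i<e. poly (h (\<kappa> i)) (t i)) \<in> fibre_ideal"
    if \<kappa>: "\<kappa> \<in> PiE {..<e} (\<lambda>_. {..<length mu})" "\<kappa> \<notin> assignments l mu" for \<kappa>
  proof -
    define \<epsilon> where "\<epsilon> = (\<lambda>t. \<Prod>i<e. poly (h (\<kappa> i)) (t i))"
    have \<epsilon>p: "\<epsilon> \<in> pfun e" unfolding \<epsilon>_def by (intro pfun_prod pfun_poly) auto
    obtain k where k: "k < length mu" "(\<Sum>i | i < e \<and> \<kappa> i = k. l ! i) \<noteq> mu ! k"
      using \<kappa> unfolding assignments_def by blast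
    define w where "w = (\<lambda>t. \<Sum>i<e. of_nat (l ! i) * poly (h k) (t i))"
    have "w t0 = (\<Sum>i<e. if \<kappa>0 i = k then of_nat (l ! i) else 0)"
      unfolding w_def using \<kappa>0 h(3)[OF k(1)] \<kappa>0r mupos by (intro sum.cong) auto
    also have "\<dots> = of_nat (\<Sum>i | i < e \<and> \<kappa>0 i = k. l ! i)"
      by (simp add: sum.inter_filter[symmetric])
    also have "\<dots> = of_nat (mu ! k)" using \<kappa>0(1) k(1) by (simp add: assignments_def)
    finally have w0: "w t0 = of_nat (mu ! k)" .
    have "(\<lambda>t. w t - w t0) \<in> fibre_ideal"
      using weighted_sum_fibre_const[of "h k"] by (simp add: fibre_const_def w_def)
    then have 1: "(\<lambda>t. \<epsilon> t * (w t - w t0)) \<in> fibre_ideal" by (rule fibre_ideal_mult[OF \<epsilon>p])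
    have 2: "(\<lambda>t. \<epsilon> t * poly (h k) (t i) - (if \<kappa> i = k then \<epsilon> t else 0)) \<in> fibre_ideal" if i: "i < e" for i
    proof -
      have \<kappa>i: "\<kappa> i < length mu" using \<kappa>(1) i by auto
      have \<epsilon>i: "\<epsilon> t = (\<Prod>j\<in>{..<e} - {i}. poly (h (\<kappa> j)) (t j)) * poly (h (\<kappa> i)) (t i)" for t
        unfolding \<epsilon>_def using i by (subst prod.remove[of _ i]) (auto simp: mult.commute)
      have "(\<lambda>t. (\<Prod>j\<in>{..<e} - {i}. poly (h (\<kappa> j)) (t j)) *
          poly (h k * h (\<kappa> i) - (if k = \<kappa> i then h (\<kappa> i) else 0)) (t i)) \<in> fibre_ideal"
        by (intro fibre_ideal_mult pfun_prod pfun_poly van idem k(1) \<kappa>i i) auto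
      moreover have "(\<Prod>j\<in>{..<e} - {i}. poly (h (\<kappa> j)) (t j)) *
          poly (h k * h (\<kappa> i) - (if k = \<kappa> i then h (\<kappa> i) else 0)) (t i)
        = \<epsilon> t * poly (h k) (t i) - (if \<kappa> i = k then \<epsilon> t else 0)" for t
        unfolding \<epsilon>i by (auto simp: algebra_simps)
      ultimately show ?thesis by simp
    qed
    have "(\<lambda>t. \<Sum>i<e. of_nat (l ! i) * (\<epsilon> t * poly (h k) (t i) - (if \<kappa> i = k then \<epsilon> t else 0))) \<in> fibre_ideal"
      using 2 by (intro fibre_ideal_sum fibre_ideal_mult[OF pfun.const]) auto
    moreover have "(\<Sum>i<e. of_nat (l ! i) * (\<epsilon> t * poly (h k) (t i) - (if \<kappa> i = k then \<epsilon> t else 0)))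
        = \<epsilon> t * w t - of_nat (\<Sum>i | i < e \<and> \<kappa> i = k. l ! i) * \<epsilon> t" for t
    proof -
      have "(\<Sum>i<e. of_nat (l ! i) * (if \<kappa> i = k then \<epsilon> t else 0)) = (\<Sum>i<e. if \<kappa> i = k then of_nat (l ! i) * \<epsilon> t else 0)"
        by (intro sum.cong) auto
      also have "\<dots> = of_nat (\<Sum>i | i < e \<and> \<kappa> i = k. l ! i) * \<epsilon> t"
        by (simp add: sum.inter_filter[symmetric] sum_distrib_right)
      finally show ?thesis by (simp add: right_diff_distrib sum_subtractf w_def sum_distrib_left mult_ac)
    qed
    ultimately have 3: "(\<lambda>t. \<epsilon> t * w t - of_nat (\<Sum>i | i < e \<and> \<kappa> i = k. l ! i) * \<epsilon> t) \<in> fibre_ideal" by simp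
    define N :: 'a where "N = of_nat (\<Sum>i | i < e \<and> \<kappa> i = k. l ! i) - of_nat (mu ! k)"
    have "N \<noteq> 0" unfolding N_def using k(2) by (simp only: right_minus_eq of_nat_eq_iff) simp
    have "(\<lambda>t. \<epsilon> t * (w t - w t0) - (\<epsilon> t * w t - of_nat (\<Sum>i | i < e \<and> \<kappa> i = k. l ! i) * \<epsilon> t)) \<in> fibre_ideal"
      by (rule fibre_ideal_diff[OF 1 3])
    moreover have "\<epsilon> t * (w t - w t0) - (\<epsilon> t * w t - of_nat (\<Sum>i | i < e \<and> \<kappa> i = k. l ! i) * \<epsilon> t) = N * \<epsilon> t" for t
      by (simp add: N_def w0 algebra_simps)
    ultimately have "(\<lambda>t. N * \<epsilon> t) \<in> fibre_ideal" by simp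
    then have "(\<lambda>t. (1 / N) * (N * \<epsilon> t)) \<in> fibre_ideal" by (rule fibre_ideal_mult[OF pfun.const])
    moreover have "(1 / N) * (N * \<epsilon> t) = \<epsilon> t" for t using \<open>N \<noteq> 0\<close> by simp
    ultimately have "(\<lambda>t. \<epsilon> t) \<in> fibre_ideal" by (simp only:)
    then show ?thesis by (simp only: \<epsilon>_def)
  qed
  have one: "(\<lambda>t. (\<Sum>k<length mu. poly (h k) (t i)) - 1) \<in> fibre_ideal" if "i < e" for i
    using van[OF h(2) that] by (simp add: poly_sum)
  \<comment> \<open>multiply by the sums of all idempotents at the other roots, which are $1$, and expand\<close>
  have eps_van: "(\<lambda>t. poly (h k) (t i)) \<in> fibre_ideal" if ik: "i < e" "k < length mu" "l ! i \<noteq> \<rho> k" for i k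
  proof -
    define K where "K = (\<lambda>j. if j = i then {k} else {..<length mu})"
    have "(\<lambda>t. \<Sum>\<kappa>\<in>PiE {..<e} K. \<Prod>j<e. poly (h (\<kappa> j)) (t j)) \<in> fibre_ideal"
    proof (intro fibre_ideal_sum prod_van)
      fix \<kappa> assume \<kappa>: "\<kappa> \<in> PiE {..<e} K"
      then have "\<kappa> j \<in> K j" if "j < e" for j using that by auto
      then have Kj: "\<kappa> j < length mu" if "j < e" for j using that ik(2) by (fastforce simp: K_def split: if_splits)
      show "\<kappa> \<in> PiE {..<e} (\<lambda>_. {..<length mu})" using \<kappa> Kj by (auto simp: PiE_iff)
      have "\<kappa> i = k" using \<open>\<And>j. j < e \<Longrightarrow> \<kappa> j \<in> K j\<close>[OF ik(1)] by (simp add: K_def)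
      then show "\<kappa> \<notin> assignments l mu" using \<rho>[of \<kappa> i] ik by auto
    qed
    moreover have "(\<Sum>\<kappa>\<in>PiE {..<e} K. \<Prod>j<e. poly (h (\<kappa> j)) (t j)) = (\<Prod>j<e. \<Sum>k'\<in>K j. poly (h k') (t j))" for t
      by (rule prod_sum_PiE[symmetric]) (auto simp: K_def)
    ultimately have A: "(\<lambda>t. \<Prod>j<e. \<Sum>k'\<in>K j. poly (h k') (t j)) \<in> fibre_ideal" by simp
    have pf: "(\<lambda>t. \<Sum>k'\<in>K j. poly (h k') (t j)) \<in> pfun e" if "j < e" for j
      using that by (intro pfun_sum pfun_poly)
    have B: "(\<lambda>t. (\<Prod>j\<in>J. \<Sum>k'\<in>K j. poly (h k') (t j)) - 1) \<in> fibre_ideal" if "J \<subseteq> {..<e} - {i}" for J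
      using finite_subset[OF that finite_Diff[OF finite_lessThan]] that
    proof (induction J rule: finite_induct)
      case (insert j J)
      define u where "u = (\<lambda>t. \<Sum>k'\<in>K j. poly (h k') (t j))"
      define v where "v = (\<lambda>t. \<Prod>j\<in>J. \<Sum>k'\<in>K j. poly (h k') (t j))"
      have "(\<lambda>t. u t - 1) \<in> fibre_ideal" "u \<in> pfun e"
        using one[of j] pf[of j] insert.prems unfolding u_def K_def by (auto simp del: sum_diff1_nat)
      moreover have "(\<lambda>t. v t - 1) \<in> fibre_ideal" using insert unfolding v_def by blast
      ultimately have "(\<lambda>t. u t * (v t - 1) + (u t - 1)) \<in> fibre_ideal"
        by (intro fibre_ideal_add fibre_ideal_mult)
      moreover have "u t * (v t - 1) + (u t - 1) = (\<Prod>j\<in>insert j J. \<Sum>k'\<in>K j. poly (h k') (t j)) - 1" for t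
        unfolding u_def v_def using insert.hyps by (simp add: algebra_simps)
      ultimately show ?case by simp
    qed simp
    define v where "v = (\<lambda>t. \<Prod>j\<in>{..<e} - {i}. \<Sum>k'\<in>K j. poly (h k') (t j))"
    have "(\<lambda>t. poly (h k) (t i) * (v t - 1)) \<in> fibre_ideal"
      unfolding v_def using ik(1) by (intro fibre_ideal_mult pfun_poly B) auto
    moreover have "(\<Prod>j<e. \<Sum>k'\<in>K j. poly (h k') (t j)) = poly (h k) (t i) * v t" for t
      unfolding v_def using ik(1) by (subst prod.remove[of _ i]) (auto simp: K_def)
    ultimately have "(\<lambda>t. poly (h k) (t i) * v t - poly (h k) (t i) * (v t - 1)) \<in> fibre_ideal"
      using A by (intro fibre_ideal_diff) auto
    then show ?thesis by (simp add: algebra_simps)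
  qed
  define B where "B = (\<lambda>r. {i. i < e \<and> l ! i = r})"
  have Be: "B r \<subseteq> {..<e}" "finite (B r)" for r by (auto simp: B_def)
  have block: "(\<lambda>t. \<Sum>i\<in>B (\<rho> k). poly g (t i) * poly (h k) (t i)) \<in> fibre_const" if k: "k < length mu" for k
  proof (cases "\<rho> k = 0")
    case True
    then have "B (\<rho> k) = {}" using l0 by (auto simp: B_def in_set_conv_nth)
    then show ?thesis using fibre_const_closed(1)[of 0] by simp
  next
    case False
    have split: "(\<Sum>i<e. of_nat (l ! i) * poly (g * h k) (t i)) = (\<Sum>i\<in>B (\<rho> k). of_nat (l ! i) * poly (g * h k) (t i))
        + (\<Sum>i\<in>{..<e} - B (\<rho> k). of_nat (l ! i) * poly (g * h k) (t i))" for t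
      using Be by (subst sum.subset_diff[of "B (\<rho> k)"]) (auto simp: add.commute)
    have "(\<lambda>t. \<Sum>i\<in>{..<e} - B (\<rho> k). (of_nat (l ! i) * poly g (t i)) * poly (h k) (t i)) \<in> fibre_ideal"
      using k by (intro fibre_ideal_sum fibre_ideal_mult pfun.mult pfun.const pfun_poly eps_van) (auto simp: B_def)
    then have rest: "(\<lambda>t. - (\<Sum>i\<in>{..<e} - B (\<rho> k). of_nat (l ! i) * poly (g * h k) (t i))) \<in> fibre_ideal"
      by (intro fibre_ideal_uminus) (simp add: mult.assoc)
    have diff: "(\<Sum>i\<in>B (\<rho> k). of_nat (l ! i) * poly (g * h k) (t i)) - (\<Sum>i<e. of_nat (l ! i) * poly (g * h k) (t i))
        = - (\<Sum>i\<in>{..<e} - B (\<rho> k). of_nat (l ! i) * poly (g * h k) (t i))" for t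
      unfolding split by simp
    have "(\<lambda>t. \<Sum>i\<in>B (\<rho> k). of_nat (l ! i) * poly (g * h k) (t i)) \<in> fibre_const"
    proof (rule fibre_const_cong[OF weighted_sum_fibre_const[of "g * h k"]])
      show "(\<lambda>t. \<Sum>i\<in>B (\<rho> k). of_nat (l ! i) * poly (g * h k) (t i)) \<in> pfun e"
        by (intro pfun_sum pfun.mult pfun.const pfun_poly) (auto simp: B_def)
    qed (unfold diff, rule rest)
    then have "(\<lambda>t. (1 / of_nat (\<rho> k)) * (\<Sum>i\<in>B (\<rho> k). of_nat (l ! i) * poly (g * h k) (t i))) \<in> fibre_const"
      by (intro fibre_const_closed)
    moreover have "(1 / of_nat (\<rho> k)) * (\<Sum>i\<in>B (\<rho> k). of_nat (l ! i) * poly (g * h k) (t i))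
        = (\<Sum>i\<in>B (\<rho> k). poly g (t i) * poly (h k) (t i))" for t
      unfolding sum_distrib_left using False by (intro sum.cong) (auto simp: B_def)
    ultimately show ?thesis by simp
  qed
  define good where "good = {k. k < length mu \<and> \<rho> k = r}"
  have good_const: "(\<lambda>t. \<Sum>k\<in>good. \<Sum>i\<in>B r. poly g (t i) * poly (h k) (t i)) \<in> fibre_const"
    by (rule fibre_const_sum) (use block in \<open>auto simp: good_def\<close>)
  have good_diff: "(\<lambda>t. (\<Sum>i\<in>B r. poly g (t i)) - (\<Sum>k\<in>good. \<Sum>i\<in>B r. poly g (t i) * poly (h k) (t i))) \<in> fibre_ideal"
  proof -
    have "(\<lambda>t. \<Sum>i\<in>B r. (- poly g (t i)) * ((\<Sum>k<length mu. poly (h k) (t i)) - 1)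
        + poly g (t i) * (\<Sum>k\<in>{..<length mu} - good. poly (h k) (t i))) \<in> fibre_ideal"
      by (intro fibre_ideal_sum fibre_ideal_add fibre_ideal_mult pfun_uminus pfun_poly one eps_van) (auto simp: B_def good_def)
    moreover have "(\<Sum>i\<in>B r. (- poly g (t i)) * ((\<Sum>k<length mu. poly (h k) (t i)) - 1)
        + poly g (t i) * (\<Sum>k\<in>{..<length mu} - good. poly (h k) (t i)))
      = (\<Sum>i\<in>B r. poly g (t i)) - (\<Sum>k\<in>good. \<Sum>i\<in>B r. poly g (t i) * poly (h k) (t i))" for t
    proof -
      have gs: "good \<subseteq> {..<length mu}" by (auto simp: good_def)
      have "(\<Sum>k<length mu. poly (h k) (t i)) = (\<Sum>k\<in>good. poly (h k) (t i)) + (\<Sum>k\<in>{..<length mu} - good. poly (h k) (t i))" for i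
        using sum.subset_diff[OF gs] by (simp add: add.commute)
      then have "(\<Sum>i\<in>B r. (- poly g (t i)) * ((\<Sum>k<length mu. poly (h k) (t i)) - 1)
        + poly g (t i) * (\<Sum>k\<in>{..<length mu} - good. poly (h k) (t i)))
        = (\<Sum>i\<in>B r. poly g (t i) - poly g (t i) * (\<Sum>k\<in>good. poly (h k) (t i)))"
        by (intro sum.cong) (auto simp: algebra_simps)
      also have "\<dots> = (\<Sum>i\<in>B r. poly g (t i)) - (\<Sum>k\<in>good. \<Sum>i\<in>B r. poly g (t i) * poly (h k) (t i))"
        by (simp add: sum_subtractf sum_distrib_left sum.swap[of _ good])
      finally show ?thesis .
    qed
    ultimately show ?thesis by simp
  qed
  have "(\<lambda>t. \<Sum>i\<in>B r. poly g (t i)) \<in> fibre_const"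
    by (rule fibre_const_cong[OF good_const _ good_diff]) (auto simp: B_def intro!: pfun_sum pfun_poly)
  then show ?thesis by (simp add: B_def)
qed

end

section \<open>Functions symmetric in equal parts\<close>

context locus_chart
begin

definition block_perms :: "(nat \<Rightarrow> nat) set" where
  "block_perms = {\<sigma>. \<sigma> permutes {..<e} \<and> (\<forall>i<e. l ! \<sigma> i = l ! i)}"

lemma finite_block_perms: "finite block_perms"
  by (rule finite_subset[OF _ finite_permutations[of "{..<e}"]]) (auto simp: block_perms_def)

lemma id_block_perms: "id \<in> block_perms"
  by (simp add: block_perms_def permutes_id)

lemma block_perm_less: "\<sigma> \<in> block_perms \<Longrightarrow> \<sigma> i < e \<longleftrightarrow> i < e"
  using permutes_in_image[of \<sigma> "{..<e}" i] by (simp add: block_perms_def)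

lemma block_perms_comp: assumes "\<sigma> \<in> block_perms" "\<tau> \<in> block_perms" shows "\<sigma> \<circ> \<tau> \<in> block_perms"
  using assms block_perm_less[OF assms(2)] by (auto simp: block_perms_def permutes_compose)

lemma block_perms_transpose:
  assumes "i < e" "j < e" "l ! i = l ! j" shows "transpose i j \<in> block_perms"
  using assms by (auto simp: block_perms_def transpose_def intro!: permutes_swap_id)

lemma block_perms_inv: assumes "\<sigma> \<in> block_perms" shows "inv_into UNIV \<sigma> \<in> block_perms"
proof -
  have p: "\<sigma> permutes {..<e}" using assms by (simp add: block_perms_def)
  have "l ! inv_into UNIV \<sigma> i = l ! i" if "i < e" for i
  proof -
    have "inv_into UNIV \<sigma> i < e" using permutes_in_image[OF permutes_inv[OF p], of i] that by simp
    then have "l ! \<sigma> (inv_into UNIV \<sigma> i) = l ! inv_into UNIV \<sigma> i" using assms by (simp add: block_perms_def)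
    then show ?thesis using permutes_inverses(1)[OF p] by simp
  qed
  then show ?thesis using permutes_inv[OF p] by (simp add: block_perms_def)
qed

lemma root_prod_perm:
  fixes t :: "nat \<Rightarrow> 'a"
  assumes "\<sigma> \<in> block_perms" shows "root_prod l (t \<circ> \<sigma>) = root_prod l t"
proof -
  have p: "\<sigma> permutes {..<e}" using assms by (simp add: block_perms_def)
  have "root_prod l (t \<circ> \<sigma>) = (\<Prod>i<e. [:- t (\<sigma> i), 1:] ^ (l ! \<sigma> i))"
    unfolding root_prod_def using assms by (intro prod.cong) (auto simp: block_perms_def)
  also have "\<dots> = root_prod l t"
    unfolding root_prod_def using prod.permute[OF p, of "\<lambda>i. [:- t i, 1:] ^ (l ! i)"] by (simp add: comp_def)
  finally show ?thesis .
qed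

lemma C_perm: "x \<in> C \<Longrightarrow> \<sigma> \<in> block_perms \<Longrightarrow> x (t \<circ> \<sigma>) = x t"
  by (rule coeff_algebra_root_prod_eq[OF _ root_prod_perm])

definition symmetrize :: "((nat \<Rightarrow> 'a) \<Rightarrow> 'a) \<Rightarrow> (nat \<Rightarrow> 'a) \<Rightarrow> 'a" where
  "symmetrize x t = (\<Sum>\<sigma>\<in>block_perms. x (t \<circ> \<sigma>))"

lemma symmetrize_symmetrize: "symmetrize (symmetrize x) t = of_nat (card block_perms) * symmetrize x t"
proof -
  have "symmetrize x (t \<circ> \<sigma>) = symmetrize x t" if s: "\<sigma> \<in> block_perms" for \<sigma>
  proof -
    have p: "\<sigma> permutes {..<e}" using s by (simp add: block_perms_def)
    have inv: "\<sigma> \<circ> inv_into UNIV \<sigma> = id" "inv_into UNIV \<sigma> \<circ> \<sigma> = id" using permutes_inv_o[OF p] by auto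
    have "inv_into UNIV \<sigma> \<circ> (\<sigma> \<circ> \<tau>) = \<tau>" "\<sigma> \<circ> (inv_into UNIV \<sigma> \<circ> \<tau>) = \<tau>" for \<tau> :: "nat \<Rightarrow> nat"
      unfolding o_assoc inv by simp_all
    then show ?thesis unfolding symmetrize_def comp_assoc
      by (intro sum.reindex_bij_witness[of _ "\<lambda>\<tau>. inv_into UNIV \<sigma> \<circ> \<tau>" "\<lambda>\<tau>. \<sigma> \<circ> \<tau>"])
         (use s in \<open>auto intro: block_perms_comp block_perms_inv\<close>)
  qed
  then show ?thesis by (simp add: symmetrize_def[of "symmetrize x"])
qed

text \<open>The module over the coefficients which is spanned by the monomials of degree less than $d$ in each root.
  It contains all polynomial functions, because each root is integral over the coefficients.\<close>
definition finite_span :: "((nat \<Rightarrow> 'a) \<Rightarrow> 'a) set" where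
  "finite_span = {x. \<exists>cf. (\<forall>\<alpha>. cf \<alpha> \<in> C) \<and> (\<forall>t. x t = (\<Sum>\<alpha>\<in>exps d e. cf \<alpha> t * tmono e \<alpha> t))}"

lemma finite_span_add:
  assumes "x \<in> finite_span" "y \<in> finite_span" shows "(\<lambda>t. x t + y t) \<in> finite_span"
proof -
  obtain cf cg where *: "\<And>\<alpha>. cf \<alpha> \<in> C" "\<And>t. x t = (\<Sum>\<alpha>\<in>exps d e. cf \<alpha> t * tmono e \<alpha> t)"
    "\<And>\<alpha>. cg \<alpha> \<in> C" "\<And>t. y t = (\<Sum>\<alpha>\<in>exps d e. cg \<alpha> t * tmono e \<alpha> t)"
    using assms unfolding finite_span_def by blast
  then show ?thesis unfolding finite_span_def
    by (intro CollectI exI[of _ "\<lambda>\<alpha> t. cf \<alpha> t + cg \<alpha> t"]) (auto simp: distrib_right sum.distrib)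
qed

lemma finite_span_mult:
  assumes "p \<in> C" "x \<in> finite_span" shows "(\<lambda>t. p t * x t) \<in> finite_span"
proof -
  obtain cf where *: "\<And>\<alpha>. cf \<alpha> \<in> C" "\<And>t. x t = (\<Sum>\<alpha>\<in>exps d e. cf \<alpha> t * tmono e \<alpha> t)"
    using assms unfolding finite_span_def by blast
  then show ?thesis unfolding finite_span_def using assms(1)
    by (intro CollectI exI[of _ "\<lambda>\<alpha> t. p t * cf \<alpha> t"]) (auto simp: sum_distrib_left mult.assoc)
qed

lemma finite_span_sum: "(\<And>i. i \<in> I \<Longrightarrow> x i \<in> finite_span) \<Longrightarrow> (\<lambda>t. \<Sum>i\<in>I. x i t) \<in> finite_span"
proof (induction I rule: infinite_finite_induct)
  case (insert i I)
  then show ?case using finite_span_add[of "x i"] by simp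
qed (auto simp: finite_span_def intro!: exI[of _ "\<lambda>_ _. 0"])

lemma finite_span_tmono: assumes "\<alpha> \<in> exps d e" shows "tmono e \<alpha> \<in> finite_span"
  unfolding finite_span_def
proof (intro CollectI exI[of _ "\<lambda>\<beta> t. if \<beta> = \<alpha> then 1 else 0"] conjI allI)
  show "(\<lambda>t. if \<beta> = \<alpha> then 1 else 0) \<in> C" for \<beta> by (cases "\<beta> = \<alpha>") auto
  show "tmono e \<alpha> t = (\<Sum>\<beta>\<in>exps d e. (if \<beta> = \<alpha> then 1 else 0) * tmono e \<beta> t)" for t :: "nat \<Rightarrow> 'a"
    using assms by (simp add: if_distrib[of "\<lambda>x. x * _"] cong: if_cong)
qed

lemma root_relation:
  fixes t :: "nat \<Rightarrow> 'a"
  assumes "i < e" shows "t i ^ d = (\<Sum>j<d. - coeff (root_prod l t) j * t i ^ j)"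
proof -
  have "l ! i \<noteq> 0" using partition_ofD(3)[OF part] assms by (metis nth_mem set_mset_mset)
  then have "poly (root_prod l t) (t i) = 0" using assms by (auto simp: root_prod_def poly_prod)
  moreover have "degree (root_prod l t) = d" "coeff (root_prod l t) d = 1"
    using root_prod_monics[of t] by (auto simp: monics_def)
  ultimately have "(\<Sum>j<d. coeff (root_prod l t) j * t i ^ j) + t i ^ d = 0"
    by (simp add: poly_altdef flip: lessThan_Suc_atMost)
  then show ?thesis by (simp add: sum_negf eq_neg_iff_add_eq_0 add.commute)
qed

lemma finite_span_var:
  assumes i: "i < e" and x: "x \<in> finite_span" shows "(\<lambda>t. t i * x t) \<in> finite_span"
proof -
  have mono: "(\<lambda>t. t i * tmono e \<alpha> t) \<in> finite_span" if \<alpha>: "\<alpha> \<in> exps d e" for \<alpha>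
  proof -
    define R :: "(nat \<Rightarrow> 'a) \<Rightarrow> 'a" where "R = (\<lambda>t. \<Prod>j\<in>{..<e} - {i}. t j ^ (\<alpha> ! j))"
    have len: "length \<alpha> = e" and sub: "set \<alpha> \<subseteq> {..<d}" using \<alpha> by (auto simp: exps_def)
    have \<beta>: "\<alpha>[i := j] \<in> exps d e" if "j < d" for j
      using that len sub set_update_subset_insert[of \<alpha> i j] by (auto simp: exps_def)
    have tm: "tmono e (\<alpha>[i := j]) t = t i ^ j * R t" for j and t :: "nat \<Rightarrow> 'a"
      unfolding tmono_def R_def using i len
      by (subst prod.remove[of _ i]) (auto intro!: arg_cong2[of _ _ _ _ "(*)"] prod.cong)
    have \<alpha>i: "\<alpha> ! i < d" using exps_nth[OF \<alpha> i] .
    have t\<alpha>: "tmono e \<alpha> t = t i ^ (\<alpha> ! i) * R t" for t :: "nat \<Rightarrow> 'a" using tm[of "\<alpha> ! i" t] by simp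
    show ?thesis
    proof (cases "Suc (\<alpha> ! i) < d")
      case True
      have "t i * tmono e \<alpha> t = tmono e (\<alpha>[i := Suc (\<alpha> ! i)]) t" for t :: "nat \<Rightarrow> 'a" by (simp add: tm t\<alpha>)
      then show ?thesis using finite_span_tmono[OF \<beta>[OF True]] by simp
    next
      case False
      then have d: "Suc (\<alpha> ! i) = d" using \<alpha>i by simp
      have "t i * tmono e \<alpha> t = (\<Sum>j<d. - coeff (root_prod l t) j * tmono e (\<alpha>[i := j]) t)" for t :: "nat \<Rightarrow> 'a"
      proof -
        have "t i * tmono e \<alpha> t = t i ^ d * R t" by (simp add: t\<alpha> flip: d)
        also have "\<dots> = (\<Sum>j<d. - coeff (root_prod l t) j * t i ^ j) * R t" using root_relation[OF i] by simp
        also have "\<dots> = (\<Sum>j<d. - coeff (root_prod l t) j * tmono e (\<alpha>[i := j]) t)"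
          by (simp add: tm sum_distrib_right mult.assoc)
        finally show ?thesis .
      qed
      moreover have "(\<lambda>t. \<Sum>j<d. - coeff (root_prod l t) j * tmono e (\<alpha>[i := j]) t) \<in> finite_span"
      proof (intro finite_span_sum finite_span_mult finite_span_tmono \<beta>)
        show "(\<lambda>t. - coeff (root_prod l t) j) \<in> C" for j
          using coeff_algebra.mult[OF coeff_algebra.const[of "- 1"] coeff_algebra.coeff[of l j]] by simp
      qed auto
      ultimately show ?thesis by simp
    qed
  qed
  obtain cf where *: "\<And>\<alpha>. cf \<alpha> \<in> C" "\<And>t. x t = (\<Sum>\<alpha>\<in>exps d e. cf \<alpha> t * tmono e \<alpha> t)"
    using x unfolding finite_span_def by blast
  have "(\<lambda>t. \<Sum>\<alpha>\<in>exps d e. cf \<alpha> t * (t i * tmono e \<alpha> t)) \<in> finite_span"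
    using *(1) mono by (intro finite_span_sum) (auto intro: finite_span_mult)
  then show ?thesis by (simp add: *(2) sum_distrib_left mult_ac)
qed

lemma pfun_finite_span:
  assumes "d \<ge> 1" "f \<in> pfun e" shows "f \<in> finite_span"
proof -
  have "(\<lambda>t. f t * x t) \<in> finite_span" if "x \<in> finite_span" for x
    using assms(2) that
  proof (induction arbitrary: x)
    case (const c)
    then show ?case using finite_span_mult[OF coeff_algebra.const] by blast
  next
    case (var i)
    then show ?case using finite_span_var by blast
  next
    case (add f g)
    then show ?case using finite_span_add[of "\<lambda>t. f t * x t" "\<lambda>t. g t * x t"] by (simp add: distrib_right)
  next
    case (mult f g)
    have "(\<lambda>t. f t * (g t * x t)) \<in> finite_span" using mult by blast
    then show ?case by (simp add: mult.assoc)
  qed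
  moreover have "tmono e (replicate e 0) \<in> finite_span"
    using assms(1) by (intro finite_span_tmono) (auto simp: exps_def)
  ultimately have "(\<lambda>t. f t * tmono e (replicate e 0) t) \<in> finite_span" by blast
  then show ?thesis by (simp add: tmono_def)
qed

lemma cdiff_C: "cdiff j \<in> C"
  using coeff_algebra.add[OF coeff_algebra.coeff[of l j] coeff_algebra.const[of "- coeff (root_prod l t0) j"]]
  by (simp add: cdiff_def[abs_def])

text \<open>The fibre ideal is generated by the maximal ideal of the coefficient algebra.\<close>
lemma fibre_ideal_expansion:
  assumes "d \<ge> 1" "x \<in> fibre_ideal"
  obtains m where "\<And>\<alpha>. m \<alpha> \<in> C" "\<And>\<alpha>. m \<alpha> t0 = 0" "\<And>t. x t = (\<Sum>\<alpha>\<in>exps d e. m \<alpha> t * tmono e \<alpha> t)"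
proof -
  obtain b where b: "\<And>j. j < d \<Longrightarrow> b j \<in> pfun e" "\<And>t. x t = (\<Sum>j<d. b j t * cdiff j t)"
    using assms(2) unfolding fibre_ideal_def by blast
  have "\<exists>cf. (\<forall>\<alpha>. cf \<alpha> \<in> C) \<and> (\<forall>t. b j t = (\<Sum>\<alpha>\<in>exps d e. cf \<alpha> t * tmono e \<alpha> t))" if "j < d" for j
    using pfun_finite_span[OF assms(1) b(1)[OF that]] unfolding finite_span_def by blast
  then obtain cf where cf: "\<And>j \<alpha>. j < d \<Longrightarrow> cf j \<alpha> \<in> C"
      "\<And>j t. j < d \<Longrightarrow> b j t = (\<Sum>\<alpha>\<in>exps d e. cf j \<alpha> t * tmono e \<alpha> t)" by metis
  define m where "m = (\<lambda>\<alpha> t. \<Sum>j<d. cf j \<alpha> t * cdiff j t)"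
  show ?thesis
  proof (rule that)
    show "m \<alpha> \<in> C" for \<alpha> unfolding m_def
      using cf(1) by (intro fun_algebra_sum[OF fun_algebra_coeff_algebra] coeff_algebra.mult cdiff_C) auto
    show "m \<alpha> t0 = 0" for \<alpha> by (simp add: m_def cdiff_def)
    show "x t = (\<Sum>\<alpha>\<in>exps d e. m \<alpha> t * tmono e \<alpha> t)" for t
    proof -
      have "x t = (\<Sum>j<d. \<Sum>\<alpha>\<in>exps d e. cf j \<alpha> t * tmono e \<alpha> t * cdiff j t)"
        using cf(2) by (simp add: b(2) sum_distrib_right)
      also have "\<dots> = (\<Sum>\<alpha>\<in>exps d e. m \<alpha> t * tmono e \<alpha> t)"
        by (subst sum.swap) (simp add: m_def sum_distrib_left sum_distrib_right mult_ac)
      finally show ?thesis .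
    qed
  qed
qed

lemma infinite_max_id: assumes "e \<ge> 1" shows "infinite max_id"
proof -
  have "flag_prime 0 \<subset> flag_prime (Suc 0)" by (intro flag_prime_strict) (use assms in linarith)
  then obtain z where "z \<in> flag_prime (Suc 0)" "z \<notin> flag_prime 0" by blast
  then obtain x q where x: "z = fraction x q" "x \<in> C" "q \<in> C" "q t0 \<noteq> 0" "\<forall>t\<in>flag (Suc 0). x t = 0"
    by (auto simp: flag_prime_def)
  then have "\<not> (\<forall>t\<in>flag 0. x t = 0)" using \<open>z \<notin> flag_prime 0\<close> by (simp add: fraction_in_flag_prime)
  then obtain t where t: "x t \<noteq> 0" by blast
  have x0: "x t0 = 0" using x(5) by simp
  have "inj (\<lambda>b. fraction ((\<lambda>_. b) * x) 1)"
  proof (rule injI)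
    fix b b' assume "fraction ((\<lambda>_. b) * x) 1 = fraction ((\<lambda>_. b') * x) 1"
    then have "(\<lambda>_. b) * x * 1 = (\<lambda>_. b') * x * 1"
      using x(2) by (subst (asm) fraction_eq_iff) (auto intro: C_closed)
    from fun_cong[OF this, of t] show "b = b'" using t by simp
  qed
  then have "infinite (range (\<lambda>b. fraction ((\<lambda>_. b) * x) 1))"
    using infinite_UNIV_char_0 by (simp add: finite_image_iff)
  moreover have "range (\<lambda>b. fraction ((\<lambda>_. b) * x) 1) \<subseteq> max_id"
    using x(2) x0 by (auto simp: frac_in_max_id_iff C_closed)
  ultimately show ?thesis using finite_subset by blast
qed

text \<open>Fewer generators than the dimension suffice too, as superfluous ones can be added.\<close>
lemma nonsingularI:
  assumes "e \<ge> 1" "finite S" "genideal A S = max_id" "S \<subseteq> max_id" "card S \<le> e"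
  shows "nonsingular_at d X F"
proof -
  interpret R: cring A by (rule cring_fractions)
  have "infinite (max_id - S)" using infinite_max_id[OF assms(1)] assms(2) by simp
  then obtain T where T: "finite T" "card T = e - card S" "T \<subseteq> max_id - S"
    using infinite_arbitrarily_large by blast
  have mc: "max_id \<subseteq> carrier A" by (auto simp: max_id_def)
  have ST: "S \<union> T \<subseteq> max_id" using T assms(4) by blast
  have "genideal A (S \<union> T) \<subseteq> max_id" by (rule R.genideal_minimal[OF ideal_max_id ST])
  moreover have "S \<subseteq> genideal A (S \<union> T)" using R.genideal_self[of "S \<union> T"] ST mc by blast
  then have "genideal A S \<subseteq> genideal A (S \<union> T)"
    using R.genideal_ideal[of "S \<union> T"] ST mc by (intro R.genideal_minimal) auto
  ultimately have "genideal A (S \<union> T) = max_id" using assms(3) by blast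
  moreover have "card (S \<union> T) = e" using T assms(2,5) by (subst card_Un_disjoint) auto
  ultimately show ?thesis unfolding nonsingular_iff using ST mc T(1) assms(2)
    by (intro exI[of _ "S \<union> T"]) auto
qed

end

context even_point
begin

text \<open>Symmetrized monomials are polynomials in the power sums of the blocks, by induction on the number
  of variables: multiplying by a power sum adds one variable, up to terms in which it coincides with
  an old one.\<close>
lemma symmetrized_product_fibre_const:
  "m \<le> e \<Longrightarrow> (\<lambda>t. \<Sum>\<sigma>\<in>block_perms. \<Prod>i<m. poly (hs i) (t (\<sigma> i))) \<in> fibre_const"
proof (induction m arbitrary: hs)
  case 0
  then show ?case using fibre_const_closed(1) by simp
next
  case (Suc m)
  then have m: "m < e" by simp
  define T where "T = (\<lambda>i' t. \<Sum>\<sigma>\<in>block_perms. (\<Prod>i<m. poly (hs i) (t (\<sigma> i))) * poly (hs m) (t (\<sigma> i')))"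
  define Bm where "Bm = {i. i < e \<and> l ! i = l ! m}"
  \<comment> \<open>the indices whose variable occurs already and those with a fresh variable, which all give the same sum\<close>
  define Lo where "Lo = {i \<in> Bm. i < m}"
  define Hi where "Hi = {i \<in> Bm. m \<le> i}"
  have fin: "finite Bm" "finite Lo" "finite Hi" by (auto simp: Bm_def Lo_def Hi_def)
  have total: "(\<Sum>i'\<in>Bm. T i' t) = (\<Sum>\<sigma>\<in>block_perms. \<Prod>i<m. poly (hs i) (t (\<sigma> i))) * (\<Sum>i\<in>Bm. poly (hs m) (t i))" for t
  proof -
    have "(\<Sum>i'\<in>Bm. poly (hs m) (t (\<sigma> i'))) = (\<Sum>i\<in>Bm. poly (hs m) (t i))" if s: "\<sigma> \<in> block_perms" for \<sigma>
    proof (rule sum.reindex_bij_betw)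
      have "\<sigma> ` Bm \<subseteq> Bm" using s block_perm_less[OF s] by (auto simp: Bm_def block_perms_def)
      moreover have "inj_on \<sigma> Bm" using s by (auto simp: block_perms_def intro: permutes_inj_on)
      ultimately show "bij_betw \<sigma> Bm Bm" using endo_inj_surj[OF fin(1)] by (simp add: bij_betw_def)
    qed
    then show ?thesis unfolding T_def
      by (subst sum.swap) (simp add: sum_distrib_right flip: sum_distrib_left)
  qed
  have high: "T i' t = T m t" if "i' \<in> Hi" for i' t
  proof -
    define \<tau> where "\<tau> = transpose m i'"
    have i': "i' < e" "l ! m = l ! i'" "m \<le> i'" using that by (auto simp: Hi_def Bm_def)
    have \<tau>: "\<tau> \<in> block_perms" unfolding \<tau>_def using m i' by (intro block_perms_transpose) auto
    have \<tau>\<tau>: "\<tau> \<circ> \<tau> = id" by (simp add: \<tau>_def)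
    have *: "\<tau> i' = m" "\<And>i. i < m \<Longrightarrow> \<tau> i = i" using i'(3) by (auto simp: \<tau>_def transpose_def)
    show ?thesis unfolding T_def
    proof (rule sum.reindex_bij_witness[of _ "\<lambda>\<sigma>. \<sigma> \<circ> \<tau>" "\<lambda>\<sigma>. \<sigma> \<circ> \<tau>"])
      fix \<sigma> assume s: "\<sigma> \<in> block_perms"
      show "\<sigma> \<circ> \<tau> \<circ> \<tau> = \<sigma>" "\<sigma> \<circ> \<tau> \<circ> \<tau> = \<sigma>" using \<tau>\<tau> by (simp_all add: o_assoc[symmetric])
      show "\<sigma> \<circ> \<tau> \<in> block_perms" "\<sigma> \<circ> \<tau> \<in> block_perms" using s \<tau> by (auto intro: block_perms_comp)
      have "\<tau> m = i'" by (simp add: \<tau>_def)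
      then show "(\<Prod>i<m. poly (hs i) (t ((\<sigma> \<circ> \<tau>) i))) * poly (hs m) (t ((\<sigma> \<circ> \<tau>) m))
        = (\<Prod>i<m. poly (hs i) (t (\<sigma> i))) * poly (hs m) (t (\<sigma> i'))" using *(2) by simp
    qed
  qed
  have low: "T i' \<in> fibre_const" if i': "i' \<in> Lo" for i'
  proof -
    have *: "T i' t = (\<Sum>\<sigma>\<in>block_perms. \<Prod>i<m. poly ((hs(i' := hs i' * hs m)) i) (t (\<sigma> i)))" for t
    proof -
      have "(\<Prod>i<m. poly ((hs(i' := hs i' * hs m)) i) (t (\<sigma> i))) = (\<Prod>i<m. poly (hs i) (t (\<sigma> i))) * poly (hs m) (t (\<sigma> i'))" for \<sigma>
        using i' by (simp add: prod.remove[of "{..<m}" i'] Lo_def mult_ac)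
      then show ?thesis by (simp add: T_def)
    qed
    have "T i' = (\<lambda>t. \<Sum>\<sigma>\<in>block_perms. \<Prod>i<m. poly ((hs(i' := hs i' * hs m)) i) (t (\<sigma> i)))"
      by (rule ext) (rule *)
    moreover have "(\<lambda>t. \<Sum>\<sigma>\<in>block_perms. \<Prod>i<m. poly ((hs(i' := hs i' * hs m)) i) (t (\<sigma> i))) \<in> fibre_const"
      using Suc by simp
    ultimately show ?thesis by (simp only:)
  qed
  have "m \<in> Hi" using m by (simp add: Hi_def Bm_def)
  then have N: "of_nat (card Hi) \<noteq> (0::'a)" using fin by auto
  have "of_nat (card Hi) * T m t = (\<Sum>i'\<in>Bm. T i' t) - (\<Sum>i'\<in>Lo. T i' t)" for t
  proof -
    have "Bm = Lo \<union> Hi" "Lo \<inter> Hi = {}" by (auto simp: Lo_def Hi_def)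
    then have "(\<Sum>i'\<in>Bm. T i' t) = (\<Sum>i'\<in>Lo. T i' t) + (\<Sum>i'\<in>Hi. T i' t)"
      using fin by (simp add: sum.union_disjoint)
    then show ?thesis using high by simp
  qed
  then have eq: "T m t = (1 / of_nat (card Hi)) * ((\<Sum>\<sigma>\<in>block_perms. \<Prod>i<m. poly (hs i) (t (\<sigma> i))) * (\<Sum>i\<in>Bm. poly (hs m) (t i))
      + (- 1) * (\<Sum>i'\<in>Lo. T i' t))" for t
    using N by (simp add: total field_simps)
  have "(\<lambda>t. (1 / of_nat (card Hi)) * ((\<Sum>\<sigma>\<in>block_perms. \<Prod>i<m. poly (hs i) (t (\<sigma> i))) * (\<Sum>i\<in>Bm. poly (hs m) (t i))
      + (- 1) * (\<Sum>i'\<in>Lo. T i' t))) \<in> fibre_const"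
  proof (rule fibre_const_closed(3)[OF fibre_const_closed(1) fibre_const_closed(2)])
    have "(\<lambda>t. \<Sum>\<sigma>\<in>block_perms. \<Prod>i<m. poly (hs i) (t (\<sigma> i))) \<in> fibre_const" using Suc by simp
    moreover have "(\<lambda>t. \<Sum>i\<in>Bm. poly (hs m) (t i)) \<in> fibre_const" unfolding Bm_def by (rule block_sum_fibre_const)
    ultimately show "(\<lambda>t. (\<Sum>\<sigma>\<in>block_perms. \<Prod>i<m. poly (hs i) (t (\<sigma> i))) * (\<Sum>i\<in>Bm. poly (hs m) (t i))) \<in> fibre_const"
      by (rule fibre_const_closed(3))
    have "(\<lambda>t. \<Sum>i'\<in>Lo. T i' t) \<in> fibre_const" using low by (intro fibre_const_sum) auto
    then show "(\<lambda>t. (- 1) * (\<Sum>i'\<in>Lo. T i' t)) \<in> fibre_const" by (rule fibre_const_closed(3)[OF fibre_const_closed(1)])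
  qed
  then have "(\<lambda>t. T m t) \<in> fibre_const" by (simp only: eq)
  then show ?case by (simp add: T_def)
qed

lemma symmetrized_monomial_fibre_const: "symmetrize (tmono e \<alpha>) \<in> fibre_const"
proof -
  have "symmetrize (tmono e \<alpha>) = (\<lambda>t. \<Sum>\<sigma>\<in>block_perms. \<Prod>i<e. poly (monom 1 (\<alpha> ! i)) (t (\<sigma> i)))"
    by (simp add: fun_eq_iff symmetrize_def tmono_def poly_monom)
  then show ?thesis using symmetrized_product_fibre_const[of e "\<lambda>i. monom 1 (\<alpha> ! i)"] by simp
qed

text \<open>Near the point, all functions which are symmetric in the blocks are functions of the coefficients. They are
  spanned by the symmetrized monomials, which are constant on the fibre and therefore satisfy a linear
  system that can be solved by Nakayama's lemma.\<close>
lemma common_denominator: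
  obtains w where "w \<in> C" "w t0 \<noteq> 0"
    "\<And>y. y \<in> pfun e \<Longrightarrow> (\<And>\<sigma> t. \<sigma> \<in> block_perms \<Longrightarrow> y (t \<circ> \<sigma>) = y t) \<Longrightarrow> w * y \<in> C"
proof -
  define M :: 'a where "M = of_nat (card block_perms)"
  have M: "M \<noteq> 0" using finite_block_perms id_block_perms by (auto simp: M_def)
  define v where "v = (\<lambda>\<alpha>. symmetrize (tmono e \<alpha>))"
  have "\<exists>m. (\<forall>\<beta>. m \<beta> \<in> C \<and> m \<beta> t0 = 0) \<and> (\<forall>t. v \<alpha> t - v \<alpha> t0 = (\<Sum>\<beta>\<in>exps d e. m \<beta> t * tmono e \<beta> t))" for \<alpha>
  proof -
    have "(\<lambda>t. v \<alpha> t - v \<alpha> t0) \<in> fibre_ideal"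
      using symmetrized_monomial_fibre_const[of \<alpha>] by (simp add: v_def fibre_const_def)
    from fibre_ideal_expansion[OF d_pos this] show ?thesis by metis
  qed
  then obtain m where m: "\<And>\<alpha> \<beta>. m \<alpha> \<beta> \<in> C" "\<And>\<alpha> \<beta>. m \<alpha> \<beta> t0 = 0"
    "\<And>\<alpha> t. v \<alpha> t - v \<alpha> t0 = (\<Sum>\<beta>\<in>exps d e. m \<alpha> \<beta> t * tmono e \<beta> t)" by metis
  have eq: "(\<lambda>_. M) * v \<alpha> = (\<lambda>_. M * v \<alpha> t0) + (\<Sum>\<beta>\<in>exps d e. m \<alpha> \<beta> * v \<beta>)" for \<alpha>
  proof
    fix t
    have "v \<alpha> (t \<circ> \<sigma>) = v \<alpha> t0 + (\<Sum>\<beta>\<in>exps d e. m \<alpha> \<beta> t * tmono e \<beta> (t \<circ> \<sigma>))" if "\<sigma> \<in> block_perms" for \<sigma>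
      using m(3)[of \<alpha> "t \<circ> \<sigma>"] C_perm[OF m(1) that] by (simp add: algebra_simps)
    then have "symmetrize (v \<alpha>) t = (\<Sum>\<sigma>\<in>block_perms. v \<alpha> t0 + (\<Sum>\<beta>\<in>exps d e. m \<alpha> \<beta> t * tmono e \<beta> (t \<circ> \<sigma>)))"
      unfolding symmetrize_def by (intro sum.cong) auto
    also have "\<dots> = M * v \<alpha> t0 + (\<Sum>\<beta>\<in>exps d e. m \<alpha> \<beta> t * v \<beta> t)"
      by (simp add: sum.distrib M_def v_def symmetrize_def sum_distrib_left sum.swap[of _ "exps d e"])
    finally show "((\<lambda>_. M) * v \<alpha>) t = ((\<lambda>_. M * v \<alpha> t0) + (\<Sum>\<beta>\<in>exps d e. m \<alpha> \<beta> * v \<beta>)) t"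
      using symmetrize_symmetrize[of "tmono e \<alpha>" t] by (simp add: v_def M_def fun_sum_apply)
  qed
  have "\<exists>D\<in>C. D t0 \<noteq> 0 \<and> (\<forall>\<alpha>\<in>exps d e. D * v \<alpha> \<in> C)"
    using m(1,2) M eq by (intro nakayama_elimination[of _ "\<lambda>_. M" "\<lambda>\<alpha> _. M * v \<alpha> t0" m]) auto
  then obtain D where D: "D \<in> C" "D t0 \<noteq> 0" "\<And>\<alpha>. \<alpha> \<in> exps d e \<Longrightarrow> D * v \<alpha> \<in> C" by blast
  show ?thesis
  proof (rule that[of "(\<lambda>_. M) * D"])
    show "(\<lambda>_. M) * D \<in> C" "((\<lambda>_. M) * D) t0 \<noteq> 0" using D M by (auto intro: C_closed)
    fix y :: "(nat \<Rightarrow> 'a) \<Rightarrow> 'a" assume y: "y \<in> pfun e" "\<And>\<sigma> t. \<sigma> \<in> block_perms \<Longrightarrow> y (t \<circ> \<sigma>) = y t"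
    obtain cf where cf: "\<And>\<alpha>. cf \<alpha> \<in> C" "\<And>t. y t = (\<Sum>\<alpha>\<in>exps d e. cf \<alpha> t * tmono e \<alpha> t)"
      using pfun_finite_span[OF d_pos y(1)] unfolding finite_span_def by blast
    have "M * y t = (\<Sum>\<alpha>\<in>exps d e. cf \<alpha> t * v \<alpha> t)" for t
    proof -
      have "M * y t = (\<Sum>\<sigma>\<in>block_perms. y (t \<circ> \<sigma>))" using y(2) by (simp add: M_def)
      also have "\<dots> = (\<Sum>\<sigma>\<in>block_perms. \<Sum>\<alpha>\<in>exps d e. cf \<alpha> t * tmono e \<alpha> (t \<circ> \<sigma>))"
        using C_perm[OF cf(1)] by (simp add: cf(2))
      also have "\<dots> = (\<Sum>\<alpha>\<in>exps d e. cf \<alpha> t * v \<alpha> t)"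
        by (subst sum.swap) (simp add: v_def symmetrize_def sum_distrib_left)
      finally show ?thesis .
    qed
    then have "(\<lambda>_. M) * D * y = (\<Sum>\<alpha>\<in>exps d e. cf \<alpha> * (D * v \<alpha>))"
      by (auto simp: fun_eq_iff fun_sum_apply sum_distrib_left mult_ac)
    also have "\<dots> \<in> C" using cf(1) D(3) by (intro C_sum) (auto intro: C_closed(2))
    finally show "(\<lambda>_. M) * D * y \<in> C" .
  qed
qed

text \<open>The polynomials $\prod_{\lambda_i = r} (X - t_i)$ are monic of degree $e_r$ and have altogether $\sum_r e_r = e$ further coefficients. These
  coefficients are symmetric in the blocks, so they lie in the local ring. After subtraction of
  their values at the point they generate the maximal ideal, because all elements of \<open>C\<close> are polynomials in them.\<close>
lemma nonsingular: "nonsingular_at d X F"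
proof -
  interpret R: cring A by (rule cring_fractions)
  obtain w where w: "w \<in> C" "w t0 \<noteq> 0"
    "\<And>y. y \<in> pfun e \<Longrightarrow> (\<And>\<sigma> t. \<sigma> \<in> block_perms \<Longrightarrow> y (t \<circ> \<sigma>) = y t) \<Longrightarrow> w * y \<in> C"
    using common_denominator by blast
  define inv_fun :: "((nat \<Rightarrow> 'a) \<Rightarrow> 'a) set" where "inv_fun = {y \<in> pfun e. \<forall>\<sigma>\<in>block_perms. \<forall>t. y (t \<circ> \<sigma>) = y t}"
  have wC: "w * y \<in> C" if "y \<in> inv_fun" for y using that w(3) by (auto simp: inv_fun_def)
  have inv_closed: "(\<lambda>t. b) \<in> inv_fun" "x \<in> inv_fun \<Longrightarrow> y \<in> inv_fun \<Longrightarrow> x + y \<in> inv_fun"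
    "x \<in> inv_fun \<Longrightarrow> y \<in> inv_fun \<Longrightarrow> x * y \<in> inv_fun" "x \<in> inv_fun \<Longrightarrow> x - (\<lambda>t. b) \<in> inv_fun" for x y b
    by (auto simp: inv_fun_def plus_fun_def times_fun_def fun_diff_def)
  define factor where "factor = (\<lambda>r (t :: nat \<Rightarrow> 'a). \<Prod>i | i < e \<and> l ! i = r. [:- t i, 1:])"
  have factor_monic: "factor r t \<in> monics (count (mset l) r)" for r t
  proof -
    have "factor r t \<in> monics (\<Sum>i | i < e \<and> l ! i = r. 1)" unfolding factor_def by (intro monics_prod monics_linear)
    moreover have "card {i. i < e \<and> l ! i = r} = count (mset l) r"
      by (simp add: count_mset count_list_eq_length_filter length_filter_conv_card eq_commute[of r])
    ultimately show ?thesis by simp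
  qed
  have factor_inv: "(\<lambda>t. coeff (factor r t) j) \<in> inv_fun" for r j
  proof -
    have "(\<lambda>t. coeff (factor r t) j) \<in> pfun e"
      unfolding factor_def by (intro fun_algebra_coeff_prod fun_algebra_pfun pfun_coeff_linear) auto
    moreover have "factor r (t \<circ> \<sigma>) = factor r t" if s: "\<sigma> \<in> block_perms" for \<sigma> t
    proof -
      define B where "B = {i. i < e \<and> l ! i = r}"
      have "\<sigma> ` B \<subseteq> B" using s block_perm_less[OF s] by (auto simp: B_def block_perms_def)
      moreover have "inj_on \<sigma> B" using s by (auto simp: block_perms_def intro: permutes_inj_on)
      ultimately have "bij_betw \<sigma> B B" using endo_inj_surj[of B \<sigma>] by (simp add: bij_betw_def B_def)
      from prod.reindex_bij_betw[OF this, of "\<lambda>i. [:- t i, 1:]"] show ?thesis by (simp add: factor_def B_def)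
    qed
    ultimately show ?thesis by (simp add: inv_fun_def)
  qed
  \<comment> \<open>the element $y - y(t_0)$ of the maximal ideal\<close>
  define gen where "gen = (\<lambda>y. fraction (w * (y - (\<lambda>_. y t0))) w)"
  define S where "S = (\<lambda>(r, j). gen (\<lambda>t. coeff (factor r t) j)) ` (SIGMA r:set l. {..<count (mset l) r})"
  have "card S \<le> card (SIGMA r:set l. {..<count (mset l) r})" unfolding S_def by (intro card_image_le) auto
  also have "\<dots> = e" unfolding size_mset[symmetric] size_multiset_overloaded_eq by simp
  finally have card: "card S \<le> e" .
  have fin: "finite S" by (simp add: S_def)
  have gen_max: "gen y \<in> max_id" if "y \<in> inv_fun" for y
    unfolding gen_def using wC[OF inv_closed(4)[OF that]] w by (subst frac_in_max_id_iff) auto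
  then have S_max: "S \<subseteq> max_id" using factor_inv by (auto simp: S_def)
  have mc: "max_id \<subseteq> carrier A" by (auto simp: max_id_def)
  define J where "J = genideal A S"
  interpret J: ideal J A unfolding J_def using S_max mc by (intro R.genideal_ideal) auto
  have SJ: "S \<subseteq> J" unfolding J_def using S_max mc by (intro R.genideal_self) auto
  \<comment> \<open>the symmetric functions that are constant modulo the ideal generated by \<open>S\<close>\<close>
  define Z where "Z = {y \<in> inv_fun. gen y \<in> J}"
  have ZI: "fun_algebra Z"
    unfolding fun_algebra_def
  proof (intro conjI allI ballI)
    have "gen (\<lambda>t. b) = \<zero>\<^bsub>A\<^esub>" for b
      unfolding gen_def frac_zero using w(1,2) by (subst fraction_eq_iff) (auto simp: fun_eq_iff)
    then show "(\<lambda>t. b) \<in> Z" for b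
      using inv_closed(1) additive_subgroup.zero_closed[OF J.additive_subgroup_axioms] by (simp add: Z_def)
    fix x y assume "x \<in> Z" "y \<in> Z"
    then have x: "x \<in> inv_fun" "gen x \<in> J" and y: "y \<in> inv_fun" "gen y \<in> J" by (auto simp: Z_def)
    define D where "D = (\<lambda>z. w * (z - (\<lambda>_. z t0)))"
    have D: "D z t = w t * (z t - z t0)" for z t by (simp add: D_def)
    have DC: "D z \<in> C" if "z \<in> inv_fun" for z unfolding D_def by (rule wC[OF inv_closed(4)[OF that]])
    have gen: "gen z = fraction (D z) w" for z by (simp add: gen_def D_def)
    have xC: "D x \<in> C" and yC: "D y \<in> C" by (rule DC[OF x(1)], rule DC[OF y(1)])
    have "gen (x + y) = gen x \<oplus>\<^bsub>A\<^esub> gen y"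
      unfolding gen using w(1,2) xC yC DC[OF inv_closed(2)[OF x(1) y(1)]]
      by (auto simp: frac_add fraction_eq_iff C_closed fun_eq_iff D algebra_simps)
    then have "gen (x + y) \<in> J" using additive_subgroup.a_closed[OF J.additive_subgroup_axioms x(2) y(2)] by simp
    then show "(\<lambda>t. x t + y t) \<in> Z" using inv_closed(2)[OF x(1) y(1)] by (simp add: Z_def plus_fun_def)
    define u where "u = w * y"
    have u: "u t = w t * y t" for t by (simp add: u_def)
    have uC: "u \<in> C" unfolding u_def by (rule wC[OF y(1)])
    have "gen (x * y) = (fraction u w \<otimes>\<^bsub>A\<^esub> gen x) \<oplus>\<^bsub>A\<^esub> (fraction (\<lambda>_. x t0) 1 \<otimes>\<^bsub>A\<^esub> gen y)"
      unfolding gen using w(1,2) xC yC uC DC[OF inv_closed(3)[OF x(1) y(1)]]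
      by (auto simp: frac_mult frac_add fraction_eq_iff C_closed fun_eq_iff D u algebra_simps)
    moreover have "fraction u w \<otimes>\<^bsub>A\<^esub> gen x \<in> J" using uC w by (intro J.I_l_closed x) auto
    moreover have "fraction (\<lambda>_. x t0) 1 \<otimes>\<^bsub>A\<^esub> gen y \<in> J" by (intro J.I_l_closed y) auto
    ultimately have "gen (x * y) \<in> J" using additive_subgroup.a_closed[OF J.additive_subgroup_axioms] by simp
    then show "(\<lambda>t. x t * y t) \<in> Z" using inv_closed(3)[OF x(1) y(1)] by (simp add: Z_def times_fun_def)
  qed
  have factor_Z: "(\<lambda>t. coeff (factor r t) j) \<in> Z" if "r \<in> set l" for r j
  proof (cases "j < count (mset l) r")
    case True
    then have "gen (\<lambda>t. coeff (factor r t) j) \<in> S" using that by (auto simp: S_def intro!: image_eqI[of _ _ "(r, j)"])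
    then show ?thesis using SJ factor_inv by (auto simp: Z_def)
  next
    case False
    have "coeff (factor r t) j = (if j = count (mset l) r then 1 else 0)" for t
      using factor_monic[of r t] False by (auto simp: monics_def coeff_eq_0)
    then show ?thesis using fun_algebraD(1)[OF ZI] by simp
  qed
  have "root_prod l t = (\<Prod>r\<in>set l. factor r t ^ r)" for t
  proof -
    have "root_prod l t = (\<Prod>r\<in>set l. \<Prod>i\<in>{i \<in> {..<e}. l ! i = r}. [:- t i, 1:] ^ (l ! i))"
      unfolding root_prod_def by (subst prod.group) auto
    also have "\<dots> = (\<Prod>r\<in>set l. factor r t ^ r)"
      by (intro prod.cong refl) (simp add: factor_def prod_power_distrib)
    finally show ?thesis .
  qed
  then have "(\<lambda>t. coeff (root_prod l t) j) \<in> Z" for j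
    using fun_algebra_coeff_prod[OF ZI, of "set l" "\<lambda>r t. factor r t ^ r" j] fun_algebra_coeff_power[OF ZI factor_Z] by simp
  then have CZ: "C \<subseteq> Z" by (intro coeff_algebra_least ZI)
  have "max_id \<subseteq> J"
  proof
    fix z assume "z \<in> max_id"
    then obtain x q where x: "z = fraction x q" "x \<in> C" "q \<in> C" "q t0 \<noteq> 0" "x t0 = 0" by (auto simp: max_id_def)
    have "gen x = fraction x 1"
    proof -
      have "x - (\<lambda>_. x t0) = x" using x(5) by (simp add: fun_eq_iff)
      then show ?thesis unfolding gen_def using w x C_closed(2)[OF w(1) x(2)]
        by (simp add: fraction_eq_iff mult.commute)
    qed
    then have "fraction x 1 \<in> J" using CZ x(2) by (auto simp: Z_def)
    then have "fraction 1 q \<otimes>\<^bsub>A\<^esub> fraction x 1 \<in> J" using x by (intro J.I_l_closed) auto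
    then show "z \<in> J" using x by (simp add: frac_mult)
  qed
  moreover have "J \<subseteq> max_id" unfolding J_def by (rule R.genideal_minimal[OF ideal_max_id S_max])
  ultimately have "genideal A S = max_id" by (simp add: J_def)
  moreover have "e \<ge> 1" using partition_ofD(4)[OF part] d_pos by (cases l) auto
  ultimately show ?thesis using nonsingularI fin S_max card by blast
qed

end

section \<open>Nonsingular points, fibres and tangent maps of coincident root loci\<close>

lemma exists_singular_tangent_map_iff:
  fixes a :: "nat \<Rightarrow> 'a::{alg_closed_field, field_char_0}"
  assumes "partition_of d lam" "partition_of d (mset mu)" "inj_on a {..<length mu}"
  shows "(\<exists>GG\<in>fibre d lam (pt d c (root_prod mu a)). \<not> inj_on (df_map d) (tangent_Y d lam GG)) \<longleftrightarrow>
    (\<exists>\<delta>\<in>splittings mu lam. \<exists>k<length mu. \<not> even_partition (\<delta> ! k))"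
proof -
  have mon: "root_prod mu a \<in> monics d"
    using root_prod_monic[of mu a] partition_ofD(4)[OF assms(2)] by (simp add: sum_mset_sum_list)
  have "fibre d lam (pt d c (root_prod mu a)) = (\<lambda>\<delta>. Y_pt d lam c (split_factors d (length mu) a \<delta>)) ` splittings mu lam"
    unfolding fibre_chart[OF assms(1) mon] bij_betw_imp_surj_on[OF split_factors_bij[OF assms], symmetric]
    by (rule image_image)
  then show ?thesis using tangent_map_injective_iff[OF assms] by auto
qed

lemma (in locus_chart) nonsingular_if_unique_even_splitting:
  assumes start: "root_prod l t0 = root_prod mu a" and inj: "inj_on a {..<length mu}"
    and "partition_of d (mset mu)" "d \<ge> 1"
    and \<delta>: "splittings mu (mset l) = {\<delta>}" "\<forall>k<length mu. even_partition (\<delta> ! k)"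
  shows "nonsingular_at d X F"
proof -
  have l0: "0 \<notin> set l" using partition_ofD(3)[OF part] by simp
  define \<rho> where "\<rho> = (\<lambda>k. SOME r. r \<in># \<delta> ! k)"
  have \<rho>: "l ! i = \<rho> (\<kappa> i)" if \<kappa>: "\<kappa> \<in> assignments l mu" and i: "i < e" for \<kappa> i
  proof -
    have "split_of l (length mu) \<kappa> \<in> splittings mu (mset l)" unfolding splittings_eq[OF l0] using \<kappa> by blast
    then have eq: "\<delta> = split_of l (length mu) \<kappa>" using \<delta>(1) by simp
    have k: "\<kappa> i < length mu" using \<kappa> i by (auto simp: assignments_def)
    then have m: "l ! i \<in># \<delta> ! \<kappa> i" using i by (simp add: eq split_of_def)
    then have "\<rho> (\<kappa> i) \<in># \<delta> ! \<kappa> i" unfolding \<rho>_def by (rule someI)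
    then show ?thesis using m \<delta>(2) k unfolding even_partition_def by blast
  qed
  interpret even_point d l c t0 mu a \<rho>
    by unfold_locales (use assms \<rho> partition_ofD(3)[OF assms(3)] in auto)
  show ?thesis by (rule nonsingular)
qed

theorem proposition2p1:
  fixes d :: nat and lam :: "nat multiset" and mu :: "nat list"
    and F :: "'a::{alg_closed_field, field_char_0} poly poly set"
  assumes "d \<ge> 1"
    and "partition_of d lam"
    and "F \<in> X_locus d lam"
    and "coarsening (mset mu) lam"
    and "F \<in> X_open d (mset mu)"
  shows "(nonsingular_at d (X_locus d lam) F \<longleftrightarrow>
            (\<exists>\<delta>. splittings mu lam = {\<delta>} \<and> (\<forall>k<length mu. even_partition (\<delta> ! k)))) \<and>
         (finite (fibre d lam F) \<and> card (fibre d lam F) = card (splittings mu lam)) \<and>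
         ((\<exists>GG\<in>fibre d lam F. \<not> inj_on (df_map d) (tangent_Y d lam GG)) \<longleftrightarrow>
            (\<exists>\<delta>\<in>splittings mu lam. \<exists>k<length mu. \<not> even_partition (\<delta> ! k)))"
proof -
  have mu: "partition_of d (mset mu)" by (rule partition_of_coarsening[OF assms(2,4)])
  obtain l where l: "mset l = lam" using ex_mset by blast
  have lam: "partition_of d (mset l)" using assms(2) l by simp
  obtain c f where f: "f \<in> monics d" "F = pt d c f"
    using exists_chart_point[OF X_locus_proj[OF assms(2,3)]] .
  obtain a where a: "f = root_prod mu a" "inj_on a {..<length mu}"
    using X_open_distinct_roots[OF mu f(1) assms(5)[unfolded f(2)]] .
  obtain t0 where t0: "f = root_prod l t0"
    using X_locus_chart[OF lam f(1), of c] assms(3) f(2) l by auto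
  interpret locus_chart d l c t0 by unfold_locales (rule lam)
  have start: "root_prod l t0 = root_prod mu a" using a(1) t0 by simp
  have "nonsingular_at d (X_locus d lam) F \<longleftrightarrow>
      (\<exists>\<delta>. splittings mu lam = {\<delta>} \<and> (\<forall>k<length mu. even_partition (\<delta> ! k)))"
    using unique_even_splitting_if_nonsingular[OF _ assms(1) start a(2)]
      nonsingular_if_unique_even_splitting[OF start a(2) mu assms(1)]
    unfolding l f(2) t0 by blast
  moreover have "finite (fibre d lam F)" "card (fibre d lam F) = card (splittings mu lam)"
    using card_fibre[OF assms(2) mu a(2)] unfolding f(2) a(1) by blast+
  moreover have "(\<exists>GG\<in>fibre d lam F. \<not> inj_on (df_map d) (tangent_Y d lam GG)) \<longleftrightarrow>
      (\<exists>\<delta>\<in>splittings mu lam. \<exists>k<length mu. \<not> even_partition (\<delta> ! k))"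
    unfolding f(2) a(1) by (rule exists_singular_tangent_map_iff[OF assms(2) mu a(2)])
  ultimately show ?thesis by blast
qed

end
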